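(* Let $\mathcal M$ be a quasianalytic regular weight sequence of moderate growth, $\Omega\subseteq\mathbb R^n$ open, $P$ a linear partial differential operator on $\Omega$ with coefficients in $\mathcal E_{\mathcal M}(\Omega)$, and $u\in\mathcal D'(\Omega)$ with $Pu=0$. Then $\overline{N(\operatorname{supp}u)}\subseteq\mathrm{Char}\,P$, i.e. the principal symbol of $P$ vanishes on $N(\operatorname{supp}u)$.
   Context: Weight sequence: $(M_j)$, $M_j>0$, $M_0=1$, $M_j^2\le M_{j-1}M_{j+1}$; $m_k=M_k/k!$; regular: $m_0=m_1=1$, $\sup_k(m_{k+1}/m_k)^{1/k}<\infty$, $m_k^2\le m_{k-1}m_{k+1}$, $m_k^{1/k}\to\infty$; quasianalytic: $\sum_kM_{k-1}/M_k=\infty$; moderate growth: $M_{j+k}\le C\rho^{j+k}M_jM_k$. $\mathcal E_{\mathcal M}(\Omega)$: smooth $f$ with $|D^\alpha f|\le Ch^{|\alpha|}M_{|\alpha|}$ on each compact. For $P=\sum_{|\alpha|\le m}a_\alpha(x)D^\alpha$ of order $m$, the principal symbol is $p_m(x,\xi)=\sum_{|\alpha|=m}a_\alpha(x)\xi^\alpha$ and $\mathrm{Char}\,P=\{(x,\xi)\in T^*\Omega\setminus0:p_m(x,\xi)=0\}$. For closed $F$: $N_e(F)$ is the set of $(x_0,\xi_0)$, $x_0\in F$, such that some real $f\in\mathcal C^2(\Omega)$ has $df(x_0)=\xi_0\ne0$ and $f\le f(x_0)$ on $F$; $N_i(F)=\{(x,\xi):(x,-\xi)\in N_e(F)\}$;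 $N(F)=N_e(F)\cup N_i(F)$. *)

theory Defs
  imports "HOL-Analysis.Analysis"
begin

definition weight_sequence :: "(nat \<Rightarrow> real) \<Rightarrow> bool" where
  "weight_sequence M \<longleftrightarrow> (\<forall>j. M j > 0) \<and> M 0 = 1 \<and>
     (\<forall>j\<ge>1. (M j)\<^sup>2 \<le> M (j - 1) * M (j + 1))"

definition small_m :: "(nat \<Rightarrow> real) \<Rightarrow> nat \<Rightarrow> real" where
  "small_m M k = M k / fact k"

definition regular_weight :: "(nat \<Rightarrow> real) \<Rightarrow> bool" where
  "regular_weight M \<longleftrightarrow> weight_sequence M \<and>
     small_m M 0 = 1 \<and> small_m M 1 = 1 \<and>
     (\<exists>B. \<forall>k\<ge>1. (small_m M (k + 1) / small_m M k) powr (1 / real k) \<le> B) \<and>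
     (\<forall>k\<ge>1. (small_m M k)\<^sup>2 \<le> small_m M (k - 1) * small_m M (k + 1)) \<and>
     filterlim (\<lambda>k. small_m M k powr (1 / real k)) at_top sequentially"

definition quasianalytic_weight :: "(nat \<Rightarrow> real) \<Rightarrow> bool" where
  "quasianalytic_weight M \<longleftrightarrow> \<not> summable (\<lambda>k. M k / M (Suc k))"

definition moderate_growth :: "(nat \<Rightarrow> real) \<Rightarrow> bool" where
  "moderate_growth M \<longleftrightarrow> (\<exists>C \<rho>. \<forall>j k. M (j + k) \<le> C * \<rho> ^ (j + k) * M j * M k)"

definition pd :: "'n::finite \<Rightarrow> (real^'n \<Rightarrow> 'b::real_normed_vector) \<Rightarrow> real^'n \<Rightarrow> 'b" where
  "pd i f x = vector_derivative (\<lambda>t. f (x + t *\<^sub>R axis i 1)) (at 0)"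

fun pds :: "'n::finite list \<Rightarrow> (real^'n \<Rightarrow> 'b::real_normed_vector) \<Rightarrow> real^'n \<Rightarrow> 'b" where
  "pds [] f = f"
| "pds (i # is) f = pd i (pds is f)"

definition smooth_on :: "(real^'n::finite) set \<Rightarrow> (real^'n \<Rightarrow> 'b::real_normed_vector) \<Rightarrow> bool" where
  "smooth_on S f \<longleftrightarrow> (\<forall>is. (\<forall>x\<in>S. \<forall>i. (\<lambda>t. pds is f (x + t *\<^sub>R axis i 1)) differentiable (at 0))
                          \<and> continuous_on S (pds is f))"

definition C2_on :: "(real^'n::finite) set \<Rightarrow> (real^'n \<Rightarrow> 'b::real_normed_vector) \<Rightarrow> bool" where
  "C2_on S f \<longleftrightarrow> (\<forall>is. length is \<le> 1 \<longrightarrow>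
                       (\<forall>x\<in>S. \<forall>i. (\<lambda>t. pds is f (x + t *\<^sub>R axis i 1)) differentiable (at 0))) \<and>
                 (\<forall>is. length is \<le> 2 \<longrightarrow> continuous_on S (pds is f))"

definition mlen :: "('n::finite \<Rightarrow> nat) \<Rightarrow> nat" where
  "mlen \<alpha> = (\<Sum>i\<in>UNIV. \<alpha> i)"

definition dpart :: "('n::finite \<Rightarrow> nat) \<Rightarrow> (real^'n \<Rightarrow> 'b::real_normed_vector) \<Rightarrow> real^'n \<Rightarrow> 'b" where
  "dpart \<alpha> f = pds (SOME is. \<forall>i. count_list is i = \<alpha> i) f"

text \<open>D^alpha with D_j = -i d/dx_j.\<close>
definition Dop :: "('n::finite \<Rightarrow> nat) \<Rightarrow> (real^'n \<Rightarrow> complex) \<Rightarrow> real^'n \<Rightarrow> complex" where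
  "Dop \<alpha> f x = (- \<i>) ^ mlen \<alpha> * dpart \<alpha> f x"

definition E_M :: "(nat \<Rightarrow> real) \<Rightarrow> (real^'n::finite) set \<Rightarrow> (real^'n \<Rightarrow> complex) \<Rightarrow> bool" where
  "E_M M \<Omega> f \<longleftrightarrow> smooth_on \<Omega> f \<and>
     (\<forall>K. compact K \<and> K \<subseteq> \<Omega> \<longrightarrow>
        (\<exists>C h. C > 0 \<and> h > 0 \<and>
           (\<forall>\<alpha>. \<forall>x\<in>K. norm (Dop \<alpha> f x) \<le> C * h ^ mlen \<alpha> * M (mlen \<alpha>))))"

definition tsupp :: "(real^'n::finite \<Rightarrow> 'b::zero) \<Rightarrow> (real^'n) set" where
  "tsupp \<phi> = closure {x. \<phi> x \<noteq> 0}"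

definition test_fun :: "(real^'n::finite) set \<Rightarrow> (real^'n \<Rightarrow> complex) \<Rightarrow> bool" where
  "test_fun \<Omega> \<phi> \<longleftrightarrow> smooth_on UNIV \<phi> \<and> compact (tsupp \<phi>) \<and> tsupp \<phi> \<subseteq> \<Omega>"

definition distribution :: "(real^'n::finite) set \<Rightarrow> ((real^'n \<Rightarrow> complex) \<Rightarrow> complex) \<Rightarrow> bool" where
  "distribution \<Omega> u \<longleftrightarrow>
     (\<forall>\<phi> \<psi>. test_fun \<Omega> \<phi> \<longrightarrow> test_fun \<Omega> \<psi> \<longrightarrow> u (\<lambda>x. \<phi> x + \<psi> x) = u \<phi> + u \<psi>) \<and>
     (\<forall>c \<phi>. test_fun \<Omega> \<phi> \<longrightarrow> u (\<lambda>x. c * \<phi> x) = c * u \<phi>) \<and>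
     (\<forall>K. compact K \<and> K \<subseteq> \<Omega> \<longrightarrow>
        (\<exists>C k. \<forall>\<phi> B. test_fun \<Omega> \<phi> \<and> tsupp \<phi> \<subseteq> K \<and>
                 (\<forall>is x. length is \<le> k \<longrightarrow> norm (pds is \<phi> x) \<le> B)
                 \<longrightarrow> norm (u \<phi>) \<le> C * B))"

definition dsupp :: "(real^'n::finite) set \<Rightarrow> ((real^'n \<Rightarrow> complex) \<Rightarrow> complex) \<Rightarrow> (real^'n) set" where
  "dsupp \<Omega> u = \<Omega> - \<Union>{V. open V \<and> V \<subseteq> \<Omega> \<and>
                         (\<forall>\<phi>. test_fun \<Omega> \<phi> \<and> tsupp \<phi> \<subseteq> V \<longrightarrow> u \<phi> = 0)}"

text \<open>P = sum_{|alpha| <= m} a_alpha(x) D^alpha, coefficients a alpha defined on Omega.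
  The formal transpose applied to a test function:
  P^t phi = sum_{|alpha| <= m} (-1)^{|alpha|} D^alpha (a_alpha phi) (extended by 0 outside Omega).\<close>
definition transp :: "nat \<Rightarrow> (('n::finite \<Rightarrow> nat) \<Rightarrow> real^'n \<Rightarrow> complex) \<Rightarrow> (real^'n) set
                       \<Rightarrow> (real^'n \<Rightarrow> complex) \<Rightarrow> real^'n \<Rightarrow> complex" where
  "transp m a \<Omega> \<phi> x = (\<Sum>\<alpha>\<in>{\<alpha>. mlen \<alpha> \<le> m}.
       (-1) ^ mlen \<alpha> * Dop \<alpha> (\<lambda>y. if y \<in> \<Omega> then a \<alpha> y * \<phi> y else 0) x)"

definition solves :: "nat \<Rightarrow> (('n::finite \<Rightarrow> nat) \<Rightarrow> real^'n \<Rightarrow> complex) \<Rightarrow> (real^'n) set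
                       \<Rightarrow> ((real^'n \<Rightarrow> complex) \<Rightarrow> complex) \<Rightarrow> bool" where
  "solves m a \<Omega> u \<longleftrightarrow> (\<forall>\<phi>. test_fun \<Omega> \<phi> \<longrightarrow> u (transp m a \<Omega> \<phi>) = 0)"

definition principal_symbol :: "nat \<Rightarrow> (('n::finite \<Rightarrow> nat) \<Rightarrow> real^'n \<Rightarrow> complex) \<Rightarrow> real^'n \<Rightarrow> real^'n \<Rightarrow> complex" where
  "principal_symbol m a x \<xi> = (\<Sum>\<alpha>\<in>{\<alpha>. mlen \<alpha> = m}. a \<alpha> x * (\<Prod>i\<in>UNIV. complex_of_real (\<xi> $ i) ^ \<alpha> i))"

definition Char :: "nat \<Rightarrow> (('n::finite \<Rightarrow> nat) \<Rightarrow> real^'n \<Rightarrow> complex) \<Rightarrow> (real^'n) set \<Rightarrow> ((real^'n) \<times> (real^'n)) set" where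
  "Char m a \<Omega> = {(x, \<xi>). x \<in> \<Omega> \<and> \<xi> \<noteq> 0 \<and> principal_symbol m a x \<xi> = 0}"

definition N_e :: "(real^'n::finite) set \<Rightarrow> (real^'n) set \<Rightarrow> ((real^'n) \<times> (real^'n)) set" where
  "N_e \<Omega> F = {(x0, \<xi>0). x0 \<in> F \<and> \<xi>0 \<noteq> 0 \<and>
      (\<exists>f :: real^'n \<Rightarrow> real. C2_on \<Omega> f \<and> (\<forall>i. \<xi>0 $ i = pd i f x0) \<and> (\<forall>y\<in>F. f y \<le> f x0))}"

definition N_i :: "(real^'n::finite) set \<Rightarrow> (real^'n) set \<Rightarrow> ((real^'n) \<times> (real^'n)) set" where
  "N_i \<Omega> F = {(x, \<xi>). (x, - \<xi>) \<in> N_e \<Omega> F}"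

definition N_normal :: "(real^'n::finite) set \<Rightarrow> (real^'n) set \<Rightarrow> ((real^'n) \<times> (real^'n)) set" where
  "N_normal \<Omega> F = N_e \<Omega> F \<union> N_i \<Omega> F"

end

theory Submission
  imports Defs
begin

text \<open>Suppose \<open>f \<le> f x0\<close> on the support of \<open>u\<close> and \<open>p\<^sub>m(x0, df(x0)) \<noteq> 0\<close>. Taylor's formula gives a
  quadratic \<open>\<rho>\<close> with \<open>\<rho> x0 = 0\<close>, \<open>d\<rho>(x0) = df(x0)\<close> and \<open>\<rho> \<le> - C |x - x0|\<^sup>2\<close> on the support near \<open>x0\<close>.
  For a smooth function \<open>\<eta>\<close> vanishing exactly on the negative half line, the equation \<open>Pu = 0\<close> tested
  with \<open>\<eta>\<^sup>(\<^sup>N\<^sup>)(s + \<rho>) \<psi> / p\<^sub>m(x, d\<rho>)\<close> expresses \<open>\<langle>u, \<eta>\<^sup>(\<^sup>N\<^sup>+\<^sup>m\<^sup>)(s + \<rho>) \<psi>\<rangle>\<close> through the terms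
  \<open>\<langle>u, \<eta>\<^sup>(\<^sup>N\<^sup>+\<^sup>j\<^sup>)(s + \<rho>) Q\<^sub>j \<psi>\<rangle>\<close> with \<open>j < m\<close> and \<open>Q\<^sub>j\<close> of order at most \<open>m - j\<close>. Iterating,
  and using \<open>m\<^sub>j m\<^sub>k \<le> m\<^sub>j\<^sub>+\<^sub>k\<close> to control the products, shows that \<open>s \<mapsto> \<langle>u, \<eta>(s + \<rho>) \<psi>\<rangle>\<close> belongs to
  the class of the weight sequence for every polynomial \<open>\<psi>\<close>. It vanishes for \<open>s < 0\<close>, hence identically by the
  Denjoy-Carleman theorem, and density of the polynomials gives \<open>u = 0\<close> near \<open>x0\<close>.\<close>

text \<open>A quasianalytic class contains no cutoff functions, so neither \<open>\<kappa>\<close>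
  nor \<open>eta\<close> can belong to it, and neither has to. The strict bound on
  \<open>\<rho>\<close> leaves, for small \<open>s\<close>, only support points with
  \<open>s + \<rho> \<ge> 0\<close> that are close to \<open>x0\<close>, where
  \<open>\<kappa> = 1\<close>; hence the cutoff commutes with the operator under \<open>u\<close>,
  and its derivatives never enter the estimates of high order. Likewise the recursion brings every
  order \<open>n\<close> down to orders below \<open>m\<close>, so only a fixed number of
  derivatives of \<open>eta\<close> is ever bounded; the regularity in \<open>s\<close> comes from
  the coefficients, from \<open>\<rho>\<close> and from \<open>\<psi>\<close>. This is why
  \<open>\<psi>\<close> has to be in the class, whence polynomials, and why a polynomial
  \<open>\<rho>\<close> replaces \<open>f\<close>. The recursion is applied up to \<open>n\<close>
  times, which may multiply constants but must not enlarge the radius \<open>h\<close>: Leibniz'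
  rule has to absorb its binomial coefficients with a factor independent of the order of
  differentiation. Finally \<open>u\<close> has finite order \<open>k0\<close> on a compact set,
  which turns \<open>M n\<close> into \<open>M (n + k0)\<close>; moderate growth undoes
  this.\<close>

section \<open>Iterated partial derivatives\<close>

definition has_pd :: "'n::finite \<Rightarrow> (real^'n \<Rightarrow> 'b::real_normed_vector) \<Rightarrow> 'b \<Rightarrow> real^'n \<Rightarrow> bool" where
  "has_pd i f D x \<longleftrightarrow> ((\<lambda>t. f (x + t *\<^sub>R axis i 1)) has_vector_derivative D) (at (0::real))"

lemma has_pd_imp_pd: "has_pd i f D x \<Longrightarrow> pd i f x = D"
  unfolding has_pd_def pd_def by (rule vector_derivative_at)

lemma has_pd_iff_differentiable:
  "(\<lambda>t. f (x + t *\<^sub>R axis i 1)) differentiable (at 0) \<longleftrightarrow> has_pd i f (pd i f x) x"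
  unfolding has_pd_def pd_def by (rule vector_derivative_works)

lemma has_pd_cong_imp:
  assumes "open S" "x \<in> S" "\<And>y. y \<in> S \<Longrightarrow> f y = g y" "has_pd i f D x"
  shows "has_pd i g D x"
proof -
  let ?T = "(\<lambda>t::real. x + t *\<^sub>R axis i 1) -` S"
  have "open ?T"
    by (intro open_vimage assms continuous_intros)
  with assms show ?thesis
    unfolding has_pd_def by (auto intro: has_vector_derivative_transform_within_open[where S="?T"])
qed

lemma has_pd_cong:
  assumes "open S" "x \<in> S" "\<And>y. y \<in> S \<Longrightarrow> f y = g y"
  shows "has_pd i f D x = has_pd i g D x"
  using has_pd_cong_imp[OF assms(1,2), of f g] has_pd_cong_imp[OF assms(1,2), of g f] assms(3) by metis

lemma pd_cong:
  assumes "open S" "x \<in> S" "\<And>y. y \<in> S \<Longrightarrow> f y = g y"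
  shows "pd i f x = pd i g x"
  using has_pd_cong[OF assms(1,2), of f g i] assms(3)
  unfolding pd_def vector_derivative_def has_pd_def by simp

lemma pds_cong:
  assumes "open S" "x \<in> S" "\<And>y. y \<in> S \<Longrightarrow> f y = g y"
  shows "pds is f x = pds is g x"
  using assms(2)
proof (induction "is" arbitrary: x)
  case (Cons i "is")
  then show ?case using pd_cong[OF assms(1), of x "pds is f" "pds is g"] by simp
qed (simp add: assms)

lemma pds_append: "pds (is @ js) f = pds is (pds js f)"
  by (induction "is") auto

lemma pds_snoc: "pds (is @ [i]) f = pds is (pd i f)"
  by (simp add: pds_append)

lemma has_pd_const: "has_pd i (\<lambda>x. c) 0 x"
  unfolding has_pd_def by (rule has_vector_derivative_const)

lemma has_pd_add:
  "has_pd i f D x \<Longrightarrow> has_pd i g E x \<Longrightarrow> has_pd i (\<lambda>x. f x + g x) (D + E) x"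
  unfolding has_pd_def by (rule has_vector_derivative_add)

lemma has_pd_mult:
  fixes f g :: "real^'n::finite \<Rightarrow> 'b::real_normed_algebra"
  shows "has_pd i f D x \<Longrightarrow> has_pd i g E x \<Longrightarrow> has_pd i (\<lambda>x. f x * g x) (f x * E + D * g x) x"
  unfolding has_pd_def
  by (drule (1) has_vector_derivative_mult) simp

lemma has_pd_linear:
  "bounded_linear L \<Longrightarrow> has_pd i f D x \<Longrightarrow> has_pd i (\<lambda>x. L (f x)) (L D) x"
  unfolding has_pd_def by (rule bounded_linear.has_vector_derivative)

lemma has_pd_component: "has_pd i (\<lambda>x. x $ j) (if i = j then 1 else 0) x"
  unfolding has_pd_def
  by (auto intro!: derivative_eq_intros simp: axis_def has_real_derivative_iff_has_vector_derivative[symmetric])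

lemma has_pd_compose:
  fixes f :: "real^'n::finite \<Rightarrow> real"
  assumes "(g has_vector_derivative E) (at (f x))" "has_pd i f D x"
  shows "has_pd i (\<lambda>x. g (f x)) (D *\<^sub>R E) x"
proof -
  have "(g has_vector_derivative E) (at (f (x + 0 *\<^sub>R axis i 1)))" using assms(1) by simp
  from vector_diff_chain_at[OF assms(2)[unfolded has_pd_def] this]
  show ?thesis unfolding has_pd_def o_def .
qed

lemma has_pd_inverse:
  fixes f :: "real^'n::finite \<Rightarrow> complex"
  assumes "has_pd i f D x" "f x \<noteq> 0"
  shows "has_pd i (\<lambda>x. inverse (f x)) (- (inverse (f x) * D * inverse (f x))) x"
proof -
  have "((\<lambda>t. inverse (f (x + t *\<^sub>R axis i 1))) has_derivative
     (\<lambda>h. - (inverse (f (x + 0 *\<^sub>R axis i 1)) * (h *\<^sub>R D) * inverse (f (x + 0 *\<^sub>R axis i 1))))) (at 0)"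
    by (intro Deriv.has_derivative_inverse) 
       (use assms in \<open>auto simp: has_pd_def has_vector_derivative_def\<close>)
  then show ?thesis
    unfolding has_pd_def has_vector_derivative_def by (simp add: scaleR_conv_of_real mult_ac)
qed

text \<open>The recursion takes the innermost derivative first, so inductions on \<open>k\<close>
  can generalize over \<open>f\<close>; \<open>pds\<close> instead adds the outermost one.
  \<open>Ck_iff_pds\<close> reconciles the two by splitting lists at their end.\<close>

fun Ck :: "nat \<Rightarrow> (real^'n::finite) set \<Rightarrow> (real^'n \<Rightarrow> 'b::real_normed_vector) \<Rightarrow> bool" where
  "Ck 0 S f \<longleftrightarrow> continuous_on S f"
| "Ck (Suc k) S f \<longleftrightarrow> continuous_on S f \<and> (\<forall>x\<in>S. \<forall>i. has_pd i f (pd i f x) x) \<and> (\<forall>i. Ck k S (pd i f))"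

lemma Ck_iff_pds:
  "Ck k S f \<longleftrightarrow> (\<forall>is. length is \<le> k \<longrightarrow> continuous_on S (pds is f)) \<and>
     (\<forall>is. length is < k \<longrightarrow> (\<forall>x\<in>S. \<forall>i. has_pd i (pds is f) (pd i (pds is f) x) x))"
proof (induction k arbitrary: f)
  case (Suc k)
  show ?case (is "?L \<longleftrightarrow> ?R1 \<and> ?R2")
  proof
    assume L: ?L
    have "continuous_on S (pds is f)" if "length is \<le> Suc k" for "is"
      by (cases "is" rule: rev_cases) (use L Suc that in \<open>auto simp: pds_snoc\<close>)
    moreover have "has_pd i (pds is f) (pd i (pds is f) x) x"
      if "length is < Suc k" "x \<in> S" for "is" x i
      by (cases "is" rule: rev_cases) (use L Suc that in \<open>auto simp: pds_snoc\<close>)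
    ultimately show "?R1 \<and> ?R2" by blast
  next
    assume R: "?R1 \<and> ?R2"
    then have R1: "\<And>is. length is \<le> Suc k \<Longrightarrow> continuous_on S (pds is f)"
      and R2: "\<And>is x i. length is < Suc k \<Longrightarrow> x \<in> S \<Longrightarrow> has_pd i (pds is f) (pd i (pds is f) x) x"
      by blast+
    have "Ck k S (pd i f)" for i
      unfolding Suc
      using R1[of "_ @ [i]"] R2[of "_ @ [i]"] by (auto simp: pds_snoc)
    then show ?L using R1[of "[]"] R2[of "[]"] by auto
  qed
qed auto

lemma smooth_on_iff_Ck: "smooth_on S f \<longleftrightarrow> (\<forall>k. Ck k S f)"
  unfolding smooth_on_def Ck_iff_pds has_pd_iff_differentiable using le_refl lessI by blast

lemma C2_on_iff_Ck: "C2_on S f \<longleftrightarrow> Ck 2 S f"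
  unfolding C2_on_def Ck_iff_pds has_pd_iff_differentiable by auto

lemma smooth_on_unfold:
  "smooth_on S f \<longleftrightarrow> continuous_on S f \<and> (\<forall>x\<in>S. \<forall>i. has_pd i f (pd i f x) x) \<and> (\<forall>i. smooth_on S (pd i f))"
proof -
  have "smooth_on S f \<longleftrightarrow> (\<forall>k. Ck (Suc k) S f) \<and> Ck 0 S f"
    unfolding smooth_on_iff_Ck by (metis not0_implies_Suc)
  also have "\<dots> \<longleftrightarrow> continuous_on S f \<and> (\<forall>x\<in>S. \<forall>i. has_pd i f (pd i f x) x) \<and> (\<forall>i. smooth_on S (pd i f))"
    unfolding smooth_on_iff_Ck by auto
  finally show ?thesis .
qed

lemma smooth_on_continuous: "smooth_on S f \<Longrightarrow> continuous_on S f"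
  using smooth_on_unfold by blast

lemma smooth_on_has_pd: "smooth_on S f \<Longrightarrow> x \<in> S \<Longrightarrow> has_pd i f (pd i f x) x"
  using smooth_on_unfold by blast

lemma smooth_on_pd: "smooth_on S f \<Longrightarrow> smooth_on S (pd i f)"
  using smooth_on_unfold by blast

lemma smooth_on_pds: "smooth_on S f \<Longrightarrow> smooth_on S (pds is f)"
  by (induction "is") (auto intro: smooth_on_pd)

lemma smooth_on_subset: "smooth_on S f \<Longrightarrow> T \<subseteq> S \<Longrightarrow> smooth_on T f"
  unfolding smooth_on_def by (meson continuous_on_subset subsetD)

lemma smooth_on_Un:
  "open S \<Longrightarrow> open T \<Longrightarrow> smooth_on S f \<Longrightarrow> smooth_on T f \<Longrightarrow> smooth_on (S \<union> T) f"
  unfolding smooth_on_def by (auto intro: continuous_on_open_Un)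

lemma Ck_cong:
  assumes "open S" "\<And>y. y \<in> S \<Longrightarrow> f y = g y" "Ck k S f"
  shows "Ck k S g"
  using assms(2,3)
proof (induction k arbitrary: f g)
  case 0
  then show ?case using continuous_on_cong[of S S f g] by simp
next
  case (Suc k)
  have pd: "pd i f y = pd i g y" if "y \<in> S" for y i
    using pd_cong[OF assms(1) that] Suc.prems(1) by blast
  have "continuous_on S g"
    using Suc.prems continuous_on_cong[of S S f g] by simp
  moreover have "has_pd i g (pd i g x) x" if "x \<in> S" for x i
    using has_pd_cong_imp[OF assms(1) that Suc.prems(1)] Suc.prems(2) pd that by fastforce
  moreover have "Ck k S (pd i g)" for i
    using Suc.IH[of "pd i f" "pd i g"] pd Suc.prems(2) by simp
  ultimately show ?case by simp
qed

lemma smooth_on_cong: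
  assumes "open S" "\<And>y. y \<in> S \<Longrightarrow> f y = g y" "smooth_on S f"
  shows "smooth_on S g"
  using Ck_cong[OF assms(1), of f g] assms(2,3) unfolding smooth_on_iff_Ck by blast

lemma Ck_Suc_imp: "Ck (Suc k) S f \<Longrightarrow> Ck k S f"
  unfolding Ck_iff_pds by auto

lemma Ck_SucI:
  assumes "open S" "continuous_on S f" "\<And>x i. x \<in> S \<Longrightarrow> has_pd i f (D i x) x" "\<And>i. Ck k S (D i)"
  shows "Ck (Suc k) S f"
proof -
  have "pd i f x = D i x" if "x \<in> S" for i x
    using has_pd_imp_pd assms(3)[OF that] by blast
  then show ?thesis
    using assms Ck_cong[OF assms(1), of "D _" "pd _ f" k] by auto
qed

lemma Ck_const: "Ck k S (\<lambda>x. c)"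
proof (induction k arbitrary: c)
  case (Suc k)
  have "pd i (\<lambda>x. c) = (\<lambda>x. 0)" for i :: 'a
    by (rule ext, rule has_pd_imp_pd, rule has_pd_const)
  then show ?case using Suc has_pd_const by auto
qed (auto intro: continuous_intros)

lemma Ck_add:
  assumes "open S" "Ck k S f" "Ck k S g"
  shows "Ck k S (\<lambda>x. f x + g x)"
  using assms(2,3)
proof (induction k arbitrary: f g)
  case (Suc k)
  show ?case
    by (rule Ck_SucI[OF assms(1), where D="\<lambda>i x. pd i f x + pd i g x"])
       (use Suc in \<open>auto intro!: continuous_intros has_pd_add\<close>)
qed (auto intro: continuous_intros)

lemma Ck_mult:
  fixes f g :: "real^'n::finite \<Rightarrow> 'b::real_normed_algebra"
  assumes "open S" "Ck k S f" "Ck k S g"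
  shows "Ck k S (\<lambda>x. f x * g x)"
  using assms(2,3)
proof (induction k arbitrary: f g)
  case (Suc k)
  have "Ck k S f" "Ck k S g"
    using Suc.prems by (auto intro: Ck_Suc_imp simp del: Ck.simps)
  then have "Ck k S (\<lambda>x. f x * pd i g x + pd i f x * g x)" for i
    using Suc by (intro Ck_add[OF assms(1)] Suc.IH) auto
  then show ?case
    by (intro Ck_SucI[OF assms(1), where D="\<lambda>i x. f x * pd i g x + pd i f x * g x"])
       (use Suc.prems in \<open>auto intro!: continuous_intros has_pd_mult\<close>)
qed (auto intro: continuous_intros)

lemma Ck_linear:
  assumes "bounded_linear L" "open S" "Ck k S f"
  shows "Ck k S (\<lambda>x. L (f x))"
  using assms(3)
proof (induction k arbitrary: f)
  case 0
  then show ?case using bounded_linear.continuous_on[OF assms(1)] by simp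
next
  case (Suc k)
  show ?case
    by (rule Ck_SucI[OF assms(2), where D="\<lambda>i x. L (pd i f x)"])
       (use Suc in \<open>auto intro: has_pd_linear[OF assms(1)] bounded_linear.continuous_on[OF assms(1)]\<close>)
qed

lemma Ck_inverse:
  fixes f :: "real^'n::finite \<Rightarrow> complex"
  assumes "open S" "Ck k S f" "\<And>x. x \<in> S \<Longrightarrow> f x \<noteq> 0"
  shows "Ck k S (\<lambda>x. inverse (f x))"
  using assms(2)
proof (induction k)
  case 0
  then show ?case using assms(3) by (simp add: continuous_on_inverse)
next
  case (Suc k)
  have c1: "continuous_on S (\<lambda>x. inverse (f x))"
    using Suc.prems assms(3) by (intro continuous_on_inverse) auto
  have c2: "Ck k S (\<lambda>x. - (inverse (f x) * pd i f x * inverse (f x)))" for i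
  proof -
    have inv: "Ck k S (\<lambda>x. inverse (f x))"
      using Suc.IH Ck_Suc_imp[OF Suc.prems] by blast
    have "Ck k S (pd i f)" using Suc.prems by simp
    then have "Ck k S (\<lambda>x. inverse (f x) * pd i f x * inverse (f x))"
      by (intro Ck_mult[OF assms(1)] inv)
    from Ck_linear[OF bounded_linear_minus[OF bounded_linear_ident] assms(1) this]
    show ?thesis .
  qed
  have c3: "has_pd i (\<lambda>x. inverse (f x)) (- (inverse (f x) * pd i f x * inverse (f x))) x"
    if "x \<in> S" for x i
    using Suc.prems assms(3) that by (intro has_pd_inverse) auto
  show ?case
    by (rule Ck_SucI[OF assms(1) c1 c3 c2])
qed

text \<open>Carrying the whole sequence \<open>\<sigma>\<close> of successive derivatives closes the
  induction: the chain rule only moves from \<open>n\<close> to \<open>Suc n\<close>.\<close>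

lemma Ck_compose:
  fixes f :: "real^'n::finite \<Rightarrow> real" and \<sigma> :: "nat \<Rightarrow> real \<Rightarrow> 'b::real_normed_algebra_1"
  assumes "\<And>n t. (\<sigma> n has_vector_derivative \<sigma> (Suc n) t) (at t)" "open S" "Ck k S f"
  shows "Ck k S (\<lambda>x. \<sigma> n (f x))"
proof -
  have cont: "continuous_on UNIV (\<sigma> n)" for n
    using assms(1) by (auto intro!: continuous_at_imp_continuous_on has_vector_derivative_continuous)
  then have comp: "continuous_on S (\<lambda>x. \<sigma> n (f x))" if "continuous_on S f" for n
    by (rule continuous_on_compose2[OF _ that]) auto
  show ?thesis
    using assms(3)
  proof (induction k arbitrary: n)
    case 0
    then show ?case using comp by simp
  next
    case (Suc k)
    have k: "Ck k S f"
      using Suc.prems by (rule Ck_Suc_imp)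
    have f: "continuous_on S f" "\<And>x i. x \<in> S \<Longrightarrow> has_pd i f (pd i f x) x" "\<And>i. Ck k S (pd i f)"
      using Suc.prems by auto
    have "Ck k S (\<lambda>x. of_real (pd i f x) * \<sigma> (Suc n) (f x))" for i
      by (intro Ck_mult assms(2) Ck_linear[OF bounded_linear_of_real] f Suc.IH k)
    then show ?case
      using f(2) assms(1)
      by (intro Ck_SucI[OF assms(2), where D="\<lambda>i x. of_real (pd i f x) * \<sigma> (Suc n) (f x)"] comp f(1))
         (simp add: scaleR_conv_of_real[symmetric] has_pd_compose)
  qed
qed

lemma Ck_component: "Ck k S (\<lambda>x::real^'n::finite. x $ j)"
proof (cases k)
  case (Suc l)
  have pd: "pd i (\<lambda>x::real^'n. x $ j) = (\<lambda>x. if i = j then 1 else 0)" for i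
    by (rule ext, rule has_pd_imp_pd, rule has_pd_component)
  have "continuous_on S (\<lambda>x::real^'n. x $ j)"
    by (intro continuous_intros)
  then show ?thesis
    unfolding Suc Ck.simps pd by (intro conjI ballI allI has_pd_component Ck_const)
qed (auto intro: continuous_intros)

lemma smooth_on_const: "smooth_on S (\<lambda>x. c)"
  by (simp add: smooth_on_iff_Ck Ck_const)

lemma smooth_on_add:
  "open S \<Longrightarrow> smooth_on S f \<Longrightarrow> smooth_on S g \<Longrightarrow> smooth_on S (\<lambda>x. f x + g x)"
  by (simp add: smooth_on_iff_Ck Ck_add)

lemma smooth_on_mult:
  fixes f g :: "real^'n::finite \<Rightarrow> 'b::real_normed_algebra"
  shows "open S \<Longrightarrow> smooth_on S f \<Longrightarrow> smooth_on S g \<Longrightarrow> smooth_on S (\<lambda>x. f x * g x)"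
  by (simp add: smooth_on_iff_Ck Ck_mult)

lemma smooth_on_linear:
  "bounded_linear L \<Longrightarrow> open S \<Longrightarrow> smooth_on S f \<Longrightarrow> smooth_on S (\<lambda>x. L (f x))"
  by (simp add: smooth_on_iff_Ck Ck_linear)

lemmas smooth_on_of_real = smooth_on_linear[OF bounded_linear_of_real]

lemma smooth_on_minus:
  "open S \<Longrightarrow> smooth_on S f \<Longrightarrow> smooth_on S (\<lambda>x. - f x)"
  by (rule smooth_on_linear[OF bounded_linear_minus[OF bounded_linear_ident]])

lemma smooth_on_diff:
  "open S \<Longrightarrow> smooth_on S f \<Longrightarrow> smooth_on S g \<Longrightarrow> smooth_on S (\<lambda>x. f x - g x)"
  using smooth_on_add[OF _ _ smooth_on_minus, of S f g] by simp

lemma smooth_on_inverse: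
  fixes f :: "real^'n::finite \<Rightarrow> complex"
  shows "open S \<Longrightarrow> smooth_on S f \<Longrightarrow> (\<And>x. x \<in> S \<Longrightarrow> f x \<noteq> 0) \<Longrightarrow> smooth_on S (\<lambda>x. inverse (f x))"
  by (simp add: smooth_on_iff_Ck Ck_inverse)

lemma smooth_on_compose:
  fixes f :: "real^'n::finite \<Rightarrow> real" and \<sigma> :: "nat \<Rightarrow> real \<Rightarrow> 'b::real_normed_algebra_1"
  assumes "\<And>n t. (\<sigma> n has_vector_derivative \<sigma> (Suc n) t) (at t)" "open S" "smooth_on S f"
  shows "smooth_on S (\<lambda>x. \<sigma> n (f x))"
  using assms by (simp add: smooth_on_iff_Ck Ck_compose)

lemma smooth_on_component: "smooth_on S (\<lambda>x. x $ j)"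
  by (simp add: smooth_on_iff_Ck Ck_component)

lemma smooth_on_sum:
  "open S \<Longrightarrow> (\<And>a. a \<in> A \<Longrightarrow> smooth_on S (f a)) \<Longrightarrow> smooth_on S (\<lambda>x. \<Sum>a\<in>A. f a x)"
  by (induction A rule: infinite_finite_induct) (auto intro: smooth_on_const smooth_on_add)

lemma smooth_on_power:
  fixes f :: "real^'n::finite \<Rightarrow> 'b::real_normed_algebra_1"
  shows "open S \<Longrightarrow> smooth_on S f \<Longrightarrow> smooth_on S (\<lambda>x. f x ^ k)"
  by (induction k) (auto intro: smooth_on_const smooth_on_mult)

lemma pd_const: "pd i (\<lambda>x. c) = (\<lambda>x. 0)"
  by (rule ext, rule has_pd_imp_pd, rule has_pd_const)

lemma pd_add:
  "smooth_on S f \<Longrightarrow> smooth_on S g \<Longrightarrow> x \<in> S \<Longrightarrow> pd i (\<lambda>x. f x + g x) x = pd i f x + pd i g x"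
  by (intro has_pd_imp_pd has_pd_add smooth_on_has_pd)

lemma pd_linear:
  "bounded_linear L \<Longrightarrow> smooth_on S f \<Longrightarrow> x \<in> S \<Longrightarrow> pd i (\<lambda>x. L (f x)) x = L (pd i f x)"
  by (rule has_pd_imp_pd) (auto intro: has_pd_linear[of L] smooth_on_has_pd)

lemma pds_const: "pds is (\<lambda>x. c) = (\<lambda>x. if is = [] then c else 0)"
  by (induction "is") (auto simp: pd_const split: if_splits)

lemma pds_linear:
  assumes "bounded_linear L" "open S" "smooth_on S f" "x \<in> S"
  shows "pds is (\<lambda>x. L (f x)) x = L (pds is f x)"
  using assms(4)
proof (induction "is" arbitrary: x)
  case (Cons i "is")
  have "pds (i # is) (\<lambda>x. L (f x)) x = pd i (\<lambda>x. L (pds is f x)) x"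
    by (simp, intro pd_cong[OF assms(2) Cons.prems] Cons.IH)
  also have "\<dots> = L (pds (i # is) f x)"
    using pd_linear[OF assms(1) smooth_on_pds[OF assms(3)] Cons.prems] by simp
  finally show ?case .
qed simp

lemma pds_add:
  assumes "open S" "smooth_on S f" "smooth_on S g" "x \<in> S"
  shows "pds is (\<lambda>x. f x + g x) x = pds is f x + pds is g x"
  using assms(4)
proof (induction "is" arbitrary: x)
  case (Cons i "is")
  have "pds (i # is) (\<lambda>x. f x + g x) x = pd i (\<lambda>x. pds is f x + pds is g x) x"
    by (simp, intro pd_cong[OF assms(1) Cons.prems] Cons.IH)
  also have "\<dots> = pds (i # is) f x + pds (i # is) g x"
    using pd_add[OF smooth_on_pds[OF assms(2)] smooth_on_pds[OF assms(3)] Cons.prems] by simp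
  finally show ?case .
qed simp

lemma pds_minus:
  assumes "open S" "smooth_on S f" "x \<in> S"
  shows "pds is (\<lambda>x. - f x) x = - pds is f x"
  using pds_linear[OF bounded_linear_minus[OF bounded_linear_ident] assms] by simp

lemma pds_diff:
  assumes "open S" "smooth_on S f" "smooth_on S g" "x \<in> S"
  shows "pds is (\<lambda>x. f x - g x) x = pds is f x - pds is g x"
  using pds_add[OF assms(1,2) smooth_on_minus[OF assms(1,3)] assms(4)] pds_minus[OF assms(1,3,4)] by simp

lemma pds_eq_0_off_tsupp: "x \<notin> tsupp f \<Longrightarrow> pds is f x = 0"
proof -
  assume "x \<notin> tsupp f"
  then have "pds is f x = pds is (\<lambda>x. 0) x"
    by (intro pds_cong[of "- tsupp f"])
       (use closure_subset[of "{x. f x \<noteq> 0}"] in \<open>auto simp: tsupp_def\<close>)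
  then show ?thesis by (simp add: pds_const)
qed

subsection \<open>The Leibniz rule\<close>

text \<open>All ways of distributing the positions of a list over two sublists, with repetitions;
  Leibniz' rule then needs no multinomial coefficients.\<close>

fun splits :: "'a list \<Rightarrow> ('a list \<times> 'a list) list" where
  "splits [] = [([], [])]"
| "splits (i # is) = map (\<lambda>(js, ks). (i # js, ks)) (splits is) @ map (\<lambda>(js, ks). (js, i # ks)) (splits is)"

lemma splits_length: "(js, ks) \<in> set (splits is) \<Longrightarrow> length js + length ks = length is"
  by (induction "is" arbitrary: js ks) auto

text \<open>Among the splittings of a list of length \<open>n\<close>, exactly
  \<open>n choose k\<close> have a first part of length \<open>k\<close>; the induction step is
  Pascal's identity.\<close>

lemma sum_list_splits_choose:
  fixes F :: "nat \<Rightarrow> nat \<Rightarrow> real"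
  shows "(\<Sum>(js, ks)\<leftarrow>splits is. F (length js) (length ks)) =
    (\<Sum>k\<le>length is. real (length is choose k) * F k (length is - k))"
proof (induction "is" arbitrary: F)
  case (Cons i "is")
  let ?n = "length is"
  have "(\<Sum>(js, ks)\<leftarrow>splits (i # is). F (length js) (length ks)) =
    (\<Sum>(js, ks)\<leftarrow>splits is. F (Suc (length js)) (length ks)) + (\<Sum>(js, ks)\<leftarrow>splits is. F (length js) (Suc (length ks)))"
    by (simp add: o_def case_prod_unfold)
  also have "\<dots> = (\<Sum>k\<le>?n. real (?n choose k) * F (Suc k) (?n - k)) + (\<Sum>k\<le>?n. real (?n choose k) * F k (Suc (?n - k)))"
    using Cons.IH[of "\<lambda>j k. F (Suc j) k"] Cons.IH[of "\<lambda>j k. F j (Suc k)"] by simp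
  also have "(\<Sum>k\<le>?n. real (?n choose k) * F k (Suc (?n - k))) = (\<Sum>k\<le>?n. real (?n choose k) * F k (Suc ?n - k))"
    by (intro sum.cong) (auto simp: Suc_diff_le)
  also have "\<dots> = (\<Sum>k\<le>Suc ?n. real (?n choose k) * F k (Suc ?n - k))"
    by simp
  also have "\<dots> = F 0 (Suc ?n) + (\<Sum>k\<le>?n. real (?n choose Suc k) * F (Suc k) (?n - k))"
    by (subst sum.atMost_Suc_shift) simp
  also have "(\<Sum>k\<le>?n. real (?n choose k) * F (Suc k) (?n - k)) + (F 0 (Suc ?n) + (\<Sum>k\<le>?n. real (?n choose Suc k) * F (Suc k) (?n - k)))
     = F 0 (Suc ?n) + (\<Sum>k\<le>?n. real (Suc ?n choose Suc k) * F (Suc k) (?n - k))"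
    by (simp add: sum.distrib algebra_simps)
  also have "\<dots> = (\<Sum>k\<le>Suc ?n. real (Suc ?n choose k) * F k (Suc ?n - k))"
    by (subst sum.atMost_Suc_shift) simp
  finally show ?case by simp
qed simp

lemma has_pd_sum_list:
  "(\<And>p. p \<in> set ps \<Longrightarrow> has_pd i (f p) (D p) x) \<Longrightarrow>
   has_pd i (\<lambda>x. \<Sum>p\<leftarrow>ps. f p x) (\<Sum>p\<leftarrow>ps. D p) x"
  by (induction ps) (auto intro!: has_pd_const has_pd_add)

lemma pds_mult:
  fixes f g :: "real^'n::finite \<Rightarrow> 'b::real_normed_algebra"
  assumes "open S" "smooth_on S f" "smooth_on S g" "x \<in> S"
  shows "pds is (\<lambda>x. f x * g x) x = (\<Sum>(js, ks)\<leftarrow>splits is. pds js f x * pds ks g x)"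
  using assms(4)
proof (induction "is" arbitrary: x)
  case (Cons i "is")
  have "pds (i # is) (\<lambda>x. f x * g x) x = pd i (\<lambda>x. \<Sum>p\<leftarrow>splits is. pds (fst p) f x * pds (snd p) g x) x"
    by (simp, intro pd_cong[OF assms(1) Cons.prems]) (simp add: Cons.IH case_prod_unfold)
  also have "\<dots> = (\<Sum>p\<leftarrow>splits is. pds (fst p) f x * pds (i # snd p) g x + pds (i # fst p) f x * pds (snd p) g x)"
    using Cons.prems smooth_on_pds[OF assms(2)] smooth_on_pds[OF assms(3)]
    by (intro has_pd_imp_pd has_pd_sum_list) (auto intro!: has_pd_mult smooth_on_has_pd)
  also have "\<dots> = (\<Sum>(js, ks)\<leftarrow>splits (i # is). pds js f x * pds ks g x)"
    by (simp add: sum_list_addf o_def case_prod_unfold add.commute)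
  finally show ?case .
qed simp

lemma sum_list_norm_mono:
  assumes "\<And>p. p \<in> set ps \<Longrightarrow> norm (f p) \<le> b p"
  shows "norm (\<Sum>p\<leftarrow>ps. f p) \<le> (\<Sum>p\<leftarrow>ps. b p)"
  using assms by (induction ps) (auto intro: norm_triangle_le add_mono)

lemma norm_pds_mult_le:
  fixes f g :: "real^'n::finite \<Rightarrow> 'b::real_normed_algebra"
  assumes "open S" "smooth_on S f" "smooth_on S g" "x \<in> S"
    and "\<And>js. length js \<le> length is \<Longrightarrow> norm (pds js f x) \<le> A (length js)"
    and "\<And>ks. length ks \<le> length is \<Longrightarrow> norm (pds ks g x) \<le> B (length ks)"
  shows "norm (pds is (\<lambda>x. f x * g x) x) \<le> (\<Sum>k\<le>length is. real (length is choose k) * (A k * B (length is - k)))"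
proof -
  have "norm (pds is (\<lambda>x. f x * g x) x) \<le> (\<Sum>p\<leftarrow>splits is. A (length (fst p)) * B (length (snd p)))"
    unfolding pds_mult[OF assms(1-4)] case_prod_unfold
  proof (rule sum_list_norm_mono)
    fix p assume "p \<in> set (splits is)"
    then have *: "length (fst p) + length (snd p) = length is"
      using splits_length by (metis prod.collapse)
    have "norm (pds (fst p) f x * pds (snd p) g x) \<le> norm (pds (fst p) f x) * norm (pds (snd p) g x)"
      by (rule norm_mult_ineq)
    also have "\<dots> \<le> A (length (fst p)) * B (length (snd p))"
      using * assms(5)[of "fst p"] assms(6)[of "snd p"] order_trans[OF norm_ge_zero assms(5)[of "fst p"]]
      by (intro mult_mono) auto
    finally show "norm (pds (fst p) f x * pds (snd p) g x) \<le> A (length (fst p)) * B (length (snd p))" .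
  qed
  also have "\<dots> = (\<Sum>k\<le>length is. real (length is choose k) * (A k * B (length is - k)))"
    using sum_list_splits_choose[of "\<lambda>j k. A j * B k" "is"] by (simp add: case_prod_unfold)
  finally show ?thesis .
qed

section \<open>Quasianalyticity in one variable\<close>

lemma log_convex_ratio_mono:
  fixes M :: "nat \<Rightarrow> real"
  assumes "\<And>j. M j > 0" "\<And>j. j \<ge> 1 \<Longrightarrow> (M j)\<^sup>2 \<le> M (j - 1) * M (j + 1)" "k \<le> n"
  shows "M (Suc k) / M k \<le> M (Suc n) / M n"
proof -
  have "incseq (\<lambda>k. M (Suc k) / M k)"
  proof (rule incseq_SucI)
    fix k
    show "M (Suc k) / M k \<le> M (Suc (Suc k)) / M (Suc k)"
      using assms(1)[of k] assms(1)[of "Suc k"] assms(2)[of "Suc k"]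
      by (simp add: field_simps power2_eq_square)
  qed
  then show ?thesis using assms(3) by (auto simp: incseq_def)
qed

lemma sum_inverse_fact_le_exp: "(\<Sum>i\<le>n. 1 / fact i) \<le> exp (1::real)"
proof -
  have "(\<Sum>i\<le>n. 1 / fact i) = (\<Sum>i\<le>n. (1::real) ^ i /\<^sub>R fact i)"
    by (simp add: field_simps)
  also have "\<dots> \<le> (\<Sum>i. (1::real) ^ i /\<^sub>R fact i)"
    by (intro sum_le_suminf summable_exp_generic) auto
  finally show ?thesis by (simp add: exp_def)
qed

text \<open>Bang's argument: the quantity \<open>sup\<^sub>j |g\<^sub>j| / (e\<^sup>j M\<^sub>j)\<close> grows at most by the factor \<open>e\<close>
  over an interval of length \<open>M\<^sub>N / (e M\<^sub>N\<^sub>+\<^sub>1)\<close> as long as it is at most \<open>e\<^sup>-\<^sup>N\<^sup>-\<^sup>1\<close>.\<close>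

lemma bang_step:
  fixes g :: "nat \<Rightarrow> real \<Rightarrow> real"
  assumes der: "\<And>n x. x \<in> {a<..<b} \<Longrightarrow> (g n has_real_derivative g (Suc n) x) (at x)"
    and bnd: "\<And>n x. x \<in> {a<..<b} \<Longrightarrow> \<bar>g n x\<bar> \<le> M n"
    and pos: "\<And>j. M j > 0" and lc: "\<And>j. j \<ge> 1 \<Longrightarrow> (M j)\<^sup>2 \<le> M (j - 1) * M (j + 1)"
    and x0: "x0 \<in> {a<..<b}" and x: "x \<in> {a<..<b}"
    and P: "\<And>j. \<bar>g j x0\<bar> \<le> exp (real j - real (Suc N)) * M j"
    and h: "\<bar>x - x0\<bar> \<le> M N / (exp 1 * M (Suc N))"
  shows "\<bar>g j x\<bar> \<le> exp (real j - real N) * M j"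
proof (cases "j \<le> N \<and> x \<noteq> x0")
  case False
  then consider "j > N" | "x = x0" by linarith
  then show ?thesis
  proof cases
    case 1
    have "\<bar>g j x\<bar> \<le> 1 * M j" using bnd[OF x] by simp
    also have "\<dots> \<le> exp (real j - real N) * M j"
      using 1 pos[of j] by (intro mult_right_mono) auto
    finally show ?thesis .
  next
    case 2
    have "\<bar>g j x\<bar> \<le> exp (real j - real (Suc N)) * M j" using P 2 by simp
    also have "\<dots> \<le> exp (real j - real N) * M j"
      using pos[of j] by (intro mult_right_mono) auto
    finally show ?thesis .
  qed
next
  case True
  define \<mu> where "\<mu> = M (Suc N) / M N"
  \<comment> \<open>Taylor's expansion stops at order \<open>Suc N\<close>, where the exponential
    factor is 1 and the global bound \<open>bnd\<close> is as good as the hypothesis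
    \<open>P\<close>.\<close>
  define n where "n = Suc N - j"
  have n: "n > 0" "j + n = Suc N" using True by (auto simp: n_def)
  have \<mu>: "\<mu> > 0" using pos by (simp add: \<mu>_def)
  have ratio: "M (j + i) \<le> M j * \<mu> ^ i" if "i \<le> n" for i
    using that
  proof (induction i)
    case (Suc i)
    have "M (Suc (j + i)) / M (j + i) \<le> \<mu>"
      unfolding \<mu>_def using Suc.prems n by (intro log_convex_ratio_mono pos lc) auto
    then have "M (j + Suc i) \<le> \<mu> * M (j + i)"
      using pos[of "j + i"] by (simp add: field_simps)
    also have "\<dots> \<le> \<mu> * (M j * \<mu> ^ i)"
      using Suc \<mu> by (intro mult_left_mono) auto
    finally show ?case by (simp add: mult_ac)
  qed simp
  \<comment> \<open>The step length is chosen for this: each factor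
    \<open>\<mu> * \<bar>x - x0\<bar>\<close> brought by a higher derivative compensates the factor
    \<open>exp 1\<close> by which \<open>P\<close> gets worse, so only \<open>1 / fact i\<close> is
    left.\<close>
  have hm: "exp 1 * \<mu> * \<bar>x - x0\<bar> \<le> 1"
    using h pos[of N] pos[of "Suc N"] by (simp add: \<mu>_def field_simps)
  have summand: "\<bar>c\<bar> / fact i * \<bar>x - x0\<bar> ^ i \<le> exp (real j - real (Suc N)) * M j * (1 / fact i)"
    if i: "i \<le> n" and c: "\<bar>c\<bar> \<le> exp (real (j + i) - real (Suc N)) * M (j + i)" for c i
  proof -
    have "\<bar>c\<bar> * \<bar>x - x0\<bar> ^ i \<le> (exp (real (j + i) - real (Suc N)) * (M j * \<mu> ^ i)) * \<bar>x - x0\<bar> ^ i"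
      by (rule mult_right_mono[OF order_trans[OF c mult_left_mono[OF ratio[OF i]]]]) auto
    also have "\<dots> = exp (real j - real (Suc N)) * M j * (exp 1 * \<mu> * \<bar>x - x0\<bar>) ^ i"
    proof -
      have "exp (real (j + i) - real (Suc N)) = exp (real j - real (Suc N)) * exp 1 ^ i"
        by (simp only: exp_of_nat_mult[symmetric] mult_exp_exp) (simp add: algebra_simps)
      then show ?thesis by (simp only: power_mult_distrib mult_ac)
    qed
    also have "\<dots> \<le> exp (real j - real (Suc N)) * M j * 1"
      using hm pos[of j] \<mu> by (intro mult_left_mono power_le_one) auto
    finally show ?thesis by (simp add: field_simps)
  qed
  have "\<exists>t. (if x < x0 then x < t \<and> t < x0 else x0 < t \<and> t < x) \<and>
     g j x = (\<Sum>m<n. (g (j + m) x0 / fact m) * (x - x0) ^ m) + (g (j + n) t / fact n) * (x - x0) ^ n"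
  proof (rule Taylor[where a="min x x0" and b="max x x0"])
    show "\<forall>m t. m < n \<and> min x x0 \<le> t \<and> t \<le> max x x0 \<longrightarrow>
        (g (j + m) has_real_derivative g (j + Suc m) t) (at t)"
      using der x x0 by (auto simp: min_def max_def split: if_splits)
  qed (use n True in auto)
  then obtain t where t0: "if x < x0 then x < t \<and> t < x0 else x0 < t \<and> t < x"
    and eq: "g j x = (\<Sum>m<n. (g (j + m) x0 / fact m) * (x - x0) ^ m) + (g (Suc N) t / fact n) * (x - x0) ^ n"
    unfolding n(2) by blast
  have t: "t \<in> {a<..<b}" using t0 x x0 by (auto split: if_splits)
  have "\<bar>g j x\<bar> \<le> (\<Sum>m<n. \<bar>g (j + m) x0\<bar> / fact m * \<bar>x - x0\<bar> ^ m) + \<bar>g (Suc N) t\<bar> / fact n * \<bar>x - x0\<bar> ^ n"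
    unfolding eq
    by (rule order_trans[OF abs_triangle_ineq] add_mono order_trans[OF sum_abs])+
       (auto simp: abs_mult power_abs)
  also have "\<dots> \<le> (\<Sum>m<n. exp (real j - real (Suc N)) * M j * (1 / fact m)) +
       exp (real j - real (Suc N)) * M j * (1 / fact n)"
  proof (intro add_mono sum_mono summand P)
    show "\<bar>g (Suc N) t\<bar> \<le> exp (real (j + n) - real (Suc N)) * M (j + n)"
      unfolding n(2) using bnd[OF t, of "Suc N"] by simp
  qed auto
  also have "\<dots> = exp (real j - real (Suc N)) * M j * (\<Sum>m\<le>n. 1 / fact m)"
    unfolding lessThan_Suc_atMost[symmetric] sum.lessThan_Suc
    by (simp only: sum_distrib_left distrib_left)
  also have "\<dots> \<le> exp (real j - real (Suc N)) * M j * exp 1"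
    using pos[of j] by (intro mult_left_mono sum_inverse_fact_le_exp) auto
  also have "\<dots> = exp (real j - real N) * M j"
  proof -
    have "exp (real j - real N) = exp (real j - real (Suc N)) * exp 1"
      by (simp add: mult_exp_exp)
    then show ?thesis by (simp only: mult_ac)
  qed
  finally show ?thesis .
qed

text \<open>At the flat point the bound with factor \<open>exp (- real (K + N))\<close> holds for
  every \<open>N\<close>. Steps of lengths \<open>\<tau> (K + N - 1)\<close>, ...,
  \<open>\<tau> K\<close> weaken it to \<open>exp (- real K)\<close>, and since
  \<open>\<tau>\<close> is not summable, \<open>N\<close> can be taken so large that they reach
  \<open>y\<close>. Then \<open>K\<close> tends to infinity.\<close>

lemma denjoy_carleman_normalized:
  fixes g :: "nat \<Rightarrow> real \<Rightarrow> real"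
  assumes der: "\<And>n x. x \<in> {a<..<b} \<Longrightarrow> (g n has_real_derivative g (Suc n) x) (at x)"
    and bnd: "\<And>n x. x \<in> {a<..<b} \<Longrightarrow> \<bar>g n x\<bar> \<le> M n"
    and pos: "\<And>j. M j > 0" and lc: "\<And>j. j \<ge> 1 \<Longrightarrow> (M j)\<^sup>2 \<le> M (j - 1) * M (j + 1)"
    and qa: "\<not> summable (\<lambda>k. M k / M (Suc k))"
    and x0: "x0 \<in> {a<..<b}" and flat: "\<And>n. g n x0 = 0" and y: "x0 \<le> y" "y < b"
  shows "g 0 y = 0"
proof -
  define \<tau> where "\<tau> n = M n / (exp 1 * M (Suc n))" for n
  have \<tau>: "\<tau> n > 0" for n using pos by (simp add: \<tau>_def)
  have step: "\<bar>g j y\<bar> \<le> exp (real j - real K) * M j"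
    if "z \<in> {a<..<b}" "z \<le> y" "\<And>j. \<bar>g j z\<bar> \<le> exp (real j - real (K + N)) * M j"
       "y - z \<le> (\<Sum>n\<in>{K..<K + N}. \<tau> n)" for z j K N
    using that
  proof (induction N arbitrary: z j)
    case 0
    then show ?case by simp
  next
    case (Suc N)
    \<comment> \<open>Steps are cut at \<open>y\<close>; once \<open>y\<close> is reached, the
      remaining ones have length zero and only weaken the bound.\<close>
    define z' where "z' = min y (z + \<tau> (K + N))"
    have z': "z' \<in> {a<..<b}" "z' \<le> y" "\<bar>z' - z\<bar> \<le> \<tau> (K + N)"
      using Suc.prems y \<tau>[of "K + N"] by (auto simp: z'_def min_def)
    have "y - z' \<le> (\<Sum>n\<in>{K..<K + N}. \<tau> n)"
    proof -
      have "0 \<le> (\<Sum>n\<in>{K..<K + N}. \<tau> n)" by (intro sum_nonneg less_imp_le \<tau>)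
      moreover have "y - z \<le> (\<Sum>n\<in>{K..<K + N}. \<tau> n) + \<tau> (K + N)" using Suc.prems(4) by simp
      ultimately show ?thesis by (auto simp: z'_def min_def)
    qed
    moreover have "\<bar>g j z'\<bar> \<le> exp (real j - real (K + N)) * M j" for j
      by (rule bang_step[OF der bnd pos lc Suc.prems(1) z'(1)])
         (use Suc.prems(3) z'(3) in \<open>auto simp: \<tau>_def\<close>)
    ultimately show ?case
      using Suc.IH z' by blast
  qed
  have bound: "\<bar>g 0 y\<bar> \<le> exp (- real K) * M 0" for K
  proof -
    have ns: "\<not> summable \<tau>"
    proof
      assume "summable \<tau>"
      then have "summable (\<lambda>n. exp 1 * \<tau> n)" by (rule summable_mult)
      then show False using qa by (simp add: \<tau>_def)
    qed
    then have "\<not> summable (\<lambda>n. \<tau> (n + K))" by (simp add: summable_iff_shift)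
    then have "\<not> (\<forall>N. (\<Sum>n<N. \<tau> (n + K)) \<le> y - x0)"
      using summableI_nonneg_bounded[of "\<lambda>n. \<tau> (n + K)" "y - x0"] \<tau> less_imp_le by blast
    then obtain N where "y - x0 \<le> (\<Sum>n<N. \<tau> (n + K))"
      by (meson linear)
    also have "\<dots> = (\<Sum>n\<in>{K..<K + N}. \<tau> n)"
      using sum.shift_bounds_nat_ivl[of \<tau> 0 K N] by (simp add: atLeast0LessThan add.commute)
    finally have "\<bar>g 0 y\<bar> \<le> exp (real 0 - real K) * M 0"
      using x0 y flat pos[THEN less_imp_le] by (intro step[of x0 K N]) auto
    then show ?thesis by simp
  qed
  have "(\<lambda>K. exp (- 1 :: real) ^ K * M 0) \<longlonglongrightarrow> 0 * M 0"
    by (intro tendsto_mult tendsto_const LIMSEQ_realpow_zero) auto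
  then have "(\<lambda>K. exp (- real K) * M 0) \<longlonglongrightarrow> 0"
    by (simp add: exp_of_nat_mult[symmetric])
  then have "\<bar>g 0 y\<bar> \<le> 0"
    using bound by (intro LIMSEQ_le_const[of _ "0" "\<bar>g 0 y\<bar>"]) auto
  then show ?thesis by simp
qed

text \<open>Lagrange's form of the remainder is for real functions, hence the two parts of
  \<open>g\<close>. The factors \<open>C\<close> and \<open>h\<close> go into the weight
  \<open>M'\<close>, which stays log-convex and keeps the divergence of the series.\<close>

theorem denjoy_carleman:
  fixes g :: "nat \<Rightarrow> real \<Rightarrow> complex"
  assumes der: "\<And>n x. x \<in> {a<..<b} \<Longrightarrow> (g n has_vector_derivative g (Suc n) x) (at x)"
    and bnd: "\<And>n x. x \<in> {a<..<b} \<Longrightarrow> norm (g n x) \<le> C * h ^ n * M n" and h: "h > 0"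
    and pos: "\<And>j. M j > 0" and lc: "\<And>j. j \<ge> 1 \<Longrightarrow> (M j)\<^sup>2 \<le> M (j - 1) * M (j + 1)"
    and qa: "\<not> summable (\<lambda>k. M k / M (Suc k))"
    and x0: "x0 \<in> {a<..<b}" and flat: "\<And>n. g n x0 = 0" and y: "x0 \<le> y" "y < b"
  shows "g 0 y = 0"
proof -
  \<comment> \<open>\<open>C\<close> may vanish or be negative; the maximum keeps \<open>M'\<close>
    positive.\<close>
  define C' where "C' = max C 1"
  define M' where "M' n = C' * h ^ n * M n" for n
  have C': "C' > 0" "C \<le> C'" by (auto simp: C'_def)
  have pos': "M' j > 0" for j using C' h pos by (simp add: M'_def)
  have lc': "(M' j)\<^sup>2 \<le> M' (j - 1) * M' (j + 1)" if j1: "j \<ge> 1" for j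
  proof -
    obtain k where k: "j = Suc k" using j1 by (cases j) auto
    have "(M' j)\<^sup>2 = C'\<^sup>2 * (h ^ j)\<^sup>2 * (M j)\<^sup>2"
      by (simp add: M'_def power_mult_distrib)
    also have "\<dots> \<le> C'\<^sup>2 * (h ^ j)\<^sup>2 * (M (j - 1) * M (j + 1))"
      using lc[OF j1] C' h by (intro mult_left_mono) auto
    also have "\<dots> = M' (j - 1) * M' (j + 1)"
      by (simp add: M'_def k power2_eq_square mult_ac mult_2 power_add)
    finally show ?thesis .
  qed
  have qa': "\<not> summable (\<lambda>k. M' k / M' (Suc k))"
  proof
    assume "summable (\<lambda>k. M' k / M' (Suc k))"
    then have "summable (\<lambda>k. h * (M' k / M' (Suc k)))" by (rule summable_mult)
    moreover have "h * (M' k / M' (Suc k)) = M k / M (Suc k)" for k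
      using C' h pos by (simp add: M'_def field_simps)
    ultimately show False using qa by simp
  qed
  have bnd': "norm (g n x) \<le> M' n" if "x \<in> {a<..<b}" for n x
  proof -
    have "C * h ^ n * M n \<le> C' * h ^ n * M n"
      using C' h pos[of n] by (intro mult_right_mono) auto
    then show ?thesis using bnd[OF that, of n] by (simp add: M'_def)
  qed
  have "Re (g 0 y) = 0"
  proof (rule denjoy_carleman_normalized[where g="\<lambda>n x. Re (g n x)" and M=M' and ?x0.0=x0])
    show "((\<lambda>x. Re (g n x)) has_real_derivative Re (g (Suc n) x)) (at x)" if "x \<in> {a<..<b}" for n x
      using bounded_linear.has_vector_derivative[OF bounded_linear_Re der[OF that]]
      by (simp add: has_real_derivative_iff_has_vector_derivative)
    show "\<bar>Re (g n x)\<bar> \<le> M' n" if "x \<in> {a<..<b}" for n x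
      using bnd'[OF that] abs_Re_le_cmod order_trans by blast
  qed (use assms pos' lc' qa' in auto)
  moreover have "Im (g 0 y) = 0"
  proof (rule denjoy_carleman_normalized[where g="\<lambda>n x. Im (g n x)" and M=M' and ?x0.0=x0])
    show "((\<lambda>x. Im (g n x)) has_real_derivative Im (g (Suc n) x)) (at x)" if "x \<in> {a<..<b}" for n x
      using bounded_linear.has_vector_derivative[OF bounded_linear_Im der[OF that]]
      by (simp add: has_real_derivative_iff_has_vector_derivative)
    show "\<bar>Im (g n x)\<bar> \<le> M' n" if "x \<in> {a<..<b}" for n x
      using bnd'[OF that] abs_Im_le_cmod order_trans by blast
  qed (use assms pos' lc' qa' in auto)
  ultimately show ?thesis by (simp add: complex_eq_iff)
qed

subsection \<open>A smooth function supported on a half line\<close>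

text \<open>With \<open>y = 1 / t\<close>, the derivative in \<open>t\<close> of
  \<open>P(y) exp (-y)\<close> is \<open>y\<^sup>2 (P(y) - P'(y)) exp (-y)\<close>. So these are the
  polynomial factors in the derivatives of \<open>exp (-1 / t)\<close>, and \<open>eta n\<close> is
  the \<open>n\<close>-th derivative of \<open>eta 0\<close>.\<close>

primrec eta_poly :: "nat \<Rightarrow> real poly" where
  "eta_poly 0 = 1"
| "eta_poly (Suc n) = [:0, 0, 1:] * (eta_poly n - pderiv (eta_poly n))"

definition eta :: "nat \<Rightarrow> real \<Rightarrow> real" where
  "eta n t = (if t > 0 then poly (eta_poly n) (inverse t) * exp (- inverse t) else 0)"

lemma eta_nonpos [simp]: "t \<le> 0 \<Longrightarrow> eta n t = 0"
  by (simp add: eta_def)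

lemma eta_0_pos [simp]: "t > 0 \<Longrightarrow> eta 0 t > 0"
  by (simp add: eta_def)

lemma poly_times_exp_minus_tendsto_0:
  "((\<lambda>y. y ^ k * poly p y * exp (- y)) \<longlongrightarrow> 0) (at_top :: real filter)"
proof (induction p arbitrary: k)
  case (pCons a p)
  have "((\<lambda>y. a * (y ^ k / exp y) + y ^ Suc k * poly p y * exp (- y)) \<longlongrightarrow> a * 0 + 0) at_top"
    by (intro tendsto_add tendsto_mult tendsto_const tendsto_power_div_exp_0 pCons.IH)
  moreover have "a * (y ^ k / exp y) + y ^ Suc k * poly p y * exp (- y) = y ^ k * poly (pCons a p) y * exp (- y)" for y
    by (simp add: algebra_simps exp_minus divide_inverse)
  ultimately show ?case by simp
qed simp

lemma has_real_derivative_eta: "(eta n has_real_derivative eta (Suc n) t) (at t)"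
proof (cases t "0::real" rule: linorder_cases)
  case less
  have "(eta n has_real_derivative 0) (at t)"
    by (rule has_field_derivative_transform_within_open[of "\<lambda>x. 0" _ _ "{..<0}"]) (use less in auto)
  then show ?thesis using less by simp
next
  case greater
  let ?P = "eta_poly n"
  have "((\<lambda>t. poly ?P (inverse t) * exp (- inverse t)) has_real_derivative
     poly ?P (inverse t) * (exp (- inverse t) * (inverse t * inverse t)) +
     poly (pderiv ?P) (inverse t) * (- (inverse t * inverse t)) * exp (- inverse t)) (at t)"
    using greater
    by (auto intro!: derivative_eq_intros DERIV_chain2[OF poly_DERIV] simp: field_simps power2_eq_square)
  also have "poly ?P (inverse t) * (exp (- inverse t) * (inverse t * inverse t)) +
     poly (pderiv ?P) (inverse t) * (- (inverse t * inverse t)) * exp (- inverse t) = eta (Suc n) t"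
    using greater by (simp add: eta_def algebra_simps)
  finally show ?thesis
    by (rule has_field_derivative_transform_within_open[of _ _ _ "{0<..}"]) (use greater in \<open>auto simp: eta_def\<close>)
next
  case equal
  have "((\<lambda>h. (eta n (0 + h) - eta n 0) / h) \<longlongrightarrow> 0) (at_left 0)"
    by (rule tendsto_eventually) (auto simp: eventually_at_left_field intro!: exI[of _ "-1"])
  moreover have "((\<lambda>h. (eta n (0 + h) - eta n 0) / h) \<longlongrightarrow> 0) (at_right 0)"
  proof -
    \<comment> \<open>The single factor \<open>inverse h\<close> is the denominator of the
      difference quotient at 0.\<close>
    have "((\<lambda>h. inverse h ^ 1 * poly (eta_poly n) (inverse h) * exp (- inverse h)) \<longlongrightarrow> 0) (at_right 0)"
      by (rule filterlim_compose[OF poly_times_exp_minus_tendsto_0 filterlim_inverse_at_top_right])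
    moreover have "eventually (\<lambda>h. inverse h ^ 1 * poly (eta_poly n) (inverse h) * exp (- inverse h)
        = (eta n (0 + h) - eta n 0) / h) (at_right (0::real))"
      by (auto simp: eventually_at_right_field eta_def field_simps intro!: exI[of _ 1])
    ultimately show ?thesis by (rule Lim_transform_eventually)
  qed
  ultimately have "((\<lambda>h. (eta n (0 + h) - eta n 0) / h) \<longlongrightarrow> 0) (at 0)"
    by (simp add: filterlim_at_split)
  then show ?thesis
    using equal by (simp add: DERIV_def)
qed

lemma continuous_on_eta: "continuous_on S (eta n)"
  by (rule continuous_at_imp_continuous_on) (use has_real_derivative_eta DERIV_isCont in blast)

section \<open>Symmetry of partial derivatives and Taylor's inequality\<close>

lemma has_pd_line:
  assumes "has_pd i f D (x + a *\<^sub>R axis i 1)"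
  shows "((\<lambda>t. f (x + t *\<^sub>R axis i 1)) has_vector_derivative D) (at a)"
proof -
  have 1: "((\<lambda>t. t - a) has_vector_derivative 1) (at a)"
    by (auto intro!: derivative_eq_intros)
  have 2: "((\<lambda>t. f ((x + a *\<^sub>R axis i 1) + t *\<^sub>R axis i 1)) has_vector_derivative D) (at (a - a))"
    using assms by (simp add: has_pd_def)
  show ?thesis
    using vector_diff_chain_at[OF 1 2] by (simp add: o_def scaleR_diff_left add.assoc)
qed

lemma mvt_line:
  fixes f :: "real^'n::finite \<Rightarrow> real"
  assumes "s > 0" "\<And>t. 0 \<le> t \<Longrightarrow> t \<le> s \<Longrightarrow> has_pd i f (D t) (x + t *\<^sub>R axis i 1)"
  obtains t where "0 < t" "t < s" "f (x + s *\<^sub>R axis i 1) - f x = s * D t"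
proof -
  have "\<exists>z. 0 < z \<and> z < s \<and> f (x + s *\<^sub>R axis i 1) - f (x + 0 *\<^sub>R axis i 1) = (s - 0) * D z"
    by (rule MVT2[OF assms(1)])
       (use has_pd_line[OF assms(2)] in \<open>simp add: has_real_derivative_iff_has_vector_derivative\<close>)
  then show ?thesis using that by auto
qed

text \<open>The mean value theorem, first for \<open>f (y + s *\<^sub>R axis j 1) - f y\<close> in
  direction \<open>i\<close>, then for \<open>pd i f\<close> in direction \<open>j\<close>. The left
  side is symmetric in \<open>i\<close> and \<open>j\<close>; exchanging them and letting
  \<open>s\<close> tend to 0 gives the symmetry of second derivatives.\<close>

lemma second_difference:
  fixes f :: "real^'n::finite \<Rightarrow> real"
  assumes "s > 0" "cball x (2 * s) \<subseteq> S" "Ck 2 S f"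
  obtains y where "dist y x \<le> 2 * s"
    "f (x + s *\<^sub>R axis i 1 + s *\<^sub>R axis j 1) - f (x + s *\<^sub>R axis i 1) - f (x + s *\<^sub>R axis j 1) + f x
       = s\<^sup>2 * pd j (pd i f) y"
proof -
  have hp: "has_pd l f (pd l f y) y" "has_pd l (pd i f) (pd l (pd i f) y) y" if "y \<in> S" for y l
    using assms(3) that by (auto simp: numeral_2_eq_2)
  have near: "dist (x + a *\<^sub>R axis i 1 + b *\<^sub>R axis j 1) x \<le> 2 * s" if "0 \<le> a" "a \<le> s" "0 \<le> b" "b \<le> s" for a b
  proof -
    have "norm (a *\<^sub>R axis i 1 + b *\<^sub>R axis j (1::real)) \<le> norm (a *\<^sub>R axis i (1::real)) + norm (b *\<^sub>R axis j (1::real))"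
      by (rule norm_triangle_ineq)
    also have "\<dots> \<le> 2 * s" using that by (simp add: norm_axis_1)
    finally show ?thesis by (simp add: dist_norm add.assoc)
  qed
  have inS: "x + a *\<^sub>R axis i 1 + b *\<^sub>R axis j 1 \<in> S" if "0 \<le> a" "a \<le> s" "0 \<le> b" "b \<le> s" for a b
    using near[OF that] assms(2) by (auto simp: dist_commute)
  have shift: "has_pd i (\<lambda>y. f (y + s *\<^sub>R axis j 1)) D y" if "has_pd i f D (y + s *\<^sub>R axis j 1)" for D y
    using that by (simp add: has_pd_def add_ac)
  have "\<exists>t. 0 < t \<and> t < s \<and> (f (x + s *\<^sub>R axis i 1 + s *\<^sub>R axis j 1) - f (x + s *\<^sub>R axis i 1))
        - (f (x + s *\<^sub>R axis j 1) - f x) =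
     s * (pd i f (x + t *\<^sub>R axis i 1 + s *\<^sub>R axis j 1) - pd i f (x + t *\<^sub>R axis i 1))"
  proof (rule mvt_line[where f="\<lambda>y. f (y + s *\<^sub>R axis j 1) - f y" and i=i and x=x])
    show "has_pd i (\<lambda>y. f (y + s *\<^sub>R axis j 1) - f y)
        (pd i f (x + t *\<^sub>R axis i 1 + s *\<^sub>R axis j 1) - pd i f (x + t *\<^sub>R axis i 1)) (x + t *\<^sub>R axis i 1)"
      if "0 \<le> t" "t \<le> s" for t
    proof -
      have "has_pd i (\<lambda>y. - f y) (- pd i f (x + t *\<^sub>R axis i 1)) (x + t *\<^sub>R axis i 1)"
        using inS[of t 0] that assms(1)
        by (intro has_pd_linear[OF bounded_linear_minus[OF bounded_linear_ident]] hp) auto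
      from has_pd_add[OF shift[OF hp(1)[OF inS[of t s]]] this]
      show ?thesis using that assms(1) by simp
    qed
  qed (use assms(1) in auto)
  then obtain t where t: "0 < t" "t < s" and eq1: "(f (x + s *\<^sub>R axis i 1 + s *\<^sub>R axis j 1) - f (x + s *\<^sub>R axis i 1))
        - (f (x + s *\<^sub>R axis j 1) - f x) =
     s * (pd i f (x + t *\<^sub>R axis i 1 + s *\<^sub>R axis j 1) - pd i f (x + t *\<^sub>R axis i 1))"
    by blast
  obtain t' where t': "0 < t'" "t' < s"
    and eq2: "pd i f (x + t *\<^sub>R axis i 1 + s *\<^sub>R axis j 1) - pd i f (x + t *\<^sub>R axis i 1)
      = s * pd j (pd i f) (x + t *\<^sub>R axis i 1 + t' *\<^sub>R axis j 1)"
  proof (rule mvt_line[where f="pd i f" and i=j and x="x + t *\<^sub>R axis i 1" and s=s])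
    show "has_pd j (pd i f) (pd j (pd i f) (x + t *\<^sub>R axis i 1 + r *\<^sub>R axis j 1)) (x + t *\<^sub>R axis i 1 + r *\<^sub>R axis j 1)"
      if "0 \<le> r" "r \<le> s" for r
      using inS[of t r] t that by (intro hp) auto
  qed (use assms(1) in auto)
  show ?thesis
  proof (rule that[of "x + t *\<^sub>R axis i 1 + t' *\<^sub>R axis j 1"])
    show "dist (x + t *\<^sub>R axis i 1 + t' *\<^sub>R axis j 1) x \<le> 2 * s" using t t' by (intro near) auto
  qed (use eq1 eq2 in \<open>simp add: power2_eq_square algebra_simps\<close>)
qed

lemma pd_commute_real:
  fixes f :: "real^'n::finite \<Rightarrow> real"
  assumes "open S" "Ck 2 S f" "x \<in> S"
  shows "pd i (pd j f) x = pd j (pd i f) x"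
proof -
  obtain r where r: "r > 0" "cball x r \<subseteq> S" using assms open_contains_cball by blast
  define s where "s n = r / 2 / real (Suc n)" for n
  have s: "s n > 0" "2 * s n \<le> r" for n using r(1) by (auto simp: s_def field_simps)
  have s0: "s \<longlonglongrightarrow> 0" unfolding s_def using lim_const_over_n[of "r / 2"] LIMSEQ_Suc by blast
  have cball: "cball x (2 * s n) \<subseteq> S" for n using r s(2)[of n] by auto
  have "\<exists>y z. dist y x \<le> 2 * s n \<and> dist z x \<le> 2 * s n \<and> pd j (pd i f) y = pd i (pd j f) z" for n
  proof -
    obtain y where y: "dist y x \<le> 2 * s n"
    "f (x + s n *\<^sub>R axis i 1 + s n *\<^sub>R axis j 1) - f (x + s n *\<^sub>R axis i 1) - f (x + s n *\<^sub>R axis j 1) + f x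
       = (s n)\<^sup>2 * pd j (pd i f) y"
      using second_difference[OF s(1) cball assms(2)] by blast
    obtain z where z: "dist z x \<le> 2 * s n"
    "f (x + s n *\<^sub>R axis j 1 + s n *\<^sub>R axis i 1) - f (x + s n *\<^sub>R axis j 1) - f (x + s n *\<^sub>R axis i 1) + f x
       = (s n)\<^sup>2 * pd i (pd j f) z"
      using second_difference[OF s(1) cball assms(2)] by blast
    have "(s n)\<^sup>2 * pd j (pd i f) y = (s n)\<^sup>2 * pd i (pd j f) z"
      using y(2) z(2) by (simp add: algebra_simps)
    then show ?thesis using y(1) z(1) s(1)[of n] by auto
  qed
  then obtain y z where yz: "\<And>n. dist (y n) x \<le> 2 * s n" "\<And>n. dist (z n) x \<le> 2 * s n"
    "\<And>n. pd j (pd i f) (y n) = pd i (pd j f) (z n)" by metis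
  have lim: "w \<longlonglongrightarrow> x" if "\<And>n. dist (w n) x \<le> 2 * s n" for w
  proof -
    have "(\<lambda>n. 2 * s n) \<longlonglongrightarrow> 2 * 0" by (intro tendsto_intros s0)
    then have "(\<lambda>n. dist (w n) x) \<longlonglongrightarrow> 0"
      by (intro tendsto_sandwich[of "\<lambda>_. 0" "\<lambda>n. dist (w n) x" _ "\<lambda>n. 2 * s n" 0]) (use that in auto)
    then show ?thesis using tendsto_dist_iff by blast
  qed
  have c: "isCont (pd j (pd i f)) x" "isCont (pd i (pd j f)) x"
    using assms by (auto simp: numeral_2_eq_2 continuous_on_eq_continuous_at)
  have "(\<lambda>n. pd j (pd i f) (y n)) \<longlonglongrightarrow> pd j (pd i f) x" "(\<lambda>n. pd i (pd j f) (z n)) \<longlonglongrightarrow> pd i (pd j f) x"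
    using c lim[of y] lim[of z] yz isCont_tendsto_compose by blast+
  then show ?thesis using yz(3) LIMSEQ_unique by simp
qed

lemma pd_commute:
  fixes f :: "real^'n::finite \<Rightarrow> complex"
  assumes "open S" "smooth_on S f" "x \<in> S"
  shows "pd i (pd j f) x = pd j (pd i f) x"
proof -
  have *: "L (pds [i, j] f x) = L (pds [j, i] f x)" if L: "bounded_linear L" for L :: "complex \<Rightarrow> real"
    using pds_linear[OF L assms(1,2,3), of "[i, j]"] pds_linear[OF L assms(1,2,3), of "[j, i]"]
      pd_commute_real[OF assms(1) _ assms(3), of "\<lambda>x. L (f x)" i j] smooth_on_linear[OF L assms(1,2)]
    by (simp add: smooth_on_iff_Ck)
  show ?thesis
    using *[OF bounded_linear_Re] *[OF bounded_linear_Im] by (simp add: complex_eq_iff)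
qed

lemma pds_move:
  fixes f :: "real^'n::finite \<Rightarrow> complex"
  assumes "open S" "smooth_on S f" "x \<in> S"
  shows "pds (ls @ i # rs) f x = pds (i # ls @ rs) f x"
  using assms(3)
proof (induction ls arbitrary: x)
  case (Cons a ls)
  have "pds ((a # ls) @ i # rs) f x = pd a (pd i (pds (ls @ rs) f)) x"
    by (simp, intro pd_cong[OF assms(1) Cons.prems]) (use Cons.IH in simp)
  also have "\<dots> = pd i (pd a (pds (ls @ rs) f)) x"
    by (rule pd_commute[OF assms(1) smooth_on_pds[OF assms(2)] Cons.prems])
  finally show ?case by simp
qed simp

lemma pds_perm:
  fixes f :: "real^'n::finite \<Rightarrow> complex"
  assumes "open S" "smooth_on S f" "x \<in> S" "mset is = mset js"
  shows "pds is f x = pds js f x"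
  using assms(3,4)
proof (induction "is" arbitrary: js x)
  case (Cons i "is")
  have "i \<in> set js" using Cons.prems(2) by (metis list.set_intros(1) set_mset_mset)
  then obtain ls rs where js: "js = ls @ i # rs" by (meson split_list)
  have "pds (i # is) f x = pd i (pds (ls @ rs) f) x"
    by (simp, intro pd_cong[OF assms(1) Cons.prems(1)]) (use Cons.IH Cons.prems js in simp)
  then show ?case using pds_move[OF assms(1,2) Cons.prems(1), of ls i rs] js by simp
qed simp

lemma count_list_eq_count: "count_list xs a = count (mset xs) a"
  by (induction xs) auto

lemma mlen_count_list: "mlen (count_list is) = length is"
  unfolding mlen_def by (rule sum_count_set) auto

lemma pds_eq_dpart:
  fixes f :: "real^'n::finite \<Rightarrow> complex"
  assumes "open S" "smooth_on S f" "x \<in> S"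
  shows "pds is f x = dpart (count_list is) f x"
proof -
  have "\<forall>i. count_list (SOME js. \<forall>i. count_list js i = count_list is i) i = count_list is i"
    by (rule someI[of "\<lambda>js. \<forall>i. count_list js i = count_list is i" "is"]) simp
  then show ?thesis
    unfolding dpart_def by (intro pds_perm[OF assms]) (simp add: multiset_eq_iff count_list_eq_count)
qed

lemma ex_list_count:
  fixes \<alpha> :: "'n::finite \<Rightarrow> nat"
  shows "\<exists>is. \<forall>i. count_list is i = \<alpha> i"
proof -
  obtain "is" where "mset is = Abs_multiset \<alpha>" using ex_mset by blast
  then show ?thesis by (intro exI[of _ "is"]) (simp add: count_list_eq_count)
qed

lemma finite_mlen_le: "finite {\<alpha> :: 'n::finite \<Rightarrow> nat. mlen \<alpha> \<le> m}"
proof (rule finite_subset)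
  show "{\<alpha> :: 'n \<Rightarrow> nat. mlen \<alpha> \<le> m} \<subseteq> PiE UNIV (\<lambda>_. {..m})"
    using member_le_sum[of _ UNIV "\<alpha> :: 'n \<Rightarrow> nat" for \<alpha>] 
    by (fastforce simp: mlen_def PiE_UNIV_domain intro: order_trans)
qed (intro finite_PiE, auto)

text \<open>Coordinates of \<open>x\<close> are replaced by those of \<open>y\<close> one at a time.
  Every intermediate point is componentwise between the two and so stays at distance at most
  \<open>\<rho>\<close> from \<open>x\<close>. This works from partial derivatives alone, without
  total differentiability.\<close>

lemma partial_lipschitz:
  fixes g :: "real^'n::finite \<Rightarrow> real"
  assumes "\<And>z i. dist z x \<le> \<rho> \<Longrightarrow> has_pd i g (D i z) z" "\<And>z i. dist z x \<le> \<rho> \<Longrightarrow> \<bar>D i z\<bar> \<le> B"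
    and "dist y x \<le> \<rho>"
  shows "\<bar>g y - g x\<bar> \<le> real CARD('n) * B * \<rho>"
proof -
  define w where "w A = (\<chi> i. if i \<in> A then y $ i else x $ i)" for A
  have w: "dist (w A + t *\<^sub>R axis i 1) x \<le> \<rho>" if "i \<notin> A" "\<bar>t\<bar> \<le> \<bar>y $ i - x $ i\<bar>" for A i t
  proof -
    have "norm (w A + t *\<^sub>R axis i 1 - x) \<le> norm (y - x)"
      by (rule norm_le_componentwise_cart) (use that in \<open>auto simp: w_def axis_def\<close>)
    then show ?thesis using assms(3) by (simp add: dist_norm)
  qed
  have B: "B \<ge> 0" using assms(2)[OF assms(3)] abs_ge_zero order_trans by blast
  have \<rho>: "\<bar>y $ i - x $ i\<bar> \<le> \<rho>" for i
    using component_le_norm_cart[of "y - x" i] assms(3) by (simp add: dist_norm)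
  have "\<bar>g (w A) - g x\<bar> \<le> real (card A) * (B * \<rho>)" for A
  proof (induction A rule: infinite_finite_induct)
    case (insert i A)
    define d where "d = y $ i - x $ i"
    have wi: "w (insert i A) = w A + d *\<^sub>R axis i 1"
      using insert by (auto simp: w_def vec_eq_iff axis_def d_def)
    have "norm (g (w A + d *\<^sub>R axis i 1) - g (w A + 0 *\<^sub>R axis i 1)) \<le> B * norm (d - 0)"
    proof (rule differentiable_bound[where S="{t. \<bar>t\<bar> \<le> \<bar>d\<bar>}"])
      show "convex {t. \<bar>t\<bar> \<le> \<bar>d\<bar>}"
      proof -
        have "{t. \<bar>t\<bar> \<le> \<bar>d\<bar>} = {-\<bar>d\<bar>..\<bar>d\<bar>}" by auto
        then show ?thesis by simp
      qed
      show "((\<lambda>t. g (w A + t *\<^sub>R axis i 1)) has_derivative (\<lambda>h. h *\<^sub>R D i (w A + t *\<^sub>R axis i 1))) (at t within {t. \<bar>t\<bar> \<le> \<bar>d\<bar>})"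
        if "t \<in> {t. \<bar>t\<bar> \<le> \<bar>d\<bar>}" for t
        using has_pd_line[OF assms(1)[OF w[OF insert.hyps(2)]]] that
        by (auto simp: has_vector_derivative_def d_def intro: has_derivative_at_withinI)
      show "onorm (\<lambda>h. h *\<^sub>R D i (w A + t *\<^sub>R axis i 1)) \<le> B" if "t \<in> {t. \<bar>t\<bar> \<le> \<bar>d\<bar>}" for t
        using assms(2)[OF w[OF insert.hyps(2)]] that
        by (intro onorm_bound[OF B]) (auto simp: d_def abs_mult mult.commute[of B] intro!: mult_left_mono)
    qed auto
    then have "\<bar>g (w (insert i A)) - g (w A)\<bar> \<le> B * \<rho>"
      using wi \<rho>[of i] mult_left_mono[OF _ B, of "\<bar>d\<bar>" \<rho>] by (simp add: d_def)
    with insert show ?case by (simp add: distrib_right)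
  qed (auto simp: w_def)
  from this[of UNIV] show ?thesis by (simp add: w_def mult.assoc)
qed

text \<open>Two uses of \<open>partial_lipschitz\<close> on the ball of radius
  \<open>dist y x\<close>: the inner one bounds \<open>pd i f z - pd i f x\<close>, the outer one
  treats \<open>F\<close>, which is \<open>f\<close> minus its linear part. Each contributes one
  factor \<open>dist y x\<close>; the summand 1 in the constant makes it positive.\<close>

lemma C2_taylor:
  fixes f :: "real^'n::finite \<Rightarrow> real"
  assumes "open S" "Ck 2 S f" "x \<in> S"
  obtains C r where "C > 0" "r > 0" "cball x r \<subseteq> S"
    "\<And>y. dist y x \<le> r \<Longrightarrow> \<bar>f y - f x - (\<Sum>i\<in>UNIV. pd i f x * (y $ i - x $ i))\<bar> \<le> C * (dist y x)\<^sup>2"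
proof -
  let ?n = "real CARD('n)"
  obtain r where r: "r > 0" "cball x r \<subseteq> S" using assms open_contains_cball by blast
  have hp: "has_pd i f (pd i f y) y" "has_pd j (pd i f) (pd j (pd i f) y) y" if "y \<in> S" for y i j
    using assms(2) that by (auto simp: numeral_2_eq_2)
  define B where "B i j = (SOME B. \<forall>z\<in>cball x r. norm (pd j (pd i f) z) \<le> B)" for i j
  have exB: "\<exists>B. \<forall>z\<in>cball x r. norm (pd j (pd i f) z) \<le> B" for i j
  proof -
    have "continuous_on (cball x r) (pd j (pd i f))"
      using assms(2) by (intro continuous_on_subset[OF _ r(2)]) (auto simp: numeral_2_eq_2)
    then have "compact (pd j (pd i f) ` cball x r)" by (intro compact_continuous_image) auto
    then show ?thesis using compact_imp_bounded[THEN bounded_normE] by (metis imageI)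
  qed
  have B: "norm (pd j (pd i f) z) \<le> B i j" if "z \<in> cball x r" for i j z
    using someI_ex[OF exB[of j i]] that unfolding B_def by blast
  define B' where "B' = (\<Sum>i\<in>UNIV. \<Sum>j\<in>UNIV. \<bar>B i j\<bar>)"
  have B': "\<bar>pd j (pd i f) z\<bar> \<le> B'" if "dist z x \<le> r" for i j z
  proof -
    have "\<bar>pd j (pd i f) z\<bar> \<le> \<bar>B i j\<bar>" using B[of z j i] that by (simp add: dist_commute)
    also have "\<dots> \<le> (\<Sum>j\<in>UNIV. \<bar>B i j\<bar>)" by (rule member_le_sum) auto
    also have "\<dots> \<le> B'" unfolding B'_def by (rule member_le_sum) (auto intro: sum_nonneg)
    finally show ?thesis .
  qed
  have B'0: "B' \<ge> 0" by (simp add: B'_def sum_nonneg)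
  show ?thesis
  proof (rule that[of "?n * ?n * B' + 1" r])
    show "?n * ?n * B' + 1 > 0" using B'0 by (intro add_nonneg_pos mult_nonneg_nonneg) auto
    fix y assume y: "dist y x \<le> r"
    define \<rho> where "\<rho> = dist y x"
    have inS: "z \<in> S" if "dist z x \<le> \<rho>" for z
      using that y r(2) by (auto simp: \<rho>_def dist_commute)
    define F where "F z = f z + (\<Sum>i\<in>UNIV. - pd i f x * z $ i)" for z
    have "\<bar>F y - F x\<bar> \<le> ?n * (?n * B' * \<rho>) * \<rho>"
    proof (rule partial_lipschitz[where D="\<lambda>i z. pd i f z - pd i f x"])
      fix z i assume z: "dist z x \<le> \<rho>"
      show "\<bar>pd i f z - pd i f x\<bar> \<le> ?n * B' * \<rho>"
        by (rule partial_lipschitz[where D="\<lambda>j z. pd j (pd i f) z"])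
           (use z y inS hp(2) B' in \<open>auto simp: \<rho>_def\<close>)
      have "has_pd i (\<lambda>z. \<Sum>j\<in>UNIV. - pd j f x * z $ j) (\<Sum>j\<in>UNIV. - pd j f x * (if i = j then 1 else 0)) z"
        unfolding has_pd_def
        by (intro has_vector_derivative_sum has_vector_derivative_mult_right has_pd_component[unfolded has_pd_def])
      from has_pd_add[OF hp(1)[OF inS[OF z]] this]
      show "has_pd i F (pd i f z - pd i f x) z"
        unfolding F_def by (simp add: if_distrib cong: if_cong)
    qed (simp add: \<rho>_def)
    also have "F y - F x = f y - f x - (\<Sum>i\<in>UNIV. pd i f x * (y $ i - x $ i))"
      by (simp add: F_def algebra_simps sum_subtractf sum_negf)
    also have "?n * (?n * B' * \<rho>) * \<rho> \<le> (?n * ?n * B' + 1) * \<rho>\<^sup>2"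
      by (simp add: power2_eq_square algebra_simps)
    finally show "\<bar>f y - f x - (\<Sum>i\<in>UNIV. pd i f x * (y $ i - x $ i))\<bar> \<le> (?n * ?n * B' + 1) * (dist y x)\<^sup>2"
      by (simp add: \<rho>_def)
  qed (use r in auto)
qed

section \<open>Cutoff functions and supports of distributions\<close>

abbreviation ceta :: "nat \<Rightarrow> real \<Rightarrow> complex" where
  "ceta n t \<equiv> complex_of_real (eta n t)"

lemma has_vector_derivative_eta:
  "((\<lambda>t. ceta n t) has_vector_derivative ceta (Suc n) t) (at t)"
  using bounded_linear.has_vector_derivative[OF bounded_linear_of_real, OF
      has_real_derivative_eta[unfolded has_real_derivative_iff_has_vector_derivative]] .

lemma smooth_on_eta_compose:
  fixes f :: "real^'n::finite \<Rightarrow> real"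
  shows "open S \<Longrightarrow> smooth_on S f \<Longrightarrow> smooth_on S (\<lambda>x. ceta n (f x))"
  by (rule smooth_on_compose[where \<sigma>="\<lambda>n t. ceta n t", OF has_vector_derivative_eta])

lemma dist_power2_eq_sum: "(dist x y)\<^sup>2 = (\<Sum>i\<in>UNIV. (x $ i - y $ i)\<^sup>2)"
  for x y :: "real^'n::finite"
  by (simp only: dist_norm power2_norm_eq_inner inner_vec_def) (simp add: power2_eq_square)

lemma smooth_on_dist_power2:
  "open S \<Longrightarrow> smooth_on S (\<lambda>x::real^'n::finite. (dist x c)\<^sup>2)"
  unfolding dist_power2_eq_sum
  by (intro smooth_on_sum smooth_on_power smooth_on_diff smooth_on_component smooth_on_const)

lemma ex_cutoff:
  fixes c :: "real^'n::finite"
  assumes "0 < a" "a < b"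
  obtains \<kappa> :: "real^'n \<Rightarrow> complex" where "smooth_on UNIV \<kappa>"
    "\<And>x. dist x c \<le> a \<Longrightarrow> \<kappa> x = 1" "\<And>x. dist x c \<ge> b \<Longrightarrow> \<kappa> x = 0"
proof
  \<comment> \<open>The squared distance is smooth also at the centre \<open>c\<close>; as
    \<open>a < b\<close>, the functions \<open>A\<close> and \<open>B\<close> never vanish
    together.\<close>
  define A where "A x = ceta 0 (b\<^sup>2 - (dist x c)\<^sup>2)" for x
  define B where "B x = ceta 0 ((dist x c)\<^sup>2 - a\<^sup>2)" for x
  have smooth: "smooth_on UNIV A" "smooth_on UNIV B"
    unfolding A_def B_def
    by (intro smooth_on_eta_compose smooth_on_diff smooth_on_const smooth_on_dist_power2 open_UNIV)+
  have ab: "a\<^sup>2 < b\<^sup>2" using assms by (simp add: power_strict_mono)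
  have nz: "A x + B x \<noteq> 0" for x
  proof -
    have eta0: "eta 0 t \<ge> 0" for t using eta_0_pos[of t] eta_nonpos[of t 0] by linarith
    have "eta 0 (b\<^sup>2 - (dist x c)\<^sup>2) + eta 0 ((dist x c)\<^sup>2 - a\<^sup>2) > 0"
    proof (cases "(dist x c)\<^sup>2 < b\<^sup>2")
      case True
      then show ?thesis by (intro add_pos_nonneg eta_0_pos eta0) auto
    next
      case False
      then show ?thesis using ab by (intro add_nonneg_pos eta_0_pos eta0) auto
    qed
    then show ?thesis unfolding A_def B_def of_real_add[symmetric] of_real_eq_0_iff by linarith
  qed
  show "smooth_on UNIV (\<lambda>x. A x * inverse (A x + B x))"
    by (intro smooth_on_mult smooth_on_inverse smooth_on_add smooth open_UNIV nz)
  show "A x * inverse (A x + B x) = 1" if "dist x c \<le> a" for x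
  proof -
    have "(dist x c)\<^sup>2 \<le> a\<^sup>2" using that by (simp add: power_mono)
    then have "B x = 0" by (simp add: B_def)
    then show ?thesis using nz[of x] by simp
  qed
  show "A x * inverse (A x + B x) = 0" if "dist x c \<ge> b" for x
  proof -
    have "b\<^sup>2 \<le> (dist x c)\<^sup>2" using that assms by (simp add: power_mono)
    then show ?thesis by (simp add: A_def)
  qed
qed

lemma tsupp_subset: "closed C \<Longrightarrow> (\<And>x. x \<notin> C \<Longrightarrow> f x = 0) \<Longrightarrow> tsupp f \<subseteq> C"
  unfolding tsupp_def by (rule closure_minimal) auto

lemma closed_tsupp: "closed (tsupp f)"
  by (simp add: tsupp_def)

lemma eq_0_off_tsupp: "x \<notin> tsupp f \<Longrightarrow> f x = 0"
  using closure_subset[of "{x. f x \<noteq> 0}"] by (auto simp: tsupp_def)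

lemma test_fun_smooth: "test_fun \<Omega> \<phi> \<Longrightarrow> smooth_on UNIV \<phi>"
  by (simp add: test_fun_def)

lemma test_fun_I:
  assumes "smooth_on UNIV \<phi>" "compact K" "K \<subseteq> \<Omega>" "\<And>x. x \<notin> K \<Longrightarrow> \<phi> x = 0"
  shows "test_fun \<Omega> \<phi>"
proof -
  have "tsupp \<phi> \<subseteq> K" by (rule tsupp_subset) (use assms compact_imp_closed in auto)
  then show ?thesis
    unfolding test_fun_def using assms compact_Int_closed[OF assms(2) closed_tsupp[of \<phi>]]
    by (auto simp: Int_absorb1)
qed

lemma test_fun_mult:
  assumes "test_fun \<Omega> \<phi>" "smooth_on UNIV f"
  shows "test_fun \<Omega> (\<lambda>x. f x * \<phi> x)"
  by (rule test_fun_I[of _ "tsupp \<phi>"])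
     (use assms eq_0_off_tsupp in \<open>auto simp: test_fun_def intro: smooth_on_mult\<close>)

lemma test_fun_add:
  assumes "test_fun \<Omega> \<phi>" "test_fun \<Omega> \<psi>"
  shows "test_fun \<Omega> (\<lambda>x. \<phi> x + \<psi> x)"
  by (rule test_fun_I[of _ "tsupp \<phi> \<union> tsupp \<psi>"])
     (use assms eq_0_off_tsupp[of _ \<phi>] eq_0_off_tsupp[of _ \<psi>] in \<open>auto simp: test_fun_def intro: smooth_on_add\<close>)

lemma test_fun_zero: "test_fun \<Omega> (\<lambda>x. 0)"
  by (rule test_fun_I[of _ "{}"]) (auto intro: smooth_on_const)

lemma test_fun_sum:
  "(\<And>a. a \<in> A \<Longrightarrow> test_fun \<Omega> (f a)) \<Longrightarrow> test_fun \<Omega> (\<lambda>x. \<Sum>a\<in>A. f a x)"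
  by (induction A rule: infinite_finite_induct) (auto intro: test_fun_zero test_fun_add)

lemma test_fun_diff:
  assumes "test_fun \<Omega> \<phi>" "test_fun \<Omega> \<psi>"
  shows "test_fun \<Omega> (\<lambda>x. \<phi> x - \<psi> x)"
  using test_fun_add[OF assms(1) test_fun_mult[OF assms(2) smooth_on_const[of _ "-1"]]] by simp

lemma distribution_add:
  "distribution \<Omega> u \<Longrightarrow> test_fun \<Omega> \<phi> \<Longrightarrow> test_fun \<Omega> \<psi> \<Longrightarrow> u (\<lambda>x. \<phi> x + \<psi> x) = u \<phi> + u \<psi>"
  by (simp add: distribution_def)

lemma distribution_scale:
  "distribution \<Omega> u \<Longrightarrow> test_fun \<Omega> \<phi> \<Longrightarrow> u (\<lambda>x. c * \<phi> x) = c * u \<phi>"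
  by (simp add: distribution_def)

lemma distribution_zero: "distribution \<Omega> u \<Longrightarrow> u (\<lambda>x. 0) = 0"
  using distribution_scale[OF _ test_fun_zero, of \<Omega> u 0] by simp

lemma distribution_diff:
  assumes "distribution \<Omega> u" "test_fun \<Omega> \<phi>" "test_fun \<Omega> \<psi>"
  shows "u (\<lambda>x. \<phi> x - \<psi> x) = u \<phi> - u \<psi>"
  using distribution_add[OF assms(1,2) test_fun_mult[OF assms(3) smooth_on_const[of _ "-1"]]]
    distribution_scale[OF assms(1,3), of "-1"] by simp

lemma distribution_sum:
  assumes "distribution \<Omega> u" "\<And>a. a \<in> A \<Longrightarrow> test_fun \<Omega> (f a)"
  shows "u (\<lambda>x. \<Sum>a\<in>A. f a x) = (\<Sum>a\<in>A. u (f a))"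
  using assms(2)
  by (induction A rule: infinite_finite_induct)
     (auto simp: distribution_zero[OF assms(1)] distribution_add[OF assms(1)] test_fun_sum)

text \<open>The support is defined by open sets on which \<open>u\<close> vanishes, so vanishing has
  to be glued. Instead of using a partition of unity, one ball of a finite cover is split off at a
  time with a cutoff.\<close>

lemma distribution_vanish:
  fixes u :: "(real^'n::finite \<Rightarrow> complex) \<Rightarrow> complex"
  assumes u: "distribution \<Omega> u" and \<theta>: "test_fun \<Omega> \<theta>" and disj: "tsupp \<theta> \<inter> dsupp \<Omega> u = {}"
  shows "u \<theta> = 0"
proof -
  \<comment> \<open>Twice the radius leaves room for a cutoff that is 1 on the ball of radius
    \<open>\<rho>\<close> used in the cover.\<close>
  define N where "N x \<rho> \<longleftrightarrow> \<rho> > 0 \<and> (\<forall>\<phi>. test_fun \<Omega> \<phi> \<and> tsupp \<phi> \<subseteq> cball x (2 * \<rho>) \<longrightarrow> u \<phi> = 0)" for x \<rho>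
  have "\<exists>\<rho>. N x \<rho>" if x: "x \<in> tsupp \<theta>" for x
  proof -
    have "x \<in> \<Omega>" "x \<notin> dsupp \<Omega> u" using x \<theta> disj by (auto simp: test_fun_def)
    then obtain V where V: "open V" "x \<in> V" "\<And>\<phi>. test_fun \<Omega> \<phi> \<Longrightarrow> tsupp \<phi> \<subseteq> V \<Longrightarrow> u \<phi> = 0"
      unfolding dsupp_def by blast
    then obtain e where "e > 0" "cball x e \<subseteq> V" using open_contains_cball by blast
    then show ?thesis using V(3) by (intro exI[of _ "e / 2"]) (auto simp: N_def)
  qed
  then obtain \<rho> where \<rho>: "\<And>x. x \<in> tsupp \<theta> \<Longrightarrow> N x (\<rho> x)" by metis
  have "compact (tsupp \<theta>)" using \<theta> by (simp add: test_fun_def)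
  moreover have "tsupp \<theta> \<subseteq> (\<Union>x\<in>tsupp \<theta>. ball x (\<rho> x))" using \<rho> by (force simp: N_def)
  ultimately obtain D where D: "D \<subseteq> tsupp \<theta>" "finite D" "tsupp \<theta> \<subseteq> (\<Union>x\<in>D. ball x (\<rho> x))"
    using compactE_image[of "tsupp \<theta>" "tsupp \<theta>" "\<lambda>x. ball x (\<rho> x)"] by (metis open_ball)
  have "u \<phi> = 0" if "test_fun \<Omega> \<phi>" "tsupp \<phi> \<subseteq> (\<Union>x\<in>D. ball x (\<rho> x))" for \<phi>
    using D(2) D(1) that
  proof (induction D arbitrary: \<phi> rule: finite_induct)
    case empty
    then have "\<phi> = (\<lambda>x. 0)" using eq_0_off_tsupp[of _ \<phi>] by auto
    then show ?case using distribution_zero[OF u] by simp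
  next
    case (insert x D)
    have Nx: "N x (\<rho> x)" using insert.prems \<rho> by auto
    obtain \<kappa> :: "real^'n \<Rightarrow> complex" where \<kappa>: "smooth_on UNIV \<kappa>"
      "\<And>y. dist y x \<le> \<rho> x \<Longrightarrow> \<kappa> y = 1" "\<And>y. dist y x \<ge> 2 * \<rho> x \<Longrightarrow> \<kappa> y = 0"
      using ex_cutoff[of "\<rho> x" "2 * \<rho> x" x] Nx by (auto simp: N_def)
    have t1: "test_fun \<Omega> (\<lambda>y. \<kappa> y * \<phi> y)" by (rule test_fun_mult[OF insert.prems(2) \<kappa>(1)])
    have t2: "test_fun \<Omega> (\<lambda>y. (1 - \<kappa> y) * \<phi> y)"
      by (intro test_fun_mult[OF insert.prems(2)] smooth_on_diff smooth_on_const \<kappa> open_UNIV)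
    have "tsupp (\<lambda>y. \<kappa> y * \<phi> y) \<subseteq> cball x (2 * \<rho> x)"
      by (rule tsupp_subset) (use \<kappa>(3) in \<open>auto simp: dist_commute\<close>)
    then have u1: "u (\<lambda>y. \<kappa> y * \<phi> y) = 0" using Nx t1 by (auto simp: N_def)
    have "tsupp (\<lambda>y. (1 - \<kappa> y) * \<phi> y) \<subseteq> tsupp \<phi> - ball x (\<rho> x)"
      by (rule tsupp_subset) 
         (use \<kappa>(2) eq_0_off_tsupp[of _ \<phi>] in \<open>auto simp: dist_commute intro: closed_Diff closed_tsupp\<close>)
    then have "tsupp (\<lambda>y. (1 - \<kappa> y) * \<phi> y) \<subseteq> (\<Union>x\<in>D. ball x (\<rho> x))"
      using insert.prems(3) by auto
    then have "u (\<lambda>y. (1 - \<kappa> y) * \<phi> y) = 0"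
      using insert.IH[OF _ t2] insert.prems(1) by auto
    then show ?case
      using distribution_add[OF u t1 t2] u1 by (simp add: algebra_simps)
  qed
  then show ?thesis using \<theta> D(3) by blast
qed

text \<open>Agreement on the support alone would leave transversal derivatives uncontrolled; with an
  open neighbourhood the difference has its support away from
  \<open>dsupp \<Omega> u\<close>.\<close>

lemma distribution_eq_near_dsupp:
  fixes u :: "(real^'n::finite \<Rightarrow> complex) \<Rightarrow> complex"
  assumes u: "distribution \<Omega> u" and t: "test_fun \<Omega> \<phi>" "test_fun \<Omega> \<psi>"
    and V: "open V" "dsupp \<Omega> u \<subseteq> V" "\<And>x. x \<in> V \<Longrightarrow> \<phi> x = \<psi> x"
  shows "u \<phi> = u \<psi>"
proof -
  have "tsupp (\<lambda>x. \<phi> x - \<psi> x) \<subseteq> - V"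
    by (rule tsupp_subset) (use V in auto)
  then have "u (\<lambda>x. \<phi> x - \<psi> x) = 0"
    using V(2) by (intro distribution_vanish[OF u] test_fun_diff t) auto
  then show ?thesis using distribution_diff[OF u t] by simp
qed

section \<open>Polynomial approximation of derivatives\<close>

lemma linear_eq_sum_axis:
  fixes f :: "real^'n::finite \<Rightarrow> real"
  assumes "bounded_linear f"
  shows "f x = (\<Sum>j\<in>UNIV. x $ j * f (axis j 1))"
proof -
  interpret bounded_linear f by fact
  have "f x = f (\<Sum>j\<in>UNIV. x $ j *\<^sub>R axis j 1)"
    using basis_expansion[of x] by (simp add: scalar_mult_eq_scaleR)
  then show ?thesis by (simp add: sum scaleR)
qed

lemma smooth_on_real_polynomial_function:
  fixes p :: "real^'n::finite \<Rightarrow> real"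
  assumes "real_polynomial_function p" "open S"
  shows "smooth_on S p"
  using assms(1)
proof induction
  case (linear f)
  have "f = (\<lambda>x. \<Sum>j\<in>UNIV. x $ j * f (axis j 1))"
    using linear_eq_sum_axis[OF linear] by blast
  moreover have "smooth_on S (\<lambda>x. \<Sum>j\<in>UNIV. x $ j * f (axis j 1))"
    by (intro smooth_on_sum smooth_on_mult smooth_on_component smooth_on_const assms)
  ultimately show ?case by simp
qed (auto intro: smooth_on_const smooth_on_add smooth_on_mult assms)

text \<open>Polynomials rewritten as sums of powers of one coordinate, with coefficients constant
  along it. The closure rules of \<open>real_polynomial_function\<close> include products, for which
  antiderivatives cannot be formed factor by factor.\<close>

inductive poly_in_coord :: "'n::finite \<Rightarrow> (real^'n \<Rightarrow> real) \<Rightarrow> bool" for i where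
  base: "real_polynomial_function c \<Longrightarrow> (\<And>x y. (\<And>j. j \<noteq> i \<Longrightarrow> x $ j = y $ j) \<Longrightarrow> c x = c y) \<Longrightarrow>
    poly_in_coord i (\<lambda>x. c x * (x $ i) ^ k)"
| add: "poly_in_coord i f \<Longrightarrow> poly_in_coord i g \<Longrightarrow> poly_in_coord i (\<lambda>x. f x + g x)"

lemma poly_in_coord_mult:
  assumes "poly_in_coord i f" "poly_in_coord i g"
  shows "poly_in_coord i (\<lambda>x. f x * g x)"
  using assms(1)
proof induction
  case (base c k)
  show ?case using assms(2)
  proof induction
    case (base d l)
    have "poly_in_coord i (\<lambda>x. (c x * d x) * (x $ i) ^ (k + l))"
      by (rule poly_in_coord.base)
         (use base.hyps \<open>real_polynomial_function c\<close> \<open>\<And>x y. (\<And>j. j \<noteq> i \<Longrightarrow> x $ j = y $ j) \<Longrightarrow> c x = c y\<close>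
           in \<open>metis real_polynomial_function.intros(4)\<close>)+
    then show ?case by (simp add: power_add mult_ac)
  next
    case (add f g)
    then show ?case by (simp add: distrib_left poly_in_coord.add)
  qed
next
  case (add f g)
  then show ?case by (simp add: distrib_right poly_in_coord.add)
qed

lemma real_polynomial_function_component: "real_polynomial_function (\<lambda>x::real^'n::finite. x $ j)"
  by (rule real_polynomial_function.intros(1)) (rule bounded_linear_vec_nth)

lemma real_polynomial_function_poly_in_coord:
  fixes p :: "real^'n::finite \<Rightarrow> real"
  assumes "real_polynomial_function p"
  shows "poly_in_coord i p"
  using assms
proof induction
  case (linear f)
  have "f x = (\<Sum>j\<in>UNIV - {i}. x $ j * f (axis j 1)) * (x $ i) ^ 0 + f (axis i 1) * (x $ i) ^ 1" for x
    unfolding linear_eq_sum_axis[OF linear, of x] by (subst sum.remove[of UNIV i]) auto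
  then have eq: "f = (\<lambda>x. (\<Sum>j\<in>UNIV - {i}. x $ j * f (axis j 1)) * (x $ i) ^ 0 + f (axis i 1) * (x $ i) ^ 1)"
    by blast
  have "poly_in_coord i (\<lambda>x. (\<Sum>j\<in>UNIV - {i}. x $ j * f (axis j 1)) * (x $ i) ^ 0 + f (axis i 1) * (x $ i) ^ 1)"
  proof (intro poly_in_coord.intros)
    show "real_polynomial_function (\<lambda>x. \<Sum>j\<in>UNIV - {i}. x $ j * f (axis j 1))"
      by (intro real_polynomial_function_sum real_polynomial_function.intros(4) real_polynomial_function_component
          real_polynomial_function.intros(2)) auto
  qed (auto intro: real_polynomial_function.intros(2))
  then show ?case using eq by simp
next
  case (const c)
  have "poly_in_coord i (\<lambda>x. c * (x $ i) ^ 0)"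
    by (rule poly_in_coord.base) (auto intro: real_polynomial_function.intros(2))
  then show ?case by simp
qed (auto intro: poly_in_coord.add poly_in_coord_mult)

lemma polynomial_antiderivative:
  fixes p :: "real^'n::finite \<Rightarrow> real"
  assumes "real_polynomial_function p"
  obtains P where "real_polynomial_function P" "\<And>x. has_pd i P (p x) x" "\<And>x. x $ i = b \<Longrightarrow> P x = 0"
proof -
  have "poly_in_coord i p" using assms by (rule real_polynomial_function_poly_in_coord)
  then have "\<exists>P. real_polynomial_function P \<and> (\<forall>x. has_pd i P (p x) x) \<and> (\<forall>x. x $ i = b \<longrightarrow> P x = 0)"
  proof induction
    case (base c k)
    let ?P = "\<lambda>x. c x * ((x $ i) ^ Suc k - b ^ Suc k) * inverse (real (Suc k))"
    have "real_polynomial_function ?P"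
      by (intro real_polynomial_function.intros(4) real_polynomial_function_diff real_polynomial_function_power
          real_polynomial_function_component real_polynomial_function.intros(2) base)
    moreover have "has_pd i ?P (c x * (x $ i) ^ k) x" for x
    proof -
      have c: "c (x + t *\<^sub>R axis i 1) = c x" for t by (rule base) (simp add: axis_def)
      have "((\<lambda>t. c x * ((x $ i + t) ^ Suc k - b ^ Suc k) * inverse (real (Suc k))) has_real_derivative
         c x * (real (Suc k) * (x $ i + 0) ^ k) * inverse (real (Suc k))) (at 0)"
        by (rule derivative_eq_intros refl)+ simp
      then show ?thesis
        unfolding has_pd_def c has_real_derivative_iff_has_vector_derivative[symmetric]
        by (simp add: axis_def field_simps del: power_Suc of_nat_Suc)
    qed
    ultimately show ?case by (intro exI[of _ ?P]) auto
  next
    case (add f g)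
    then obtain F G where
      "real_polynomial_function F" "\<And>x. has_pd i F (f x) x" "\<And>x. x $ i = b \<Longrightarrow> F x = 0"
      "real_polynomial_function G" "\<And>x. has_pd i G (g x) x" "\<And>x. x $ i = b \<Longrightarrow> G x = 0" by metis
    then show ?case
      by (intro exI[of _ "\<lambda>x. F x + G x"]) (auto intro: real_polynomial_function.intros(3) has_pd_add)
  qed
  then show ?thesis using that by blast
qed

text \<open>Moving in the directions of \<open>is\<close> stays inside the hyperplane.\<close>

lemma pds_zero_on_hyperplane:
  fixes P :: "real^'n::finite \<Rightarrow> real"
  assumes "\<And>x. x $ i = b \<Longrightarrow> P x = 0" "i \<notin> set is" "x $ i = b"
  shows "pds is P x = 0"
  using assms(2,3)
proof (induction "is" arbitrary: x)
  case (Cons j "is")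
  have "(x + t *\<^sub>R axis j 1) $ i = b" for t
    using Cons.prems by (auto simp: axis_def)
  then have "pds is P (x + t *\<^sub>R axis j 1) = 0" for t
    using Cons.IH Cons.prems(1) by simp
  then have "has_pd j (pds is P) 0 x"
    by (simp add: has_pd_def)
  then show ?case by (simp add: has_pd_imp_pd)
qed (use assms in simp)

lemma pds_real_perm:
  fixes f :: "real^'n::finite \<Rightarrow> real"
  assumes "open S" "smooth_on S f" "x \<in> S" "mset is = mset js"
  shows "pds is f x = pds js f x"
proof -
  have "pds ls (\<lambda>x. complex_of_real (f x)) x = complex_of_real (pds ls f x)" for ls
    by (rule pds_linear[OF bounded_linear_of_real assms(1-3)])
  then show ?thesis
    using pds_perm[OF assms(1) smooth_on_of_real[OF assms(1,2)] assms(3,4)]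
    by (metis of_real_eq_iff)
qed

text \<open>A uniform approximation of \<open>\<theta>\<close> says nothing about derivatives, so
  \<open>pd i \<theta>\<close> is approximated and the result integrated along coordinate
  \<open>i\<close>, starting at the face where that coordinate is \<open>- R\<close>; there
  \<open>\<theta>\<close> and its derivatives vanish. Lists containing \<open>i\<close> reduce to
  the approximation of \<open>pd i \<theta>\<close>; for the others the error is integrated from
  that face.\<close>

lemma polynomial_approx_derivatives_aux:
  fixes \<theta> :: "real^'n::finite \<Rightarrow> real"
  assumes "R > 0" "smooth_on UNIV \<theta>" "\<And>x i. x \<in> tsupp \<theta> \<Longrightarrow> \<bar>x $ i\<bar> < R" "\<epsilon> > 0"
  shows "\<exists>p. real_polynomial_function p \<and>
    (\<forall>is. mset is \<subseteq># mset js \<longrightarrow> (\<forall>x. (\<forall>i. \<bar>x $ i\<bar> \<le> R) \<longrightarrow> \<bar>pds is \<theta> x - pds is p x\<bar> \<le> \<epsilon>))"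
  using assms(2-4)
proof (induction js arbitrary: \<theta> \<epsilon>)
  case Nil
  have Q: "{x::real^'n. \<forall>i. \<bar>x $ i\<bar> \<le> R} = cbox (\<chi> i. - R) (\<chi> i. R)"
    by (auto simp: mem_box_cart abs_le_iff) (metis minus_le_iff)+
  have "compact (cbox (\<chi> i. - R) (\<chi> i. R) :: (real^'n) set)" by simp
  moreover have "continuous_on (cbox (\<chi> i. - R) (\<chi> i. R)) \<theta>"
    using Nil(1) smooth_on_continuous continuous_on_subset by blast
  ultimately obtain p where "real_polynomial_function p" "\<And>x. x \<in> cbox (\<chi> i. - R) (\<chi> i. R) \<Longrightarrow> \<bar>\<theta> x - p x\<bar> < \<epsilon>"
    using Stone_Weierstrass_real_polynomial_function Nil(3) by blast
  then show ?case unfolding Q[symmetric] by (intro exI[of _ p]) (auto simp: less_imp_le)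
next
  case (Cons i js)
  \<comment> \<open>Integration along a segment of length at most \<open>2 * R\<close> multiplies
    the error by that length; the summand 1 also gives
    \<open>\<delta> \<le> \<epsilon>\<close>.\<close>
  define \<delta> where "\<delta> = \<epsilon> / (2 * R + 1)"
  have \<delta>: "\<delta> > 0" "\<delta> \<le> \<epsilon>" "2 * R * \<delta> \<le> \<epsilon>" using Cons.prems(3) assms(1) by (auto simp: \<delta>_def field_simps)
  have supp: "x \<in> tsupp (pd i \<theta>) \<Longrightarrow> x \<in> tsupp \<theta>" for x
    using tsupp_subset[OF closed_tsupp, of \<theta> "pd i \<theta>"] pds_eq_0_off_tsupp[of _ \<theta> "[i]"] by auto
  have "\<exists>p. real_polynomial_function p \<and> (\<forall>is. mset is \<subseteq># mset js \<longrightarrow>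
      (\<forall>x. (\<forall>i. \<bar>x $ i\<bar> \<le> R) \<longrightarrow> \<bar>pds is (pd i \<theta>) x - pds is p x\<bar> \<le> \<delta>))"
    by (rule Cons.IH[OF smooth_on_pd[OF Cons.prems(1)] Cons.prems(2)[OF supp] \<delta>(1)])
  then obtain p where p: "real_polynomial_function p"
    "\<And>is x. mset is \<subseteq># mset js \<Longrightarrow> (\<And>i. \<bar>x $ i\<bar> \<le> R) \<Longrightarrow> \<bar>pds is (pd i \<theta>) x - pds is p x\<bar> \<le> \<delta>"
    by blast
  obtain P where P: "real_polynomial_function P" "\<And>x. has_pd i P (p x) x" "\<And>x. x $ i = - R \<Longrightarrow> P x = 0"
    using polynomial_antiderivative[OF p(1), of i "-R"] by blast
  have pdP: "pd i P = p" using P(2) has_pd_imp_pd by blast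
  define F where "F x = \<theta> x - P x" for x
  have smP: "smooth_on UNIV P" using smooth_on_real_polynomial_function[OF P(1)] by simp
  have smF: "smooth_on UNIV F" unfolding F_def by (intro smooth_on_diff smP Cons.prems open_UNIV)
  have pdsF: "pds is F x = pds is \<theta> x - pds is P x" for "is" x
    unfolding F_def by (rule pds_diff[OF open_UNIV Cons.prems(1) smP]) simp
  have snoc: "\<bar>pds (is @ [i]) F x\<bar> \<le> \<delta>" if "mset is \<subseteq># mset js" "\<And>i. \<bar>x $ i\<bar> \<le> R" for "is" x
    using p(2)[OF that] by (subst pdsF) (simp add: pds_snoc pdP)
  have "\<bar>pds is F x\<bar> \<le> \<epsilon>" if sub: "mset is \<subseteq># mset (i # js)" and x: "\<And>i. \<bar>x $ i\<bar> \<le> R" for "is" x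
  proof (cases "i \<in> set is")
    case True
    then obtain ls rs where "is": "is = ls @ i # rs" by (meson split_list)
    then have "pds is F x = pds ((ls @ rs) @ [i]) F x"
      by (intro pds_real_perm[OF open_UNIV smF]) auto
    moreover have "mset (ls @ rs) \<subseteq># mset js" using sub "is" by simp
    ultimately show ?thesis using snoc x \<delta>(2) by fastforce
  next
    case False
    have sub': "mset is \<subseteq># mset js"
      using sub False by (metis inter_add_left1 mset.simps(2) set_mset_mset subset_mset.inf.absorb_iff2 subset_mset.inf_commute)
    \<comment> \<open>The projection of \<open>x\<close> to the face; it lies outside
      \<open>tsupp \<theta>\<close>, and \<open>P\<close> vanishes on that face.\<close>
    define y where "y = x - (x $ i + R) *\<^sub>R axis i 1"
    have y: "y $ i = - R" "\<And>j. j \<noteq> i \<Longrightarrow> y $ j = x $ j" by (auto simp: y_def axis_def)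
    have "y \<notin> tsupp \<theta>" using Cons.prems(2)[of y i] y assms(1) by auto
    then have Fy: "pds is F y = 0"
      using pds_zero_on_hyperplane[OF P(3) False y(1)] pds_eq_0_off_tsupp[of y \<theta> "is"] pdsF by simp
    show ?thesis
    proof (cases "x $ i = - R")
      case True
      then have "x = y" by (simp add: y_def)
      then show ?thesis using Fy Cons.prems(3) by simp
    next
      case neq: False
      then have pos: "x $ i + R > 0" using x[of i] by auto
      obtain t where t: "0 < t" "t < x $ i + R"
        "pds is F (y + (x $ i + R) *\<^sub>R axis i 1) - pds is F y = (x $ i + R) * pds (i # is) F (y + t *\<^sub>R axis i 1)"
        using mvt_line[OF pos, of i "pds is F" "\<lambda>t. pds (i # is) F (y + t *\<^sub>R axis i 1)" y]
          smooth_on_has_pd[OF smooth_on_pds[OF smF]] by auto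
      have "\<bar>(y + t *\<^sub>R axis i 1) $ j\<bar> \<le> R" for j
        using t(1,2) y x[of j] by (cases "j = i") (auto simp: axis_def)
      then have "\<bar>pds (is @ [i]) F (y + t *\<^sub>R axis i 1)\<bar> \<le> \<delta>" by (intro snoc sub')
      moreover have "pds (i # is) F (y + t *\<^sub>R axis i 1) = pds (is @ [i]) F (y + t *\<^sub>R axis i 1)"
        by (rule pds_real_perm[OF open_UNIV smF]) auto
      moreover have "\<bar>pds is F x\<bar> = (x $ i + R) * \<bar>pds (i # is) F (y + t *\<^sub>R axis i 1)\<bar>"
        using t(3) Fy pos by (simp add: y_def abs_mult)
      ultimately have "\<bar>pds is F x\<bar> \<le> (x $ i + R) * \<delta>"
        using pos by (simp add: mult_left_mono)
      also have "\<dots> \<le> 2 * R * \<delta>" using x[of i] \<delta>(1) by (intro mult_right_mono) auto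
      finally show ?thesis using \<delta>(3) by simp
    qed
  qed
  then show ?case using P(1) pdsF by (intro exI[of _ P]) auto
qed

lemma polynomial_approx_derivatives:
  fixes \<theta> :: "real^'n::finite \<Rightarrow> real"
  assumes "smooth_on UNIV \<theta>" "compact (tsupp \<theta>)" "bounded K" "\<epsilon> > 0"
  obtains p where "real_polynomial_function p"
    "\<And>is x. length is \<le> k \<Longrightarrow> x \<in> K \<Longrightarrow> \<bar>pds is \<theta> x - pds is p x\<bar> \<le> \<epsilon>"
proof -
  have "bounded (tsupp \<theta> \<union> K)" using assms compact_imp_bounded by auto
  then obtain B where B: "B > 0" "\<And>x. x \<in> tsupp \<theta> \<union> K \<Longrightarrow> norm x \<le> B"
    using bounded_pos[of "tsupp \<theta> \<union> K"] by auto
  have comp: "\<bar>x $ i\<bar> < B + 1" if "x \<in> tsupp \<theta> \<union> K" for x i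
    using B(2)[OF that] component_le_norm_cart[of x i] by linarith
  obtain us :: "'n list" where us: "set us = UNIV" using finite_list[of "UNIV :: 'n set"] by auto
  \<comment> \<open>Each direction occurs at least \<open>k\<close> times in the concatenation,
    which is enough for any list of length at most \<open>k\<close>.\<close>
  have sub: "mset is \<subseteq># mset (concat (replicate k us))" if "length is \<le> k" for "is"
  proof (rule mset_subset_eqI)
    fix a
    have "count (mset is) a \<le> k" using count_le_size[of "mset is" a] that by simp
    also have "k \<le> count (mset (concat (replicate k us))) a"
    proof (induction k)
      case (Suc k)
      have "count (mset us) a \<ge> 1" using us by (simp add: Suc_le_eq)
      from add_mono[OF this Suc] show ?case by simp
    qed simp
    finally show "count (mset is) a \<le> count (mset (concat (replicate k us))) a" .
  qed
  have "\<exists>p. real_polynomial_function p \<and> (\<forall>is. mset is \<subseteq># mset (concat (replicate k us)) \<longrightarrow>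
      (\<forall>x. (\<forall>i. \<bar>x $ i\<bar> \<le> B + 1) \<longrightarrow> \<bar>pds is \<theta> x - pds is p x\<bar> \<le> \<epsilon>))"
    by (rule polynomial_approx_derivatives_aux) (use assms comp B(1) in auto)
  then obtain p where "real_polynomial_function p"
    "\<And>is x. mset is \<subseteq># mset (concat (replicate k us)) \<Longrightarrow> (\<And>i. \<bar>x $ i\<bar> \<le> B + 1) \<Longrightarrow> \<bar>pds is \<theta> x - pds is p x\<bar> \<le> \<epsilon>"
    by blast
  then show ?thesis
    using sub less_imp_le[OF comp] by (intro that[of p]) auto
qed

section \<open>Functions with derivatives controlled by a regular weight sequence\<close>

locale regular_seq =
  fixes M :: "nat \<Rightarrow> real"
  assumes regular: "regular_weight M"
begin

lemma M_pos: "M j > 0"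
  using regular by (simp add: regular_weight_def weight_sequence_def)

lemma M_nonneg [simp]: "M j \<ge> 0"
  using M_pos less_imp_le by blast

lemma M_0: "M 0 = 1"
  using regular by (simp add: regular_weight_def weight_sequence_def)

lemma M_log_convex: "j \<ge> 1 \<Longrightarrow> (M j)\<^sup>2 \<le> M (j - 1) * M (j + 1)"
  using regular by (simp add: regular_weight_def weight_sequence_def)

lemma small_m_pos: "small_m M k > 0"
  by (simp add: small_m_def M_pos)

text \<open>By log-convexity the ratios of consecutive terms increase, so shifting by
  \<open>j\<close> can only enlarge each of the \<open>k\<close> ratios whose product is
  \<open>small_m M k\<close>.\<close>

lemma small_m_supermult: "small_m M j * small_m M k \<le> small_m M (j + k)"
proof (induction k)
  case 0
  then show ?case using regular by (simp add: regular_weight_def)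
next
  case (Suc k)
  let ?m = "small_m M"
  have "?m (Suc k) / ?m k \<le> ?m (Suc (j + k)) / ?m (j + k)"
    using regular by (intro log_convex_ratio_mono small_m_pos) (auto simp: regular_weight_def)
  then have "?m j * ?m k * (?m (Suc k) / ?m k) \<le> ?m (j + k) * (?m (Suc (j + k)) / ?m (j + k))"
    using Suc small_m_pos[THEN less_imp_le] by (intro mult_mono) auto
  then show ?case using small_m_pos[of k] small_m_pos[of "j + k"] by simp
qed

text \<open>Since \<open>M k = fact k * small_m M k\<close>, the factorials turn the binomial
  coefficient into at most \<open>fact (n + d)\<close>, and supermultiplicativity of
  \<open>small_m M\<close> does the rest. So Leibniz' rule costs no constant here; \<open>d\<close>
  counts derivatives already spent on the second factor.\<close>

lemma M_choose:
  assumes "k \<le> n"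
  shows "real (n choose k) * (M k * M (n + d - k)) \<le> M (n + d)"
proof -
  have "real (n choose k) * (M k * M (n + d - k))
      = real (n choose k) * fact k * fact (n + d - k) * (small_m M k * small_m M (n + d - k))"
    by (simp add: small_m_def)
  also have "\<dots> \<le> real ((n + d) choose k) * fact k * fact (n + d - k) * small_m M (k + (n + d - k))"
    using small_m_pos[THEN less_imp_le]
    by (intro mult_mono small_m_supermult mult_right_mono) (auto intro: binomial_right_mono)
  also have "real ((n + d) choose k) * fact k * fact (n + d - k) = fact (n + d)"
    using assms by (simp add: binomial_fact)
  finally show ?thesis using assms by (simp add: small_m_def)
qed

lemma M_mono: "j \<le> k \<Longrightarrow> M j \<le> M k"
proof (rule incseqD[OF incseq_SucI])
  fix k
  have "M (Suc 0) / M 0 \<le> M (Suc k) / M k"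
    by (intro log_convex_ratio_mono M_pos M_log_convex) auto
  moreover have "M (Suc 0) = 1" using regular by (simp add: regular_weight_def small_m_def)
  ultimately show "M k \<le> M (Suc k)" using M_pos[of k] by (simp add: M_0 field_simps)
qed

lemma M_ge_1: "M k \<ge> 1"
  using M_mono[of 0 k] M_0 by simp

text \<open>\<open>d\<close> records derivatives already taken: \<open>f\<close> is treated like a
  \<open>d\<close>-th derivative of a function in the class. The three parameters are kept apart
  because iterated operators may change \<open>A\<close> and \<open>d\<close> but not
  \<open>h\<close>.\<close>

definition weighted :: "(real^'n::finite) set \<Rightarrow> real \<Rightarrow> real \<Rightarrow> nat \<Rightarrow> (real^'n \<Rightarrow> complex) \<Rightarrow> bool" where
  "weighted S h A d f \<longleftrightarrow> smooth_on S f \<and>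
     (\<forall>is. \<forall>x\<in>S. norm (pds is f x) \<le> A * h ^ (length is + d) * M (length is + d))"

definition denjoy :: "(real^'n::finite) set \<Rightarrow> (real^'n \<Rightarrow> complex) \<Rightarrow> bool" where
  "denjoy S f \<longleftrightarrow> (\<exists>C h. C \<ge> 0 \<and> h > 0 \<and> weighted S h C 0 f)"

lemma weightedD: "weighted S h A d f \<Longrightarrow> x \<in> S \<Longrightarrow> norm (pds is f x) \<le> A * h ^ (length is + d) * M (length is + d)"
  by (simp add: weighted_def)

lemma weighted_smooth: "weighted S h A d f \<Longrightarrow> smooth_on S f"
  by (simp add: weighted_def)

lemma denjoy_smooth: "denjoy S f \<Longrightarrow> smooth_on S f"
  by (auto simp: denjoy_def weighted_def)

lemma weighted_mono:
  assumes "weighted S h A d f" "0 \<le> A" "A \<le> A'" "0 < h" "h \<le> h'" "d \<le> d'" "1 \<le> h' \<or> d' = d"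
  shows "weighted S h' A' d' f"
  unfolding weighted_def
proof (intro conjI allI ballI)
  fix "is" x assume x: "x \<in> S"
  have "norm (pds is f x) \<le> A * h ^ (length is + d) * M (length is + d)"
    by (rule weightedD[OF assms(1) x])
  also have "\<dots> \<le> A' * h' ^ (length is + d') * M (length is + d')"
  proof (intro mult_mono M_mono)
    have "h ^ (length is + d) \<le> h' ^ (length is + d)" using assms by (intro power_mono) auto
    also have "\<dots> \<le> h' ^ (length is + d')"
      using assms(6,7) by (auto intro: power_increasing)
    finally show "h ^ (length is + d) \<le> h' ^ (length is + d')" .
  qed (use assms in auto)
  finally show "norm (pds is f x) \<le> A' * h' ^ (length is + d') * M (length is + d')" .
qed (use assms weighted_smooth in blast)

lemma weighted_add:
  assumes "open S" "weighted S h A d f" "weighted S h B d g"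
  shows "weighted S h (A + B) d (\<lambda>x. f x + g x)"
  unfolding weighted_def
proof (intro conjI allI ballI smooth_on_add assms weighted_smooth[OF assms(2)] weighted_smooth[OF assms(3)])
  fix "is" x assume x: "x \<in> S"
  have "norm (pds is (\<lambda>x. f x + g x) x) \<le> norm (pds is f x) + norm (pds is g x)"
    unfolding pds_add[OF assms(1) weighted_smooth[OF assms(2)] weighted_smooth[OF assms(3)] x]
    by (rule norm_triangle_ineq)
  also have "\<dots> \<le> A * h ^ (length is + d) * M (length is + d) + B * h ^ (length is + d) * M (length is + d)"
    by (intro add_mono weightedD[OF assms(2) x] weightedD[OF assms(3) x])
  finally show "norm (pds is (\<lambda>x. f x + g x) x) \<le> (A + B) * h ^ (length is + d) * M (length is + d)"
    by (simp add: distrib_right)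
qed

text \<open>With \<open>2 * h0 \<le> h\<close> the Leibniz terms decay like
  \<open>(1 / 2) ^ k\<close>, whose sum is at most 2. The radius \<open>h\<close> is preserved, so
  the multiplication can be iterated at the cost of a factor in \<open>A\<close> alone.\<close>

lemma weighted_mult:
  fixes S :: "(real^'n::finite) set"
  assumes S: "open S" and a: "weighted S h0 C 0 a" and f: "weighted S h A d f"
    and pos: "h0 > 0" "C \<ge> 0" "A \<ge> 0" "2 * h0 \<le> h"
  shows "weighted S h (2 * C * A) d (\<lambda>x. a x * f x)"
  unfolding weighted_def
proof (intro conjI allI ballI smooth_on_mult S weighted_smooth[OF a] weighted_smooth[OF f])
  fix "is" :: "'n list" and x assume x: "x \<in> S"
  let ?n = "length is"
  have h: "h > 0" using pos by linarith
  have "norm (pds is (\<lambda>x. a x * f x) x)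
      \<le> (\<Sum>k\<le>?n. real (?n choose k) * ((C * h0 ^ k * M k) * (A * h ^ ((?n - k) + d) * M ((?n - k) + d))))"
    using weightedD[OF a x] weightedD[OF f x]
    by (intro norm_pds_mult_le[OF S weighted_smooth[OF a] weighted_smooth[OF f] x]) auto
  also have "\<dots> \<le> (\<Sum>k\<le>?n. C * A * h ^ (?n + d) * M (?n + d) * (1 / 2) ^ k)"
  proof (rule sum_mono)
    fix k assume k: "k \<in> {..?n}"
    have idx: "?n - k + d = ?n + d - k" using k by auto
    have "real (?n choose k) * ((C * h0 ^ k * M k) * (A * h ^ ((?n - k) + d) * M ((?n - k) + d)))
      = (C * A * (h0 ^ k * h ^ (?n + d - k))) * (real (?n choose k) * (M k * M (?n + d - k)))"
      unfolding idx by (simp add: mult_ac)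
    also have "\<dots> \<le> (C * A * ((h / 2) ^ k * h ^ (?n + d - k))) * M (?n + d)"
      using k pos h
      by (intro mult_mono M_choose mult_left_mono mult_right_mono power_mono mult_nonneg_nonneg) auto
    also have "(h / 2) ^ k * h ^ (?n + d - k) = h ^ (?n + d) * (1 / 2) ^ k"
      using k by (simp add: power_divide power_add[symmetric])
    finally show "real (?n choose k) * ((C * h0 ^ k * M k) * (A * h ^ ((?n - k) + d) * M ((?n - k) + d)))
        \<le> C * A * h ^ (?n + d) * M (?n + d) * (1 / 2) ^ k"
      by (simp add: mult_ac)
  qed
  also have "\<dots> = C * A * h ^ (?n + d) * M (?n + d) * (\<Sum>k\<le>?n. (1 / 2) ^ k)"
    by (simp add: sum_distrib_left)
  also have "\<dots> \<le> C * A * h ^ (?n + d) * M (?n + d) * 2"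
  proof (intro mult_left_mono)
    have "(\<Sum>k\<le>?n. (1 / 2) ^ k) \<le> (\<Sum>k. (1 / 2 :: real) ^ k)"
      by (intro sum_le_suminf summable_geometric) auto
    then show "(\<Sum>k\<le>?n. (1 / 2 :: real) ^ k) \<le> 2" by (simp add: suminf_geometric)
  qed (use pos h in auto)
  finally show "norm (pds is (\<lambda>x. a x * f x) x) \<le> 2 * C * A * h ^ (?n + d) * M (?n + d)"
    by (simp add: mult_ac)
qed

lemma weighted_pd: "weighted S h A d f \<Longrightarrow> weighted S h A (Suc d) (pd i f)"
  unfolding weighted_def pds_snoc[symmetric]
proof (elim conjE, intro conjI allI ballI)
  fix "is" x
  assume "\<forall>is. \<forall>x\<in>S. norm (pds is f x) \<le> A * h ^ (length is + d) * M (length is + d)" "x \<in> S"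
  then have "norm (pds (is @ [i]) f x) \<le> A * h ^ (length (is @ [i]) + d) * M (length (is @ [i]) + d)" by blast
  then show "norm (pds (is @ [i]) f x) \<le> A * h ^ (length is + Suc d) * M (length is + Suc d)" by simp
qed (rule smooth_on_pd)

lemma weighted_const: "norm c \<le> C \<Longrightarrow> 0 < h \<Longrightarrow> weighted S h C 0 (\<lambda>x. c)"
  unfolding weighted_def
  by (auto simp: smooth_on_const pds_const M_0 intro!: mult_nonneg_nonneg intro: order_trans[OF norm_ge_zero])

lemma denjoy_const: "denjoy S (\<lambda>x. c)"
  unfolding denjoy_def by (intro exI[of _ "norm c"] exI[of _ 1]) (auto intro: weighted_const)

lemma denjoy_add:
  assumes "open S" "denjoy S f" "denjoy S g"
  shows "denjoy S (\<lambda>x. f x + g x)"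
proof -
  obtain A h B h' where *: "A \<ge> 0" "h > 0" "weighted S h A 0 f" "B \<ge> 0" "h' > 0" "weighted S h' B 0 g"
    using assms unfolding denjoy_def by blast
  have "weighted S (max h h') A 0 f" "weighted S (max h h') B 0 g"
    using * by (auto intro: weighted_mono[of S h A 0 f] weighted_mono[of S h' B 0 g])
  from weighted_add[OF assms(1) this] show ?thesis
    unfolding denjoy_def using * by (intro exI[of _ "A + B"] exI[of _ "max h h'"]) auto
qed

lemma denjoy_mult:
  assumes "open S" "denjoy S f" "denjoy S g"
  shows "denjoy S (\<lambda>x. f x * g x)"
proof -
  obtain A h B h' where *: "A \<ge> 0" "h > 0" "weighted S h A 0 f" "B \<ge> 0" "h' > 0" "weighted S h' B 0 g"
    using assms unfolding denjoy_def by blast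
  have "weighted S (max (2 * h) h') B 0 g"
    using * by (auto intro: weighted_mono[of S h' B 0 g])
  from weighted_mult[OF assms(1) *(3) this] show ?thesis
    unfolding denjoy_def using * by (intro exI[of _ "2 * A * B"] exI[of _ "max (2 * h) h'"]) auto
qed

lemma denjoy_sum:
  "open S \<Longrightarrow> (\<And>a. a \<in> A \<Longrightarrow> denjoy S (f a)) \<Longrightarrow> denjoy S (\<lambda>x. \<Sum>a\<in>A. f a x)"
  by (induction A rule: infinite_finite_induct) (auto intro: denjoy_const denjoy_add)

lemma denjoy_prod:
  "open S \<Longrightarrow> (\<And>a. a \<in> A \<Longrightarrow> denjoy S (f a)) \<Longrightarrow> denjoy S (\<lambda>x. \<Prod>a\<in>A. f a x)"
  by (induction A rule: infinite_finite_induct) (auto intro: denjoy_const denjoy_mult)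

lemma denjoy_power: "open S \<Longrightarrow> denjoy S f \<Longrightarrow> denjoy S (\<lambda>x. f x ^ k)"
  by (induction k) (auto intro: denjoy_const denjoy_mult)

lemma denjoy_component:
  fixes S :: "(real^'n::finite) set"
  assumes "bounded S" "open S"
  shows "denjoy S (\<lambda>x. complex_of_real (x $ j))"
proof -
  obtain B where B: "B > 0" "\<And>x. x \<in> S \<Longrightarrow> norm x \<le> B"
    using assms(1) bounded_pos[of S] by auto
  have pd: "pd i (\<lambda>x::real^'n. x $ j) = (\<lambda>x. if i = j then 1 else 0)" for i
    by (rule ext, rule has_pd_imp_pd, rule has_pd_component)
  have "weighted S 1 (max B 1) 0 (\<lambda>x. complex_of_real (x $ j))"
    unfolding weighted_def
  proof (intro conjI allI ballI smooth_on_of_real assms smooth_on_component)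
    fix "is" x assume x: "x \<in> S"
    have "norm (pds is (\<lambda>x. complex_of_real (x $ j)) x) = \<bar>pds is (\<lambda>x. x $ j) x\<bar>"
    proof -
      have "pds is (\<lambda>x. complex_of_real (x $ j)) x = complex_of_real (pds is (\<lambda>x. x $ j) x)"
        by (rule pds_linear[OF bounded_linear_of_real assms(2) smooth_on_component x])
      then show ?thesis by simp
    qed
    also have "\<dots> \<le> max B 1"
    proof (cases "is" rule: rev_cases)
      case Nil
      then show ?thesis using B(2)[OF x] component_le_norm_cart[of x j] by simp
    next
      case (snoc js i)
      then show ?thesis using B(1) by (simp add: pds_snoc pd pds_const le_max_iff_disj)
    qed
    also have "\<dots> \<le> max B 1 * M (length is)"
      using M_ge_1[of "length is"] B(1) by (simp add: mult_le_cancel_left1)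
    finally show "norm (pds is (\<lambda>x. complex_of_real (x $ j)) x) \<le> max B 1 * 1 ^ (length is + 0) * M (length is + 0)"
      by simp
  qed
  then show ?thesis unfolding denjoy_def using B(1) by (intro exI[of _ "max B 1"] exI[of _ 1]) auto
qed

lemma denjoy_polynomial:
  fixes p :: "real^'n::finite \<Rightarrow> real"
  assumes "real_polynomial_function p" "bounded S" "open S"
  shows "denjoy S (\<lambda>x. complex_of_real (p x))"
  using assms(1)
proof induction
  case (linear f)
  have eq: "(\<lambda>x. complex_of_real (f x)) = (\<lambda>x. \<Sum>j\<in>UNIV. complex_of_real (x $ j) * complex_of_real (f (axis j 1)))"
    by (rule ext, subst linear_eq_sum_axis[OF linear]) simp
  have "denjoy S (\<lambda>x. \<Sum>j\<in>UNIV. complex_of_real (x $ j) * complex_of_real (f (axis j 1)))"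
    by (intro denjoy_sum denjoy_mult denjoy_component denjoy_const assms)
  then show ?case by (subst eq)
qed (auto intro: denjoy_const denjoy_add denjoy_mult assms)

text \<open>Leibniz' rule for \<open>q x * inverse (q x) = 1\<close> is solved for the term in which
  \<open>q\<close> is not differentiated, which bounds derivatives of the inverse by those of lower
  order.\<close>

lemma denjoy_inverse:
  fixes S :: "(real^'n::finite) set"
  assumes S: "open S" and q: "denjoy S q" and c: "c > 0" "\<And>x. x \<in> S \<Longrightarrow> c \<le> norm (q x)"
  shows "denjoy S (\<lambda>x. inverse (q x))"
proof -
  obtain C h0 where *: "C \<ge> 0" "h0 > 0" "weighted S h0 C 0 q"
    using q unfolding denjoy_def by blast
  \<comment> \<open>With \<open>r = h0 / h\<close>, the induction closes if the series of
    \<open>C * r ^ k\<close> over \<open>k \<ge> 1\<close> is at most \<open>c\<close>, that is, if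
    \<open>C * r \<le> c * (1 - r)\<close>; this \<open>h\<close> achieves it.\<close>
  define h where "h = h0 * (2 + C / c)"
  define r where "r = h0 / h"
  have "2 * h0 \<le> h" using * c by (auto simp: h_def algebra_simps)
  then have h: "h > 0" "0 < r" "r < 1" using * by (auto simp: r_def)
  have hr: "h0 = r * h" using h(1) by (simp add: r_def)
  have Cr: "C * r \<le> c * (1 - r)"
  proof -
    have "C * h0 \<le> c * (h - h0)" using * c by (simp add: h_def field_simps)
    then have "(C * r) * h \<le> (c * (1 - r)) * h" unfolding hr by (simp add: algebra_simps)
    then show ?thesis using h(1) by simp
  qed
  define R where "R = 1 / c"
  have R: "R > 0" using c by (simp add: R_def)
  have nz: "q x \<noteq> 0" if "x \<in> S" for x using c that by force
  have smooth: "smooth_on S (\<lambda>x. inverse (q x))" "smooth_on S q"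
    using weighted_smooth[OF *(3)] nz by (auto intro: smooth_on_inverse S)
  have bound: "norm (pds is (\<lambda>x. inverse (q x)) x) \<le> R * h ^ length is * M (length is)" if x: "x \<in> S" for "is" x
  proof (induction "length is" arbitrary: "is" rule: less_induct)
    case less
    let ?n = "length is"
    let ?r = "\<lambda>x. inverse (q x)"
    have qx: "norm (q x) \<ge> c" "norm (q x) > 0" using c x by force+
    show ?case
    proof (cases "is = []")
      case True
      then show ?thesis
        using qx(1) c(1) by (simp add: R_def M_0 norm_divide inverse_eq_divide frac_le)
    next
      case False
      have "pds is (\<lambda>x. q x * ?r x) x = pds is (\<lambda>x. 1) x"
        by (rule pds_cong[OF S x]) (simp add: nz)
      then have zero: "(\<Sum>p\<leftarrow>splits is. pds (fst p) q x * pds (snd p) ?r x) = 0"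
        using False pds_mult[OF S smooth(2,1) x, of "is"] by (simp add: pds_const case_prod_unfold)
      \<comment> \<open>Exactly one splitting has an empty first part.\<close>
      have split: "(\<Sum>p\<leftarrow>splits js. F p) = F ([], js) + (\<Sum>p\<leftarrow>splits js. if fst p = [] then 0 else F p)"
        for F :: "'n list \<times> 'n list \<Rightarrow> complex" and js
      proof (induction js arbitrary: F)
        case (Cons j js)
        show ?case
          using Cons.IH[of "\<lambda>p. F (fst p, j # snd p)"]
          by (simp add: o_def case_prod_unfold if_distrib cong: if_cong)
      qed simp
      let ?F = "\<lambda>p. pds (fst p) q x * pds (snd p) ?r x"
      have "?F ([], is) + (\<Sum>p\<leftarrow>splits is. if fst p = [] then 0 else ?F p) = 0"
        using split[of ?F "is"] zero by argo
      then have eq: "q x * pds is ?r x = - (\<Sum>p\<leftarrow>splits is. if fst p = [] then 0 else pds (fst p) q x * pds (snd p) ?r x)"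
        unfolding eq_neg_iff_add_eq_0 by simp
      have "norm (q x) * norm (pds is ?r x)
          = norm (\<Sum>p\<leftarrow>splits is. if fst p = [] then 0 else pds (fst p) q x * pds (snd p) ?r x)"
        unfolding norm_mult[symmetric] eq by (rule norm_minus_cancel)
      also have "\<dots> \<le> (\<Sum>p\<leftarrow>splits is. (\<lambda>k l. if k = 0 then 0 else (C * h0 ^ k * M k) * (R * h ^ l * M l)) (length (fst p)) (length (snd p)))"
      proof (rule sum_list_norm_mono)
        fix p assume p: "p \<in> set (splits is)"
        then have len: "length (fst p) + length (snd p) = ?n"
          using splits_length by (metis prod.collapse)
        have "norm (pds (fst p) q x * pds (snd p) ?r x) \<le> (C * h0 ^ length (fst p) * M (length (fst p))) * (R * h ^ length (snd p) * M (length (snd p)))"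
          if "fst p \<noteq> []"
        proof -
          have "length (snd p) < ?n" using that len by (cases "fst p") auto
          then show ?thesis
            unfolding norm_mult using weightedD[OF *(3) x, of "fst p"] less[of "snd p"] * h R
            by (intro mult_mono) auto
        qed
        then show "norm (if fst p = [] then 0 else pds (fst p) q x * pds (snd p) ?r x)
          \<le> (\<lambda>k l. if k = 0 then 0 else (C * h0 ^ k * M k) * (R * h ^ l * M l)) (length (fst p)) (length (snd p))"
          by auto
      qed
      also have "\<dots> = (\<Sum>k\<le>?n. real (?n choose k) * (if k = 0 then 0 else (C * h0 ^ k * M k) * (R * h ^ (?n - k) * M (?n - k))))"
        using sum_list_splits_choose[of "\<lambda>k l. if k = 0 then 0 else (C * h0 ^ k * M k) * (R * h ^ l * M l)" "is"]
        by (simp add: case_prod_unfold)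
      also have "\<dots> \<le> (\<Sum>k\<le>?n. if k = 0 then 0 else C * R * h ^ ?n * M ?n * (h0 / h) ^ k)"
      proof (rule sum_mono)
        fix k assume k: "k \<in> {..?n}"
        have "real (?n choose k) * ((C * h0 ^ k * M k) * (R * h ^ (?n - k) * M (?n - k)))
          = (C * R * (h0 ^ k * h ^ (?n - k))) * (real (?n choose k) * (M k * M (?n + 0 - k)))"
          by (simp add: mult_ac)
        also have "\<dots> \<le> (C * R * (h0 ^ k * h ^ (?n - k))) * M (?n + 0)"
          using k * h R by (intro mult_left_mono M_choose) auto
        also have "h0 ^ k * h ^ (?n - k) = h ^ ?n * (h0 / h) ^ k"
          using k h by (simp add: power_divide power_diff)
        finally show "real (?n choose k) * (if k = 0 then 0 else (C * h0 ^ k * M k) * (R * h ^ (?n - k) * M (?n - k)))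
          \<le> (if k = 0 then 0 else C * R * h ^ ?n * M ?n * (h0 / h) ^ k)"
          by (simp add: mult_ac)
      qed
      also have "\<dots> = C * R * h ^ ?n * M ?n * (\<Sum>k<?n. (h0 / h) ^ Suc k)"
        by (simp add: sum.atMost_shift sum_distrib_left)
      also have "\<dots> = (C * r) * (\<Sum>k<?n. r ^ k) * (R * h ^ ?n * M ?n)"
        by (simp add: r_def[symmetric] sum_distrib_left[symmetric] mult_ac)
      also have "\<dots> \<le> c * (R * h ^ ?n * M ?n)"
      proof (rule mult_right_mono)
        have "(C * r) * (\<Sum>k<?n. r ^ k) \<le> (c * (1 - r)) * (\<Sum>k<?n. r ^ k)"
          using h by (intro mult_right_mono Cr sum_nonneg) auto
        also have "\<dots> = c * (1 - r ^ ?n)" by (simp add: one_diff_power_eq)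
        also have "\<dots> \<le> c" using c(1) h by (simp add: mult_le_cancel_left1)
        finally show "(C * r) * (\<Sum>k<?n. r ^ k) \<le> c" .
      qed (use R h in auto)
      finally have "norm (q x) * norm (pds is ?r x) \<le> c * (R * h ^ ?n * M ?n)" .
      moreover have "c * norm (pds is ?r x) \<le> norm (q x) * norm (pds is ?r x)"
        using qx by (intro mult_right_mono) auto
      ultimately have "c * norm (pds is ?r x) \<le> c * (R * h ^ ?n * M ?n)" by linarith
      then show ?thesis using c(1) by simp
    qed
  qed
  have "weighted S h R 0 (\<lambda>x. inverse (q x))"
    unfolding weighted_def using bound smooth by simp
  then show ?thesis unfolding denjoy_def using R h by (intro exI[of _ R] exI[of _ h]) auto
qed


lemma denjoy_E_M:
  fixes S :: "(real^'n::finite) set"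
  assumes "E_M M \<Omega> f" "compact K" "K \<subseteq> \<Omega>" "open \<Omega>" "S \<subseteq> K"
  shows "denjoy S f"
proof -
  have sm: "smooth_on \<Omega> f" using assms(1) by (simp add: E_M_def)
  have "\<exists>C h. C > 0 \<and> h > 0 \<and> (\<forall>\<alpha>. \<forall>x\<in>K. norm (Dop \<alpha> f x) \<le> C * h ^ mlen \<alpha> * M (mlen \<alpha>))"
    using assms(1-3) by (simp add: E_M_def)
  then obtain C h where Ch: "C > 0" "h > 0" "\<And>\<alpha> x. x \<in> K \<Longrightarrow> norm (Dop \<alpha> f x) \<le> C * h ^ mlen \<alpha> * M (mlen \<alpha>)"
    by blast
  have "norm (pds is f x) \<le> C * h ^ length is * M (length is)" if "x \<in> S" for "is" x
  proof -
    have "x \<in> K" "x \<in> \<Omega>" using that assms by auto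
    then show ?thesis
      using Ch(3)[of x "count_list is"] pds_eq_dpart[OF assms(4) sm, of x "is"]
      by (simp add: Dop_def norm_mult norm_power mlen_count_list)
  qed
  then have "weighted S h C 0 f"
    unfolding weighted_def using smooth_on_subset[OF sm] assms by auto
  then show ?thesis unfolding denjoy_def using Ch by (intro exI[of _ C] exI[of _ h]) auto
qed

subsection \<open>Operators of finite order\<close>

text \<open>Uniform in \<open>A\<close> and \<open>d\<close>, so that the operator can be applied
  repeatedly with one \<open>h\<close>. In \<open>op_order\<close> the constant is chosen before
  \<open>h\<close>; thus finitely many operators can share a single large \<open>h\<close> without
  changing their constants.\<close>

definition op_bound :: "(real^'n::finite) set \<Rightarrow> real \<Rightarrow> real \<Rightarrow> nat \<Rightarrow> ((real^'n \<Rightarrow> complex) \<Rightarrow> real^'n \<Rightarrow> complex) \<Rightarrow> bool" where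
  "op_bound S h c i T \<longleftrightarrow> (\<forall>A d f. A \<ge> 0 \<longrightarrow> weighted S h A d f \<longrightarrow> weighted S h (c * A) (d + i) (T f))"

definition op_order :: "(real^'n::finite) set \<Rightarrow> nat \<Rightarrow> ((real^'n \<Rightarrow> complex) \<Rightarrow> real^'n \<Rightarrow> complex) \<Rightarrow> bool" where
  "op_order S i T \<longleftrightarrow> (\<exists>c\<ge>0. \<forall>\<^sub>F h in at_top. op_bound S h c i T)"

lemma op_order_pd: "op_order S 1 (pd i)"
  unfolding op_order_def op_bound_def
  by (intro exI[of _ 1] conjI always_eventually) (auto intro: weighted_pd)

lemma op_order_id: "op_order S 0 (\<lambda>f. f)"
  unfolding op_order_def op_bound_def by (intro exI[of _ 1]) auto

lemma op_order_zero: "op_order S i (\<lambda>f x. 0)"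
proof -
  have "weighted S h 0 d (\<lambda>x. 0)" for h d
    by (auto simp: weighted_def smooth_on_const pds_const)
  then show ?thesis unfolding op_order_def op_bound_def by (intro exI[of _ 0]) auto
qed

lemma op_order_mult:
  assumes "open S" "denjoy S a"
  shows "op_order S 0 (\<lambda>f x. a x * f x)"
proof -
  obtain C h0 where *: "C \<ge> 0" "h0 > 0" "weighted S h0 C 0 a"
    using assms(2) unfolding denjoy_def by blast
  have "\<forall>\<^sub>F h in at_top. op_bound S h (2 * C) 0 (\<lambda>f x. a x * f x)"
    using eventually_ge_at_top[of "2 * h0"]
    by eventually_elim (use weighted_mult[OF assms(1) *(3)] * in \<open>auto simp: op_bound_def\<close>)
  then show ?thesis unfolding op_order_def using * by (intro exI[of _ "2 * C"]) auto
qed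

lemma op_order_compose:
  assumes "op_order S i T" "op_order S j T'"
  shows "op_order S (j + i) (\<lambda>f. T (T' f))"
proof -
  obtain c where c: "c \<ge> 0" "\<forall>\<^sub>F h in at_top. op_bound S h c i T"
    using assms(1) unfolding op_order_def by blast
  obtain c' where c': "c' \<ge> 0" "\<forall>\<^sub>F h in at_top. op_bound S h c' j T'"
    using assms(2) unfolding op_order_def by blast
  have "\<forall>\<^sub>F h in at_top. op_bound S h (c * c') (j + i) (\<lambda>f. T (T' f))"
    using c(2) c'(2)
  proof eventually_elim
    case (elim h)
    then show ?case using c'(1) unfolding op_bound_def by (metis (no_types, opaque_lifting) add.assoc mult.assoc mult_nonneg_nonneg)
  qed
  then show ?thesis unfolding op_order_def using c c' by (intro exI[of _ "c * c'"]) auto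
qed

lemma op_order_add:
  assumes "open S" "op_order S i T" "op_order S i T'"
  shows "op_order S i (\<lambda>f x. T f x + T' f x)"
proof -
  obtain c where c: "c \<ge> 0" "\<forall>\<^sub>F h in at_top. op_bound S h c i T"
    using assms(2) unfolding op_order_def by blast
  obtain c' where c': "c' \<ge> 0" "\<forall>\<^sub>F h in at_top. op_bound S h c' i T'"
    using assms(3) unfolding op_order_def by blast
  have "\<forall>\<^sub>F h in at_top. op_bound S h (c + c') i (\<lambda>f x. T f x + T' f x)"
    using c(2) c'(2)
  proof eventually_elim
    case (elim h)
    then show ?case using weighted_add[OF assms(1)] by (simp add: op_bound_def distrib_right)
  qed
  then show ?thesis unfolding op_order_def using c c' by (intro exI[of _ "c + c'"]) auto
qed

lemma op_order_mono:
  assumes "op_order S i T" "i \<le> j"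
  shows "op_order S j T"
proof -
  obtain c where c: "c \<ge> 0" "\<forall>\<^sub>F h in at_top. op_bound S h c i T"
    using assms(1) unfolding op_order_def by blast
  have "\<forall>\<^sub>F h in at_top. op_bound S h c j T"
    using c(2) eventually_ge_at_top[of 1]
  proof eventually_elim
    case (elim h)
    show ?case unfolding op_bound_def
    proof (intro allI impI)
      fix A :: real and d f assume "0 \<le> A" "weighted S h A d f"
      then have "weighted S h (c * A) (d + i) (T f)" using elim(1) by (simp add: op_bound_def)
      then show "weighted S h (c * A) (d + j) (T f)"
        by (rule weighted_mono) (use elim(2) c(1) assms(2) \<open>0 \<le> A\<close> in auto)
    qed
  qed
  then show ?thesis unfolding op_order_def using c by blast
qed

lemma op_order_sum:
  "open S \<Longrightarrow> (\<And>a. a \<in> A \<Longrightarrow> op_order S i (T a)) \<Longrightarrow> op_order S i (\<lambda>f x. \<Sum>a\<in>A. T a f x)"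
  by (induction A rule: infinite_finite_induct) (auto intro: op_order_zero op_order_add)

end

section \<open>Differentiating a composite factor\<close>

text \<open>\<open>chain_op \<rho>' is j\<close> collects the terms that carry the \<open>j\<close>-th derivative of \<open>\<sigma>\<close> in the partial
  derivative \<open>is\<close> of \<open>(\<sigma> \<circ> \<rho>) f\<close>, where \<open>\<rho>' i\<close> is the \<open>i\<close>-th partial derivative of \<open>\<rho>\<close>.\<close>

fun chain_op :: "('n::finite \<Rightarrow> real^'n \<Rightarrow> complex) \<Rightarrow> 'n list \<Rightarrow> nat \<Rightarrow> (real^'n \<Rightarrow> complex) \<Rightarrow> real^'n \<Rightarrow> complex" where
  "chain_op \<rho>' [] 0 f = f"
| "chain_op \<rho>' [] (Suc j) f = (\<lambda>x. 0)"
| "chain_op \<rho>' (i # is) 0 f = pd i (chain_op \<rho>' is 0 f)"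
| "chain_op \<rho>' (i # is) (Suc j) f = (\<lambda>x. pd i (chain_op \<rho>' is (Suc j) f) x + \<rho>' i x * chain_op \<rho>' is j f x)"

lemma chain_op_zero: "j > length is \<Longrightarrow> chain_op \<rho>' is j f = (\<lambda>x. 0)"
proof (induction "is" arbitrary: j)
  case Nil
  then show ?case by (cases j) auto
next
  case (Cons i "is")
  then show ?case by (cases j) (auto simp: pd_const)
qed

text \<open>Here every derivative has fallen on \<open>\<sigma>\<close>; these products are the
  monomials of the principal symbol.\<close>

lemma chain_op_top: "chain_op \<rho>' is (length is) f x = (\<Prod>i\<leftarrow>is. \<rho>' i x) * f x"
  by (induction "is") (auto simp: chain_op_zero pd_const)

lemma smooth_on_chain_op:
  assumes "open S" "\<And>i. smooth_on S (\<rho>' i)" "smooth_on S f"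
  shows "smooth_on S (chain_op \<rho>' is j f)"
proof (induction "is" arbitrary: j)
  case Nil
  then show ?case using assms by (cases j) (auto simp: smooth_on_const)
next
  case (Cons i "is")
  then show ?case using assms by (cases j) (auto intro!: smooth_on_pd smooth_on_add smooth_on_mult)
qed

lemma chain_op_cong:
  assumes "open S" "x \<in> S" "\<And>y. y \<in> S \<Longrightarrow> f y = g y"
  shows "chain_op \<rho>' is j f x = chain_op \<rho>' is j g x"
  using assms(2)
proof (induction "is" arbitrary: j x)
  case Nil
  then show ?case using assms by (cases j) auto
next
  case (Cons i "is")
  have "pd i (chain_op \<rho>' is j f) x = pd i (chain_op \<rho>' is j g) x" for j
    by (rule pd_cong[OF assms(1) Cons.prems Cons.IH])
  then show ?case using Cons by (cases j) auto
qed

lemma pds_compose_mult: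
  fixes \<rho> :: "real^'n::finite \<Rightarrow> real" and \<sigma> :: "nat \<Rightarrow> real \<Rightarrow> complex"
  assumes S: "open S" and \<sigma>: "\<And>n t. (\<sigma> n has_vector_derivative \<sigma> (Suc n) t) (at t)"
    and \<rho>: "smooth_on S \<rho>" "\<And>i x. x \<in> S \<Longrightarrow> \<rho>' i x = complex_of_real (pd i \<rho> x)" "\<And>i. smooth_on S (\<rho>' i)"
    and f: "smooth_on S f" and x: "x \<in> S"
  shows "pds is (\<lambda>x. \<sigma> n (\<rho> x) * f x) x = (\<Sum>j\<le>length is. \<sigma> (n + j) (\<rho> x) * chain_op \<rho>' is j f x)"
  using x
proof (induction "is" arbitrary: x)
  case (Cons i "is")
  let ?l = "length is"
  let ?T = "\<lambda>j. chain_op \<rho>' is j f"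
  have hp: "has_pd i (\<lambda>x. \<sigma> (n + j) (\<rho> x) * ?T j x)
     (\<sigma> (n + j) (\<rho> x) * pd i (?T j) x + (\<rho>' i x * \<sigma> (Suc (n + j)) (\<rho> x)) * ?T j x) x" for j
    using has_pd_compose[OF \<sigma> smooth_on_has_pd[OF \<rho>(1) Cons.prems]]
    by (intro has_pd_mult smooth_on_has_pd[OF smooth_on_chain_op[OF S \<rho>(3) f] Cons.prems])
       (simp add: \<rho>(2)[OF Cons.prems] scaleR_conv_of_real)
  have "pds (i # is) (\<lambda>x. \<sigma> n (\<rho> x) * f x) x = pd i (\<lambda>x. \<Sum>j\<le>?l. \<sigma> (n + j) (\<rho> x) * ?T j x) x"
    by (simp, intro pd_cong[OF S Cons.prems] Cons.IH)
  also have "\<dots> = (\<Sum>j\<le>?l. \<sigma> (n + j) (\<rho> x) * pd i (?T j) x + (\<rho>' i x * \<sigma> (Suc (n + j)) (\<rho> x)) * ?T j x)"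
    using hp unfolding has_pd_def by (intro has_pd_imp_pd[unfolded has_pd_def] has_vector_derivative_sum)
  also have "\<dots> = (\<Sum>j\<le>?l. \<sigma> (n + j) (\<rho> x) * pd i (?T j) x) + (\<Sum>j\<le>?l. \<sigma> (n + Suc j) (\<rho> x) * (\<rho>' i x * ?T j x))"
    by (simp add: sum.distrib mult_ac)
  also have "(\<Sum>j\<le>?l. \<sigma> (n + j) (\<rho> x) * pd i (?T j) x) = (\<Sum>j\<le>Suc ?l. \<sigma> (n + j) (\<rho> x) * pd i (?T j) x)"
    by (simp add: chain_op_zero pd_const)
  also have "\<dots> = \<sigma> (n + 0) (\<rho> x) * pd i (?T 0) x + (\<Sum>j\<le>?l. \<sigma> (n + Suc j) (\<rho> x) * pd i (?T (Suc j)) x)"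
    by (rule sum.atMost_Suc_shift)
  also have "\<dots> + (\<Sum>j\<le>?l. \<sigma> (n + Suc j) (\<rho> x) * (\<rho>' i x * ?T j x))
     = \<sigma> (n + 0) (\<rho> x) * chain_op \<rho>' (i # is) 0 f x + (\<Sum>j\<le>?l. \<sigma> (n + Suc j) (\<rho> x) * chain_op \<rho>' (i # is) (Suc j) f x)"
    by (simp add: sum.distrib distrib_left)
  also have "\<dots> = (\<Sum>j\<le>Suc ?l. \<sigma> (n + j) (\<rho> x) * chain_op \<rho>' (i # is) j f x)"
    by (rule sum.atMost_Suc_shift[symmetric])
  finally show ?case by simp
qed simp

text \<open>Each of the \<open>length is\<close> derivatives either falls on
  \<open>\<sigma>\<close>, raising \<open>j\<close>, or remains an operator of order 1.\<close>

lemma (in regular_seq) op_order_chain_op: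
  assumes "open S" "\<And>i. denjoy S (\<rho>' i)" "j \<le> length is"
  shows "op_order S (length is - j) (chain_op \<rho>' is j)"
  using assms(3)
proof (induction "is" arbitrary: j)
  case Nil
  show ?case
  proof -
    have "chain_op \<rho>' [] 0 = (\<lambda>f. f)" by (rule ext) simp
    then show ?thesis using Nil op_order_id[of S] by simp
  qed
next
  case (Cons i "is")
  have pd: "op_order S (Suc (length is) - j) (\<lambda>f. pd i (chain_op \<rho>' is j f))" if "j \<le> length is" for j
    using op_order_compose[OF op_order_pd Cons.IH[OF that], of i] that by (simp add: Suc_diff_le)
  show ?case
  proof (cases j)
    case 0
    have "chain_op \<rho>' (i # is) 0 = (\<lambda>f. pd i (chain_op \<rho>' is 0 f))" by (rule ext) simp
    then show ?thesis using pd[of 0] 0 by simp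
  next
    case (Suc l)
    have 1: "op_order S (length is - l) (\<lambda>f. pd i (chain_op \<rho>' is (Suc l) f))"
    proof (cases "Suc l \<le> length is")
      case True
      then show ?thesis using pd[of "Suc l"] by simp
    next
      case False
      then show ?thesis using op_order_zero by (simp add: chain_op_zero pd_const)
    qed
    have 2: "op_order S (length is - l) (\<lambda>f x. \<rho>' i x * chain_op \<rho>' is l f x)"
    proof -
      have "op_order S (length is - l) (chain_op \<rho>' is l)" using Cons.prems Suc by (intro Cons.IH) simp
      from op_order_compose[OF op_order_mult[OF assms(1) assms(2)[of i]] this] show ?thesis by simp
    qed
    have "chain_op \<rho>' (i # is) j = (\<lambda>f x. pd i (chain_op \<rho>' is (Suc l) f) x + \<rho>' i x * chain_op \<rho>' is l f x)"
      unfolding Suc by (rule ext)+ simp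
    moreover have "length (i # is) - j = length is - l" using Suc by simp
    ultimately show ?thesis using op_order_add[OF assms(1) 1 2] by metis
  qed
qed

section \<open>Bounds for differentiating a pairing with respect to a parameter\<close>

lemma has_vector_derivative_quadratic:
  fixes f :: "real \<Rightarrow> 'a::real_normed_vector"
  assumes "\<And>h. \<bar>h\<bar> \<le> 1 \<Longrightarrow> norm (f (x + h) - f x - h *\<^sub>R D) \<le> B * h\<^sup>2"
  shows "(f has_vector_derivative D) (at x)"
  unfolding has_vector_derivative_def has_derivative_at
proof
  have lim: "((\<lambda>h. B * \<bar>h\<bar>) \<longlongrightarrow> B * \<bar>0\<bar>) (at (0::real))"
    by (intro tendsto_intros)
  have ev: "eventually (\<lambda>h::real. \<bar>h\<bar> \<le> 1 \<and> h \<noteq> 0) (at 0)"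
    unfolding eventually_at by (intro exI[of _ 1]) auto
  show "((\<lambda>h. norm (f (x + h) - f x - h *\<^sub>R D) / norm h) \<longlongrightarrow> 0) (at 0)"
  proof (rule tendsto_sandwich[of "\<lambda>_. 0" _ _ "\<lambda>h. B * \<bar>h\<bar>"])
    show "eventually (\<lambda>h. norm (f (x + h) - f x - h *\<^sub>R D) / norm h \<le> B * \<bar>h\<bar>) (at 0)"
      using ev
    proof eventually_elim
      case (elim h)
      then show ?case using assms[of h] by (simp add: divide_le_eq power2_eq_square abs_mult mult.assoc)
    qed
  qed (use lim in auto)
qed (rule bounded_linear_scaleR_left)

lemma eta_bound: "\<exists>B\<ge>0. \<forall>n\<le>N. \<forall>t. \<bar>t\<bar> \<le> R \<longrightarrow> \<bar>eta n t\<bar> \<le> B"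
proof -
  have "\<exists>B. \<forall>t\<in>{-R..R}. norm (eta n t) \<le> B" for n
  proof -
    have "compact (eta n ` {-R..R})" by (intro compact_continuous_image continuous_on_eta) auto
    then have "bounded (eta n ` {-R..R})" by (rule compact_imp_bounded)
    then show ?thesis by (auto simp: bounded_iff)
  qed
  then obtain B where B: "\<And>n t. t \<in> {-R..R} \<Longrightarrow> norm (eta n t) \<le> B n" by metis
  have "\<bar>eta n t\<bar> \<le> (\<Sum>n\<le>N. \<bar>B n\<bar>)" if "n \<le> N" "\<bar>t\<bar> \<le> R" for n t
  proof -
    have "t \<in> {-R..R}" using that by auto
    from B[OF this, of n] have "\<bar>eta n t\<bar> \<le> \<bar>B n\<bar>" by simp
    also have "\<dots> \<le> (\<Sum>n\<le>N. \<bar>B n\<bar>)" using that by (intro member_le_sum) auto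
    finally show ?thesis .
  qed
  then show ?thesis by (intro exI[of _ "\<Sum>n\<le>N. \<bar>B n\<bar>"]) (auto intro: sum_nonneg)
qed

lemma eta_taylor:
  assumes "\<And>z. \<bar>z\<bar> \<le> R \<Longrightarrow> \<bar>eta (Suc (Suc n)) z\<bar> \<le> B" "\<bar>t\<bar> \<le> R" "\<bar>t + h\<bar> \<le> R"
  shows "\<bar>eta n (t + h) - eta n t - h * eta (Suc n) t\<bar> \<le> B * h\<^sup>2"
proof (cases "h = 0")
  case False
  have "\<exists>z. (if t + h < t then t + h < z \<and> z < t else t < z \<and> z < t + h) \<and>
     eta n (t + h) = (\<Sum>m<2. (eta (n + m) t / fact m) * (t + h - t) ^ m) + (eta (n + 2) z / fact 2) * (t + h - t) ^ 2"
    by (rule Taylor[where a="min t (t + h)" and b="max t (t + h)"])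
       (use False has_real_derivative_eta in auto)
  then obtain z where z: "if t + h < t then t + h < z \<and> z < t else t < z \<and> z < t + h"
    "eta n (t + h) = (\<Sum>m<2. (eta (n + m) t / fact m) * h ^ m) + (eta (n + 2) z / fact 2) * h ^ 2" by auto
  have "\<bar>z\<bar> \<le> R" using z(1) assms(2,3) by (auto split: if_splits)
  then have B: "\<bar>eta (Suc (Suc n)) z\<bar> \<le> B" by (rule assms(1))
  have "eta n (t + h) - eta n t - h * eta (Suc n) t = (eta (Suc (Suc n)) z / 2) * h\<^sup>2"
    using z(2) by (simp add: numeral_2_eq_2)
  also have "\<bar>\<dots>\<bar> = \<bar>eta (Suc (Suc n)) z\<bar> / 2 * h\<^sup>2" by (simp add: abs_mult)
  also have "\<dots> \<le> B * h\<^sup>2" using B by (intro mult_right_mono) auto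
  finally show ?thesis .
qed (use assms(1)[of t] assms(2) in auto)

text \<open>The constant depends on \<open>\<rho>\<close>, \<open>f\<close>, \<open>K\<close> and
  \<open>k\<close> but not on \<open>\<sigma>\<close>. This uniformity is used for shifts of
  \<open>eta\<close> by \<open>s\<close> and for Taylor remainders in \<open>s\<close>, where
  \<open>b\<close> is small.\<close>

lemma compose_mult_bound:
  fixes \<rho> :: "real^'n::finite \<Rightarrow> real"
  assumes \<rho>: "smooth_on UNIV \<rho>" and f: "smooth_on UNIV f" and K: "compact K" "\<And>x. x \<notin> K \<Longrightarrow> f x = 0"
  obtains C where "C \<ge> 0"
    "\<And>\<sigma> b is x. (\<And>n t. (\<sigma> n has_vector_derivative \<sigma> (Suc n) t) (at t)) \<Longrightarrow>
       (\<And>n x. n \<le> k \<Longrightarrow> x \<in> K \<Longrightarrow> norm (\<sigma> n (\<rho> x) :: complex) \<le> b) \<Longrightarrow> b \<ge> 0 \<Longrightarrow> length is \<le> k \<Longrightarrow>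
       norm (pds is (\<lambda>x. \<sigma> 0 (\<rho> x) * f x) x) \<le> C * b"
proof -
  define \<rho>' where "\<rho>' i x = complex_of_real (pd i \<rho> x)" for i x
  have \<rho>': "smooth_on UNIV (\<rho>' i)" for i
  proof -
    have "\<rho>' i = (\<lambda>x. complex_of_real (pd i \<rho> x))" by (rule ext) (simp add: \<rho>'_def)
    then show ?thesis
      using smooth_on_of_real[OF open_UNIV smooth_on_pd[OF \<rho>, of i]] by simp
  qed
  define T where "T is j = chain_op \<rho>' is j f" for "is" j
  have "\<exists>B. \<forall>x\<in>K. norm (T is j x) \<le> B" for "is" j
  proof -
    have "continuous_on K (T is j)"
      unfolding T_def
      by (rule continuous_on_subset[OF smooth_on_continuous[OF smooth_on_chain_op[OF open_UNIV \<rho>' f]] subset_UNIV])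
    then have "bounded (T is j ` K)" by (intro compact_imp_bounded compact_continuous_image K)
    then show ?thesis by (auto simp: bounded_iff)
  qed
  then obtain B where B: "\<And>is j x. x \<in> K \<Longrightarrow> norm (T is j x) \<le> B is j" by metis
  define LS where "LS = {is :: 'n list. length is \<le> k}"
  have fin: "finite LS"
    using finite_lists_length_le[of "UNIV :: 'n set" k] by (simp add: LS_def)
  define C where "C = (\<Sum>is\<in>LS. \<Sum>j\<le>k. \<bar>B is j\<bar>)"
  show ?thesis
  proof (rule that[of C])
    show "C \<ge> 0" unfolding C_def by (intro sum_nonneg) auto
    fix \<sigma> :: "nat \<Rightarrow> real \<Rightarrow> complex" and b :: real and "is" :: "'n list" and x
    assume \<sigma>: "\<And>n t. (\<sigma> n has_vector_derivative \<sigma> (Suc n) t) (at t)"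
      and b: "\<And>n x. n \<le> k \<Longrightarrow> x \<in> K \<Longrightarrow> norm (\<sigma> n (\<rho> x)) \<le> b" "b \<ge> 0" and len: "length is \<le> k"
    show "norm (pds is (\<lambda>x. \<sigma> 0 (\<rho> x) * f x) x) \<le> C * b"
    proof (cases "x \<in> K")
      case False
      have "tsupp (\<lambda>x. \<sigma> 0 (\<rho> x) * f x) \<subseteq> K"
        by (rule tsupp_subset) (use K compact_imp_closed in auto)
      then have "pds is (\<lambda>x. \<sigma> 0 (\<rho> x) * f x) x = 0"
        using False by (intro pds_eq_0_off_tsupp) auto
      then show ?thesis using \<open>C \<ge> 0\<close> b(2) by simp
    next
      case True
      have "pds is (\<lambda>x. \<sigma> 0 (\<rho> x) * f x) x = (\<Sum>j\<le>length is. \<sigma> (0 + j) (\<rho> x) * T is j x)"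
        unfolding T_def by (rule pds_compose_mult[where \<sigma>=\<sigma>, OF open_UNIV \<sigma> \<rho> \<rho>'_def \<rho>' f UNIV_I])
      also have "norm \<dots> \<le> (\<Sum>j\<le>length is. b * \<bar>B is j\<bar>)"
        using b B[OF True] True len
        by (intro sum_norm_le) (auto simp: norm_mult intro!: mult_mono intro: order_trans[OF _ abs_ge_self])
      also have "\<dots> \<le> (\<Sum>j\<le>k. b * \<bar>B is j\<bar>)"
        using len b(2) by (intro sum_mono2) auto
      also have "\<dots> = b * (\<Sum>j\<le>k. \<bar>B is j\<bar>)" by (simp add: sum_distrib_left)
      also have "\<dots> \<le> b * C"
        unfolding C_def using len fin b(2)
        by (intro mult_left_mono member_le_sum[of "is" LS "\<lambda>is. \<Sum>j\<le>k. \<bar>B is j\<bar>"]) (auto simp: LS_def intro: sum_nonneg)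
      finally show ?thesis by (simp add: mult.commute)
    qed
  qed
qed

lemma chain_op_0: "chain_op \<rho>' is j (\<lambda>x. 0) = (\<lambda>x. 0)"
proof (induction "is" arbitrary: j)
  case Nil
  then show ?case by (cases j) auto
next
  case (Cons i "is")
  then show ?case by (cases j) (auto simp: pd_const)
qed

section \<open>Uniqueness across a noncharacteristic hypersurface\<close>

definition list_of :: "('n::finite \<Rightarrow> nat) \<Rightarrow> 'n list" where
  "list_of \<alpha> = (SOME is. \<forall>i. count_list is i = \<alpha> i)"

lemma count_list_of: "count_list (list_of \<alpha>) = \<alpha>"
  unfolding list_of_def using someI_ex[OF ex_list_count[of \<alpha>]] by blast

lemma length_list_of: "length (list_of \<alpha>) = mlen \<alpha>"
  using mlen_count_list[of "list_of \<alpha>"] by (simp add: count_list_of)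

lemma prod_list_eq_prod_count:
  fixes f :: "'n::finite \<Rightarrow> complex"
  shows "(\<Prod>i\<leftarrow>is. f i) = (\<Prod>i\<in>UNIV. f i ^ count_list is i)"
proof (induction "is")
  case (Cons a "is")
  have "(\<Prod>i\<in>UNIV. f i ^ count_list (a # is) i) = (\<Prod>i\<in>UNIV. (if i = a then f i else 1) * f i ^ count_list is i)"
    by (intro prod.cong) auto
  also have "\<dots> = f a * (\<Prod>i\<in>UNIV. f i ^ count_list is i)"
    by (simp add: prod.distrib prod.delta)
  finally show ?case using Cons by simp
qed simp

text \<open>The local situation at a noncharacteristic normal; \<open>not_in_dsupp\<close> shows
  that \<open>x0\<close> is then outside the support. The bound \<open>supp\<close> is quadratic and
  not merely \<open>\<rho> y \<le> 0\<close>, so that for small \<open>s\<close> the points of the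
  support in the ball with \<open>s + \<rho> y \<ge> 0\<close> are close to
  \<open>x0\<close>.\<close>

locale noncharacteristic = regular_seq M
  for M :: "nat \<Rightarrow> real" +
  fixes \<Omega> :: "(real^'n::finite) set" and m :: nat and a :: "('n \<Rightarrow> nat) \<Rightarrow> real^'n \<Rightarrow> complex"
    and u :: "(real^'n \<Rightarrow> complex) \<Rightarrow> complex" and x0 :: "real^'n" and r C0 :: real and \<rho> :: "real^'n \<Rightarrow> real"
  assumes qa: "quasianalytic_weight M" and mg: "moderate_growth M"
    and dist: "distribution \<Omega> u" and sol: "solves m a \<Omega> u"
    and r: "r > 0" "ball x0 r \<subseteq> \<Omega>"
    and a: "\<And>\<alpha>. mlen \<alpha> \<le> m \<Longrightarrow> denjoy (ball x0 r) (a \<alpha>)"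
    and \<rho>: "smooth_on UNIV \<rho>" "\<rho> x0 = 0" "\<And>i. denjoy (ball x0 r) (\<lambda>x. complex_of_real (pd i \<rho> x))"
    and symbol: "\<exists>c>0. \<forall>x\<in>ball x0 r. c \<le> norm (principal_symbol m a x (\<chi> i. pd i \<rho> x))"
    and C0: "C0 > 0" and supp: "\<And>y. y \<in> dsupp \<Omega> u \<Longrightarrow> y \<in> ball x0 r \<Longrightarrow> \<rho> y \<le> - C0 * (dist y x0)\<^sup>2"
begin

section \<open>The cutoff and the pairing with \<open>eta (s + \<rho>)\<close>\<close>

abbreviation W where "W \<equiv> ball x0 r"
definition K where "K = cball x0 (r / 2)"

lemma compact_K: "compact K" and closed_K: "closed K"
  by (simp_all add: K_def)

text \<open>A support point in \<open>K\<close> with \<open>s + \<rho> y \<ge> 0\<close> satisfies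
  \<open>C0 * (dist y x0)\<^sup>2 \<le> s\<close>; for \<open>s < \<delta>\<close> it lies within
  \<open>r / 3\<close> of \<open>x0\<close>, where \<open>\<kappa>\<close> is 1.\<close>

definition \<delta> where "\<delta> = C0 * (r / 3)\<^sup>2"

definition \<kappa> :: "real^'n \<Rightarrow> complex" where
  "\<kappa> = (SOME \<kappa>. smooth_on UNIV \<kappa> \<and> (\<forall>x. dist x x0 \<le> r / 3 \<longrightarrow> \<kappa> x = 1) \<and> (\<forall>x. dist x x0 \<ge> r / 2 \<longrightarrow> \<kappa> x = 0))"

lemma \<kappa>: "smooth_on UNIV \<kappa>" "\<And>x. dist x x0 \<le> r / 3 \<Longrightarrow> \<kappa> x = 1" "\<And>x. x \<notin> K \<Longrightarrow> \<kappa> x = 0"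
proof -
  have "\<exists>\<kappa>::real^'n \<Rightarrow> complex. smooth_on UNIV \<kappa> \<and> (\<forall>x. dist x x0 \<le> r / 3 \<longrightarrow> \<kappa> x = 1) \<and> (\<forall>x. dist x x0 \<ge> r / 2 \<longrightarrow> \<kappa> x = 0)"
    by (rule ex_cutoff[of "r / 3" "r / 2" x0]) (use r in auto)
  from someI_ex[OF this, folded \<kappa>_def]
  show "smooth_on UNIV \<kappa>" "\<And>x. dist x x0 \<le> r / 3 \<Longrightarrow> \<kappa> x = 1" "\<And>x. x \<notin> K \<Longrightarrow> \<kappa> x = 0"
    by (auto simp: K_def dist_commute)
qed

lemma KW: "K \<subseteq> W" "K \<subseteq> \<Omega>" using r by (force simp: K_def)+

definition \<rho>' where "\<rho>' i x = complex_of_real (pd i \<rho> x)"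

lemma smooth_\<rho>': "smooth_on UNIV (\<rho>' i)"
proof -
  have "\<rho>' i = (\<lambda>x. complex_of_real (pd i \<rho> x))" by (rule ext) (simp add: \<rho>'_def)
  then show ?thesis
    using smooth_on_of_real[OF open_UNIV smooth_on_pd[OF \<rho>(1), of i]] by simp
qed

lemma denjoy_\<rho>': "denjoy W (\<rho>' i)"
proof -
  have "\<rho>' i = (\<lambda>x. complex_of_real (pd i \<rho> x))" by (rule ext) (simp add: \<rho>'_def)
  then show ?thesis using \<rho>(3)[of i] by simp
qed

lemma smooth_extend:
  assumes "smooth_on W g" "\<And>x. x \<notin> K \<Longrightarrow> g x = (0 :: complex)"
  shows "smooth_on UNIV g"
proof -
  have "smooth_on (- K) g"
    by (rule smooth_on_cong[of _ "\<lambda>x. 0"]) (use assms(2) smooth_on_const closed_K in auto)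
  then have "smooth_on (W \<union> - K) g" using assms(1) closed_K by (intro smooth_on_Un) auto
  moreover have "W \<union> - K = UNIV" using KW by auto
  ultimately show ?thesis by simp
qed

lemma smooth_cut: "smooth_on W g \<Longrightarrow> smooth_on UNIV (\<lambda>x. \<kappa> x * g x)"
  by (rule smooth_extend) (auto intro: smooth_on_mult smooth_on_subset[OF \<kappa>(1)] simp: \<kappa>(3))

definition E :: "nat \<Rightarrow> real \<Rightarrow> real^'n \<Rightarrow> complex" where
  "E n s x = ceta n (s + \<rho> x)"

lemma sigma: "((\<lambda>t. ceta n (s + t)) has_vector_derivative ceta (Suc n) (s + t)) (at t)"
proof -
  have "((\<lambda>t. s + t) has_vector_derivative 1) (at t)" by (auto intro!: derivative_eq_intros)
  from vector_diff_chain_at[OF this has_vector_derivative_eta] show ?thesis by (simp add: o_def)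
qed

lemma smooth_E: "smooth_on UNIV (E n s)"
  unfolding E_def[abs_def]
  by (rule smooth_on_compose[where \<sigma>="\<lambda>n t. ceta n (s + t)", OF sigma open_UNIV \<rho>(1)])

text \<open>The cutoff is built in, so \<open>g\<close> only has to be smooth on \<open>W\<close>;
  the coefficients and the inverse of the symbol are controlled only there.\<close>

definition L :: "nat \<Rightarrow> real \<Rightarrow> (real^'n \<Rightarrow> complex) \<Rightarrow> complex" where
  "L n s g = u (\<lambda>x. E n s x * (\<kappa> x * g x))"

lemma test_K: "smooth_on UNIV f \<Longrightarrow> (\<And>x. x \<notin> K \<Longrightarrow> f x = 0) \<Longrightarrow> test_fun \<Omega> f"
  by (rule test_fun_I[of _ K]) (use KW compact_K in auto)

lemma test_L: "smooth_on W g \<Longrightarrow> test_fun \<Omega> (\<lambda>x. E n s x * (\<kappa> x * g x))"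
  by (rule test_K) (auto intro: smooth_on_mult smooth_E smooth_cut simp: \<kappa>(3))

lemma L_cong: "(\<And>x. x \<in> W \<Longrightarrow> f x = g x) \<Longrightarrow> L n s f = L n s g"
proof -
  assume "\<And>x. x \<in> W \<Longrightarrow> f x = g x"
  then have "(\<lambda>x. E n s x * (\<kappa> x * f x)) = (\<lambda>x. E n s x * (\<kappa> x * g x))"
    using \<kappa>(3) KW(1) by (intro ext) (metis mult_zero_left subsetD)
  then show ?thesis by (simp add: L_def)
qed

lemma order_ex: "\<exists>C k. C \<ge> 0 \<and> (\<forall>\<phi> B. smooth_on UNIV \<phi> \<and> (\<forall>x. x \<notin> K \<longrightarrow> \<phi> x = 0) \<and>
    (\<forall>is x. length is \<le> k \<longrightarrow> norm (pds is \<phi> x) \<le> B) \<longrightarrow> norm (u \<phi>) \<le> C * B)"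
proof -
  have "\<exists>C k. \<forall>\<phi> B. test_fun \<Omega> \<phi> \<and> tsupp \<phi> \<subseteq> K \<and>
                 (\<forall>is x. length is \<le> k \<longrightarrow> norm (pds is \<phi> x) \<le> B)
                 \<longrightarrow> norm (u \<phi>) \<le> C * B"
    using dist KW(2) compact_K unfolding distribution_def by simp
  then obtain C k where Ck: "\<And>\<phi> B. test_fun \<Omega> \<phi> \<Longrightarrow> tsupp \<phi> \<subseteq> K \<Longrightarrow>
                 (\<And>is x. length is \<le> k \<Longrightarrow> norm (pds is \<phi> x) \<le> B) \<Longrightarrow> norm (u \<phi>) \<le> C * B"
    by blast
  have "norm (u \<phi>) \<le> \<bar>C\<bar> * B"
    if "smooth_on UNIV \<phi>" "\<And>x. x \<notin> K \<Longrightarrow> \<phi> x = 0" "\<And>is x. length is \<le> k \<Longrightarrow> norm (pds is \<phi> x) \<le> B" for \<phi> B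
  proof -
    have "tsupp \<phi> \<subseteq> K" by (rule tsupp_subset) (use that closed_K in auto)
    then have "norm (u \<phi>) \<le> C * B" using that by (intro Ck test_K) auto
    also have "\<dots> \<le> \<bar>C\<bar> * B"
      using that(3)[of "[]" x0] norm_ge_zero[of "\<phi> x0"] by (intro mult_right_mono) (auto simp del: norm_ge_zero)
    finally show ?thesis .
  qed
  then show ?thesis by (intro exI[of _ "\<bar>C\<bar>"] exI[of _ k]) auto
qed

text \<open>An order of \<open>u\<close> on \<open>K\<close>, fixed once: it is independent of
  \<open>n\<close> and \<open>s\<close>, and it is the number of derivatives lost in
  \<open>L_estimate\<close>.\<close>

definition k0 where "k0 = (SOME k. \<exists>C. C \<ge> 0 \<and> (\<forall>\<phi> B. smooth_on UNIV \<phi> \<and> (\<forall>x. x \<notin> K \<longrightarrow> \<phi> x = 0) \<and>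
    (\<forall>is x. length is \<le> k \<longrightarrow> norm (pds is \<phi> x) \<le> B) \<longrightarrow> norm (u \<phi>) \<le> C * B))"

lemma order:
  obtains C where "C \<ge> 0" "\<And>\<phi> B. smooth_on UNIV \<phi> \<Longrightarrow> (\<And>x. x \<notin> K \<Longrightarrow> \<phi> x = 0) \<Longrightarrow>
    (\<And>is x. length is \<le> k0 \<Longrightarrow> norm (pds is \<phi> x) \<le> B) \<Longrightarrow> norm (u \<phi>) \<le> C * B"
proof -
  have "\<exists>k C. C \<ge> 0 \<and> (\<forall>\<phi> B. smooth_on UNIV \<phi> \<and> (\<forall>x. x \<notin> K \<longrightarrow> \<phi> x = 0) \<and>
    (\<forall>is x. length is \<le> k \<longrightarrow> norm (pds is \<phi> x) \<le> B) \<longrightarrow> norm (u \<phi>) \<le> C * B)"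
    using order_ex by blast
  from someI_ex[OF this, folded k0_def] show ?thesis using that by blast
qed

lemma \<rho>_bounded: obtains R where "R > 0" "\<And>x. x \<in> K \<Longrightarrow> \<bar>\<rho> x\<bar> \<le> R"
proof -
  have "continuous_on K \<rho>" by (rule continuous_on_subset[OF smooth_on_continuous[OF \<rho>(1)] subset_UNIV])
  then have "bounded (\<rho> ` K)" by (intro compact_imp_bounded compact_continuous_image compact_K)
  then obtain R where R: "\<And>x. x \<in> K \<Longrightarrow> norm (\<rho> x) \<le> R" by (auto simp: bounded_iff)
  show ?thesis by (rule that[of "\<bar>R\<bar> + 1"]) (use R in force)+
qed

lemma compose_bound:
  assumes "smooth_on UNIV f" "\<And>x. x \<notin> K \<Longrightarrow> f x = 0"
  obtains C where "C \<ge> 0"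
    "\<And>\<sigma> b. (\<And>n t. (\<sigma> n has_vector_derivative \<sigma> (Suc n) t) (at t)) \<Longrightarrow>
       (\<And>n x. n \<le> k0 \<Longrightarrow> x \<in> K \<Longrightarrow> norm (\<sigma> n (\<rho> x) :: complex) \<le> b) \<Longrightarrow> b \<ge> 0 \<Longrightarrow>
       norm (u (\<lambda>x. \<sigma> 0 (\<rho> x) * f x)) \<le> C * b"
proof -
  obtain C1 where C1: "C1 \<ge> 0" "\<And>\<phi> B. smooth_on UNIV \<phi> \<Longrightarrow> (\<And>x. x \<notin> K \<Longrightarrow> \<phi> x = 0) \<Longrightarrow>
    (\<And>is x. length is \<le> k0 \<Longrightarrow> norm (pds is \<phi> x) \<le> B) \<Longrightarrow> norm (u \<phi>) \<le> C1 * B"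
    by (rule order) blast
  obtain C2 where C2: "C2 \<ge> 0"
    "\<And>\<sigma> b is x. (\<And>n t. (\<sigma> n has_vector_derivative \<sigma> (Suc n) t) (at t)) \<Longrightarrow>
       (\<And>n x. n \<le> k0 \<Longrightarrow> x \<in> K \<Longrightarrow> norm (\<sigma> n (\<rho> x) :: complex) \<le> b) \<Longrightarrow> b \<ge> 0 \<Longrightarrow> length is \<le> k0 \<Longrightarrow>
       norm (pds is (\<lambda>x. \<sigma> 0 (\<rho> x) * f x) x) \<le> C2 * b"
    using compose_mult_bound[OF \<rho>(1) assms(1) compact_K assms(2), where k=k0] by blast
  show ?thesis
  proof (rule that[of "C1 * C2"])
    fix \<sigma> :: "nat \<Rightarrow> real \<Rightarrow> complex" and b :: real
    assume \<sigma>: "\<And>n t. (\<sigma> n has_vector_derivative \<sigma> (Suc n) t) (at t)"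
      and b: "\<And>n x. n \<le> k0 \<Longrightarrow> x \<in> K \<Longrightarrow> norm (\<sigma> n (\<rho> x)) \<le> b" "b \<ge> 0"
    have "norm (u (\<lambda>x. \<sigma> 0 (\<rho> x) * f x)) \<le> C1 * (C2 * b)"
    proof (rule C1(2))
      show "smooth_on UNIV (\<lambda>x. \<sigma> 0 (\<rho> x) * f x)"
        by (intro smooth_on_mult assms smooth_on_compose[of \<sigma>] \<sigma> \<rho> open_UNIV)
    qed (use assms(2) C2(2)[of \<sigma> b, OF \<sigma>] b in auto)
    then show "norm (u (\<lambda>x. \<sigma> 0 (\<rho> x) * f x)) \<le> C1 * C2 * b" by (simp add: mult.assoc)
  qed (use C1 C2 in auto)
qed

text \<open>The derivative in \<open>s\<close> passes under \<open>u\<close> since the Taylor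
  remainder of \<open>eta\<close> in \<open>s\<close>, together with its first \<open>k0\<close>
  derivatives, is quadratic in the increment.\<close>

lemma L_derivative:
  assumes g: "smooth_on W g"
  shows "((\<lambda>s. L n s g) has_vector_derivative L (Suc n) s g) (at s)"
proof -
  obtain R where R: "R > 0" "\<And>x. x \<in> K \<Longrightarrow> \<bar>\<rho> x\<bar> \<le> R" by (rule \<rho>_bounded) blast
  \<comment> \<open>The radius covers \<open>s + h + \<rho> x\<close> for
    \<open>\<bar>h\<bar> \<le> 1\<close>; the two orders beyond \<open>n + k0\<close> are for the
    remainder term.\<close>
  obtain B where B: "B \<ge> 0" "\<And>j t. j \<le> n + k0 + 2 \<Longrightarrow> \<bar>t\<bar> \<le> \<bar>s\<bar> + 1 + R \<Longrightarrow> \<bar>eta j t\<bar> \<le> B"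
    using eta_bound[of "n + k0 + 2" "\<bar>s\<bar> + 1 + R"] by blast
  obtain C where C: "C \<ge> 0" 
    "\<And>\<sigma> b. (\<And>n t. (\<sigma> n has_vector_derivative \<sigma> (Suc n) t) (at t)) \<Longrightarrow>
       (\<And>n x. n \<le> k0 \<Longrightarrow> x \<in> K \<Longrightarrow> norm (\<sigma> n (\<rho> x) :: complex) \<le> b) \<Longrightarrow> b \<ge> 0 \<Longrightarrow>
       norm (u (\<lambda>x. \<sigma> 0 (\<rho> x) * (\<kappa> x * g x))) \<le> C * b"
    by (rule compose_bound[OF smooth_cut[OF g]]) (auto simp: \<kappa>(3))
  show ?thesis
  proof (rule has_vector_derivative_quadratic)
    fix h :: real assume h: "\<bar>h\<bar> \<le> 1"
    \<comment> \<open>\<open>\<sigma> j\<close> is the \<open>j\<close>-th derivative in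
      \<open>t\<close> of the remainder \<open>\<sigma> 0\<close>.\<close>
    define \<sigma> where "\<sigma> j t = ceta (n + j) (s + h + t) - ceta (n + j) (s + t)
       - complex_of_real h * ceta (n + Suc j) (s + t)" for j t
    have test: "test_fun \<Omega> (\<lambda>x. E n s x * (\<kappa> x * g x))" for n s by (rule test_L[OF g])
    have testh: "test_fun \<Omega> (\<lambda>x. of_real h * (E (Suc n) s x * (\<kappa> x * g x)))"
      by (intro test_fun_mult test smooth_on_const)
    have "L n (s + h) g - L n s g - h *\<^sub>R L (Suc n) s g
       = u (\<lambda>x. (E n (s + h) x * (\<kappa> x * g x) - E n s x * (\<kappa> x * g x)) - of_real h * (E (Suc n) s x * (\<kappa> x * g x)))"
      unfolding L_def distribution_diff[OF dist test_fun_diff[OF test test] testh]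
        distribution_diff[OF dist test test] distribution_scale[OF dist test]
      by (simp add: scaleR_conv_of_real)
    also have "\<dots> = u (\<lambda>x. \<sigma> 0 (\<rho> x) * (\<kappa> x * g x))"
      by (simp add: \<sigma>_def E_def algebra_simps)
    also have "norm \<dots> \<le> C * (B * h\<^sup>2)"
    proof (rule C(2))
      show "(\<sigma> j has_vector_derivative \<sigma> (Suc j) t) (at t)" for j t
        unfolding \<sigma>_def using sigma[of "n + j" "s + h" t] sigma[of "n + j" s t] sigma[of "n + Suc j" s t]
        by (intro has_vector_derivative_diff has_vector_derivative_mult_right) auto
      show "norm (\<sigma> j (\<rho> x)) \<le> B * h\<^sup>2" if "j \<le> k0" "x \<in> K" for j x
      proof -
        have "\<sigma> j (\<rho> x) = of_real (eta (n + j) ((s + \<rho> x) + h) - eta (n + j) (s + \<rho> x) - h * eta (Suc (n + j)) (s + \<rho> x))"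
          by (simp add: \<sigma>_def add_ac)
        also have "norm \<dots> \<le> B * h\<^sup>2"
          unfolding norm_of_real
          by (rule eta_taylor[where R="\<bar>s\<bar> + 1 + R"]) (use B(2) R(2)[OF that(2)] h that(1) in auto)
        finally show ?thesis .
      qed
    qed (use B in auto)
    finally show "norm (L n (s + h) g - L n s g - h *\<^sub>R L (Suc n) s g) \<le> (C * B) * h\<^sup>2" by (simp add: mult.assoc)
  qed
qed

lemma open_below: "open {x. s + \<rho> x < 0}"
  using smooth_on_continuous[OF \<rho>(1)] by (intro open_Collect_less continuous_intros) 

text \<open>On the part of the support inside \<open>K\<close> one has
  \<open>\<rho> \<le> 0\<close>, so \<open>s + \<rho>\<close> is negative there and
  \<open>eta\<close> vanishes nearby.\<close>

lemma L_negative: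
  assumes "smooth_on W g" "s < 0"
  shows "L n s g = 0"
proof -
  have "L n s g = u (\<lambda>x. 0)" unfolding L_def
  proof (rule distribution_eq_near_dsupp[OF dist test_L[OF assms(1)] test_fun_zero])
    show "open ({x. s + \<rho> x < 0} \<union> - K)" using open_below closed_K by auto
    show "dsupp \<Omega> u \<subseteq> {x. s + \<rho> x < 0} \<union> - K"
    proof
      fix y assume y: "y \<in> dsupp \<Omega> u"
      show "y \<in> {x. s + \<rho> x < 0} \<union> - K"
      proof (cases "y \<in> K")
        case True
        then have "\<rho> y \<le> - C0 * (dist y x0)\<^sup>2" using supp y KW by blast
        also have "\<dots> \<le> 0" using C0 by simp
        finally show ?thesis using assms(2) by simp
      qed simp
    qed
    show "E n s x * (\<kappa> x * g x) = 0" if "x \<in> {x. s + \<rho> x < 0} \<union> - K" for x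
      using that \<kappa>(3)[of x] by (auto simp: E_def)
  qed
  then show ?thesis using distribution_zero[OF dist] by simp
qed

end

section \<open>The transposed operator on composite test functions, and the recursion\<close>

context noncharacteristic
begin

text \<open>The sign from transposition times the factor in \<open>Dop\<close>; the product is
  \<open>\<i> ^ mlen \<alpha>\<close>, whence the factor \<open>\<i> ^ m\<close> in
  \<open>q\<close>.\<close>

definition coef :: "('n \<Rightarrow> nat) \<Rightarrow> complex" where
  "coef \<alpha> = (-1) ^ mlen \<alpha> * (- \<i>) ^ mlen \<alpha>"

text \<open>The coefficient of \<open>E (N + j) s\<close> when the transposed operator is applied to
  \<open>E N s x * g x\<close>; it is independent of \<open>N\<close> and \<open>s\<close>, and the
  top one is multiplication by \<open>q\<close>.\<close>

definition Q :: "nat \<Rightarrow> (real^'n \<Rightarrow> complex) \<Rightarrow> real^'n \<Rightarrow> complex" where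
  "Q j g x = (\<Sum>\<alpha>\<in>{\<alpha>. mlen \<alpha> \<le> m}. coef \<alpha> * chain_op \<rho>' (list_of \<alpha>) j (\<lambda>y. a \<alpha> y * g y) x)"

definition q :: "real^'n \<Rightarrow> complex" where
  "q x = \<i> ^ m * principal_symbol m a x (\<chi> i. pd i \<rho> x)"

lemma \<delta>_pos: "\<delta> > 0"
  using C0 r by (simp add: \<delta>_def)

lemma Q_top: "Q m g x = q x * g x"
proof -
  have top: "chain_op \<rho>' (list_of \<alpha>) m (\<lambda>y. a \<alpha> y * g y) x =
      (\<Prod>i\<in>UNIV. complex_of_real (pd i \<rho> x) ^ \<alpha> i) * (a \<alpha> x * g x)" if "mlen \<alpha> = m" for \<alpha>
    using chain_op_top[of \<rho>' "list_of \<alpha>" "\<lambda>y. a \<alpha> y * g y" x] prod_list_eq_prod_count[of "\<lambda>i. \<rho>' i x" "list_of \<alpha>"] that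
    by (simp add: length_list_of count_list_of \<rho>'_def)
  have "Q m g x = (\<Sum>\<alpha>\<in>{\<alpha>. mlen \<alpha> = m}. coef \<alpha> * chain_op \<rho>' (list_of \<alpha>) m (\<lambda>y. a \<alpha> y * g y) x)"
    unfolding Q_def
    by (rule sum.mono_neutral_right[OF finite_mlen_le]) (auto simp: chain_op_zero length_list_of)
  also have "\<dots> = (\<Sum>\<alpha>\<in>{\<alpha>. mlen \<alpha> = m}. \<i> ^ m * (a \<alpha> x * (\<Prod>i\<in>UNIV. complex_of_real (pd i \<rho> x) ^ \<alpha> i)) * g x)"
    by (intro sum.cong refl) (simp add: top coef_def power_mult_distrib[symmetric])
  also have "\<dots> = q x * g x"
    by (simp add: q_def principal_symbol_def sum_distrib_left sum_distrib_right mult_ac)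
  finally show ?thesis .
qed

lemma denjoy_q: "denjoy W q"
proof -
  have "denjoy W (\<lambda>x. \<i> ^ m * (\<Sum>\<alpha>\<in>{\<alpha>. mlen \<alpha> = m}. a \<alpha> x * (\<Prod>i\<in>UNIV. complex_of_real (pd i \<rho> x) ^ \<alpha> i)))"
    by (intro denjoy_mult denjoy_sum denjoy_prod denjoy_power denjoy_const open_ball a \<rho>(3)) auto
  then show ?thesis by (simp add: q_def[abs_def] principal_symbol_def)
qed

lemma denjoy_inverse_q: "denjoy W (\<lambda>x. inverse (q x))" and q_nonzero: "x \<in> W \<Longrightarrow> q x \<noteq> 0"
proof -
  obtain c where c: "c > 0" "\<And>x. x \<in> W \<Longrightarrow> c \<le> norm (principal_symbol m a x (\<chi> i. pd i \<rho> x))"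
    using symbol by blast
  have le: "c \<le> norm (q x)" if "x \<in> W" for x
    using c(2)[OF that] by (simp add: q_def norm_mult norm_power)
  show "denjoy W (\<lambda>x. inverse (q x))"
    by (rule denjoy_inverse[OF open_ball denjoy_q c(1) le])
  show "x \<in> W \<Longrightarrow> q x \<noteq> 0" using le[of x] c(1) by auto
qed

lemma smooth_a_mult:
  assumes "smooth_on UNIV f" "\<And>x. x \<notin> K \<Longrightarrow> f x = 0" "mlen \<alpha> \<le> m"
  shows "smooth_on UNIV (\<lambda>y. a \<alpha> y * f y)"
  by (rule smooth_extend)
     (auto intro!: smooth_on_mult denjoy_smooth[OF a] assms(3) smooth_on_subset[OF assms(1)] simp: assms(2))

lemma smooth_Q:
  assumes "smooth_on UNIV f" "\<And>x. x \<notin> K \<Longrightarrow> f x = 0"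
  shows "smooth_on UNIV (Q j f)"
  unfolding Q_def[abs_def]
  by (intro smooth_on_sum smooth_on_mult smooth_on_const smooth_on_chain_op smooth_\<rho>' open_UNIV smooth_a_mult)
     (use assms in auto)

lemma Q_zero:
  assumes "\<And>x. x \<notin> K \<Longrightarrow> f x = 0" "x \<notin> K"
  shows "Q j f x = 0"
proof -
  have "chain_op \<rho>' (list_of \<alpha>) j (\<lambda>y. a \<alpha> y * f y) x = chain_op \<rho>' (list_of \<alpha>) j (\<lambda>y. 0) x" for \<alpha>
    by (rule chain_op_cong[of "- K"]) (use assms closed_K in auto)
  then show ?thesis by (simp add: Q_def chain_op_0)
qed

lemma smooth_Q_W:
  assumes "smooth_on W f"
  shows "smooth_on W (Q j f)"
  unfolding Q_def[abs_def]
  by (intro smooth_on_sum smooth_on_mult smooth_on_const smooth_on_chain_op open_ball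
      smooth_on_subset[OF smooth_\<rho>'] denjoy_smooth[OF a] assms) auto

lemma transp_eq:
  assumes f: "smooth_on UNIV f" "\<And>x. x \<notin> K \<Longrightarrow> f x = 0"
  shows "transp m a \<Omega> (\<lambda>x. E N s x * f x) = (\<lambda>x. \<Sum>j\<le>m. E (N + j) s x * Q j f x)"
proof
  fix x
  have "transp m a \<Omega> (\<lambda>x. E N s x * f x) x
    = (\<Sum>\<alpha>\<in>{\<alpha>. mlen \<alpha> \<le> m}. \<Sum>j\<le>m. E (N + j) s x * (coef \<alpha> * chain_op \<rho>' (list_of \<alpha>) j (\<lambda>y. a \<alpha> y * f y) x))"
    unfolding transp_def
  proof (rule sum.cong[OF refl])
    fix \<alpha> :: "'n \<Rightarrow> nat" assume "\<alpha> \<in> {\<alpha>. mlen \<alpha> \<le> m}"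
    then have \<alpha>: "mlen \<alpha> \<le> m" by simp
    let ?T = "\<lambda>j. chain_op \<rho>' (list_of \<alpha>) j (\<lambda>y. a \<alpha> y * f y) x"
    \<comment> \<open>\<open>f\<close> vanishes off \<open>K\<close>, which lies in
      \<open>\<Omega>\<close>, so the extension by 0 is automatic.\<close>
    have fn: "(\<lambda>y. if y \<in> \<Omega> then a \<alpha> y * (E N s y * f y) else 0)
        = (\<lambda>y. ceta N (s + \<rho> y) * (a \<alpha> y * f y))"
    proof
      fix y
      show "(if y \<in> \<Omega> then a \<alpha> y * (E N s y * f y) else 0) = ceta N (s + \<rho> y) * (a \<alpha> y * f y)"
        using f(2)[of y] KW(2) by (cases "y \<in> K") (auto simp: E_def)
    qed
    have "pds (list_of \<alpha>) (\<lambda>y. ceta N (s + \<rho> y) * (a \<alpha> y * f y)) x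
       = (\<Sum>j\<le>length (list_of \<alpha>). ceta (N + j) (s + \<rho> x) * ?T j)"
      by (rule pds_compose_mult[where \<sigma>="\<lambda>n t. ceta n (s + t)",
            OF open_UNIV sigma \<rho>(1) \<rho>'_def smooth_\<rho>' smooth_a_mult[OF f \<alpha>] UNIV_I])
    also have "\<dots> = (\<Sum>j\<le>m. E (N + j) s x * ?T j)"
      unfolding E_def
      by (rule sum.mono_neutral_left) (use \<alpha> in \<open>auto simp: chain_op_zero length_list_of\<close>)
    finally have eq: "pds (list_of \<alpha>) (\<lambda>y. ceta N (s + \<rho> y) * (a \<alpha> y * f y)) x
        = (\<Sum>j\<le>m. E (N + j) s x * ?T j)" .
    have "(- 1) ^ mlen \<alpha> * Dop \<alpha> (\<lambda>y. if y \<in> \<Omega> then a \<alpha> y * (E N s y * f y) else 0) x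
       = coef \<alpha> * (\<Sum>j\<le>m. E (N + j) s x * ?T j)"
      unfolding Dop_def dpart_def list_of_def[symmetric] fn eq coef_def by (simp add: mult.assoc)
    also have "\<dots> = (\<Sum>j\<le>m. E (N + j) s x * (coef \<alpha> * ?T j))"
      by (simp add: sum_distrib_left mult_ac)
    finally show "(- 1) ^ mlen \<alpha> * Dop \<alpha> (\<lambda>y. if y \<in> \<Omega> then a \<alpha> y * (E N s y * f y) else 0) x
       = (\<Sum>j\<le>m. E (N + j) s x * (coef \<alpha> * ?T j))" .
  qed
  also have "\<dots> = (\<Sum>j\<le>m. E (N + j) s x * Q j f x)"
    by (subst sum.swap) (simp add: Q_def sum_distrib_left)
  finally show "transp m a \<Omega> (\<lambda>x. E N s x * f x) x = (\<Sum>j\<le>m. E (N + j) s x * Q j f x)" .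
qed

text \<open>For \<open>s < \<delta>\<close> the cutoff equals 1 near the part of the support of \<open>u\<close> met by \<open>E n s\<close>,
  so it commutes with the differential operators under \<open>u\<close>.\<close>

lemma L_recursion:
  assumes \<psi>: "smooth_on W \<psi>" and s: "s < \<delta>"
  shows "L (N + m) s \<psi> = - (\<Sum>j<m. L (N + j) s (Q j (\<lambda>x. inverse (q x) * \<psi> x)))"
proof -
  define w where "w x = inverse (q x) * \<psi> x" for x
  have w: "smooth_on W w"
    unfolding w_def[abs_def] by (intro smooth_on_mult open_ball denjoy_smooth[OF denjoy_inverse_q] \<psi>)
  \<comment> \<open>The equation needs a global test function, so \<open>\<kappa>\<close> stands
    inside \<open>Q j\<close> at first; \<open>summand\<close> moves it outside.\<close>
  define f where "f x = \<kappa> x * w x" for x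
  have f: "smooth_on UNIV f" "\<And>x. x \<notin> K \<Longrightarrow> f x = 0"
    unfolding f_def[abs_def] using smooth_cut[OF w] \<kappa>(3) by auto
  have t1: "test_fun \<Omega> (\<lambda>x. E (N + j) s x * Q j f x)" for j
    using Q_zero[of f] f(2) by (intro test_K smooth_on_mult smooth_E smooth_Q f open_UNIV) auto
  have summand: "u (\<lambda>x. E (N + j) s x * Q j f x) = L (N + j) s (Q j w)" for j
    unfolding L_def
  proof (rule distribution_eq_near_dsupp[OF dist t1 test_L[OF smooth_Q_W[OF w]]])
    \<comment> \<open>On the first set \<open>\<kappa>\<close> is 1, on the second \<open>E\<close>
      vanishes, on the third both sides vanish. A support point outside all three would give
      \<open>\<delta> \<le> s\<close>.\<close>
    let ?V = "ball x0 (r / 3) \<union> {x. s + \<rho> x < 0} \<union> - K"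
    show "open ?V" using open_below closed_K by auto
    show "dsupp \<Omega> u \<subseteq> ?V"
    proof
      fix y assume y: "y \<in> dsupp \<Omega> u"
      show "y \<in> ?V"
      proof (rule ccontr)
        assume "y \<notin> ?V"
        then have *: "y \<in> K" "0 \<le> s + \<rho> y" "r / 3 \<le> dist y x0" by (auto simp: dist_commute)
        have "\<rho> y \<le> - C0 * (dist y x0)\<^sup>2" using supp[OF y] *(1) KW by blast
        moreover have "C0 * (r / 3)\<^sup>2 \<le> C0 * (dist y x0)\<^sup>2"
          using *(3) C0 r by (intro mult_left_mono power_mono) auto
        ultimately show False using *(2) s by (simp add: \<delta>_def)
      qed
    qed
    fix x assume "x \<in> ?V"
    then consider "x \<in> ball x0 (r / 3)" | "s + \<rho> x < 0" | "x \<notin> K" by auto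
    then show "E (N + j) s x * Q j f x = E (N + j) s x * (\<kappa> x * Q j w x)"
    proof cases
      case 1
      have "chain_op \<rho>' (list_of \<alpha>) j (\<lambda>y. a \<alpha> y * f y) x = chain_op \<rho>' (list_of \<alpha>) j (\<lambda>y. a \<alpha> y * w y) x" for \<alpha>
        by (rule chain_op_cong[OF open_ball 1]) (simp add: f_def \<kappa>(2) dist_commute)
      then have "Q j f x = Q j w x" by (simp add: Q_def)
      then show ?thesis using 1 by (simp add: \<kappa>(2) dist_commute)
    next
      case 2
      then show ?thesis by (simp add: E_def)
    next
      case 3
      then show ?thesis using Q_zero[of f, OF f(2)] \<kappa>(3) by simp
    qed
  qed
  have "0 = u (transp m a \<Omega> (\<lambda>x. E N s x * f x))"
  proof -
    have "test_fun \<Omega> (\<lambda>x. E N s x * f x)"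
      by (intro test_K smooth_on_mult smooth_E f open_UNIV) (simp add: f(2))
    then show ?thesis using sol by (simp add: solves_def)
  qed
  also have "\<dots> = (\<Sum>j\<le>m. L (N + j) s (Q j w))"
  proof -
    have "transp m a \<Omega> (\<lambda>x. E N s x * f x) = (\<lambda>x. \<Sum>j\<le>m. E (N + j) s x * Q j f x)"
      by (rule transp_eq) (use f in auto)
    then show ?thesis
      using distribution_sum[OF dist t1, where A="{..m}"] by (simp add: summand)
  qed
  also have "\<dots> = L (N + m) s (Q m w) + (\<Sum>j<m. L (N + j) s (Q j w))"
    by (simp add: lessThan_Suc_atMost[symmetric])
  \<comment> \<open>The division by \<open>q\<close> in \<open>w\<close> is for this term:
    multiplication by \<open>q\<close> gives back \<open>\<psi>\<close>.\<close>
  also have "L (N + m) s (Q m w) = L (N + m) s \<psi>"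
    by (rule L_cong) (simp add: Q_top w_def q_nonzero)
  finally show ?thesis
    unfolding w_def[abs_def] by (simp add: eq_neg_iff_add_eq_0)
qed

text \<open>What \<open>E\<close> loses in order is returned as differentiation of
  \<open>\<psi>\<close>: \<open>(N + j) + (m - j) = N + m\<close>. This balance keeps the index of
  \<open>M\<close> fixed in \<open>L_estimate\<close>.\<close>

lemma op_order_Q: "j < m \<Longrightarrow> op_order W (m - j) (\<lambda>\<psi>. Q j (\<lambda>x. inverse (q x) * \<psi> x))"
proof -
  assume j: "j < m"
  have "op_order W (m - j) (\<lambda>g x. coef \<alpha> * chain_op \<rho>' (list_of \<alpha>) j (\<lambda>y. a \<alpha> y * g y) x)"
    if "mlen \<alpha> \<le> m" for \<alpha>
  proof (cases "j \<le> mlen \<alpha>")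
    case False
    then show ?thesis using op_order_zero by (simp add: chain_op_zero length_list_of)
  next
    case True
    have 1: "op_order W (mlen \<alpha> - j) (chain_op \<rho>' (list_of \<alpha>) j)"
      using op_order_chain_op[OF open_ball denjoy_\<rho>', of j "list_of \<alpha>"] True by (simp add: length_list_of)
    have "op_order W (0 + (mlen \<alpha> - j) + 0) (\<lambda>g x. coef \<alpha> * chain_op \<rho>' (list_of \<alpha>) j (\<lambda>y. a \<alpha> y * g y) x)"
      by (rule op_order_compose[OF op_order_mult[OF open_ball denjoy_const]
            op_order_compose[OF 1 op_order_mult[OF open_ball a[OF that]]]])
    then show ?thesis by (rule op_order_mono) (use that in auto)
  qed
  then have "op_order W (m - j) (\<lambda>g x. \<Sum>\<alpha>\<in>{\<alpha>. mlen \<alpha> \<le> m}. coef \<alpha> * chain_op \<rho>' (list_of \<alpha>) j (\<lambda>y. a \<alpha> y * g y) x)"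
    by (intro op_order_sum open_ball) auto
  moreover have "Q j = (\<lambda>g x. \<Sum>\<alpha>\<in>{\<alpha>. mlen \<alpha> \<le> m}. coef \<alpha> * chain_op \<rho>' (list_of \<alpha>) j (\<lambda>y. a \<alpha> y * g y) x)"
    by (intro ext) (simp add: Q_def)
  ultimately have "op_order W (m - j) (Q j)" by simp
  from op_order_compose[OF this op_order_mult[OF open_ball denjoy_inverse_q]] show ?thesis by simp
qed

text \<open>Continuity of \<open>L n s\<close> in finitely many derivatives, uniform for bounded
  \<open>s\<close>. It starts the recursion for \<open>n < m\<close> and later carries the passage
  from polynomials to test functions.\<close>

lemma L_bound:
  obtains C where "C \<ge> 0"
    "\<And>s \<psi> B. \<bar>s\<bar> \<le> S \<Longrightarrow> smooth_on W \<psi> \<Longrightarrow> (\<And>is x. length is \<le> k0 \<Longrightarrow> x \<in> W \<Longrightarrow> norm (pds is \<psi> x) \<le> B) \<Longrightarrow>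
       norm (L n s \<psi>) \<le> C * B"
proof -
  obtain R where R: "R > 0" "\<And>x. x \<in> K \<Longrightarrow> \<bar>\<rho> x\<bar> \<le> R" by (rule \<rho>_bounded) blast
  obtain Be where Be: "Be \<ge> 0" "\<And>j t. j \<le> n + k0 \<Longrightarrow> \<bar>t\<bar> \<le> S + R \<Longrightarrow> \<bar>eta j t\<bar> \<le> Be"
    using eta_bound[of "n + k0" "S + R"] by blast
  obtain C1 where C1: "C1 \<ge> 0" "\<And>\<phi> B. smooth_on UNIV \<phi> \<Longrightarrow> (\<And>x. x \<notin> K \<Longrightarrow> \<phi> x = 0) \<Longrightarrow>
    (\<And>is x. length is \<le> k0 \<Longrightarrow> norm (pds is \<phi> x) \<le> B) \<Longrightarrow> norm (u \<phi>) \<le> C1 * B"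
    by (rule order) blast
  obtain C2 where C2: "C2 \<ge> 0"
    "\<And>\<sigma> b is x. (\<And>n t. (\<sigma> n has_vector_derivative \<sigma> (Suc n) t) (at t)) \<Longrightarrow>
       (\<And>n x. n \<le> k0 \<Longrightarrow> x \<in> K \<Longrightarrow> norm (\<sigma> n (\<rho> x) :: complex) \<le> b) \<Longrightarrow> b \<ge> 0 \<Longrightarrow> length is \<le> k0 \<Longrightarrow>
       norm (pds is (\<lambda>x. \<sigma> 0 (\<rho> x) * \<kappa> x) x) \<le> C2 * b"
    using compose_mult_bound[OF \<rho>(1) \<kappa>(1) compact_K \<kappa>(3), where k=k0] by blast
  show ?thesis
  \<comment> \<open>\<open>C1\<close> belongs to \<open>u\<close>, \<open>C2 * Be\<close> bounds the
    derivatives of \<open>E n s x * \<kappa> x\<close>, and \<open>2 ^ k0\<close> bounds the sum of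
    the binomial coefficients.\<close>
  proof (rule that[of "C1 * (2 ^ k0 * (C2 * Be))"])
    fix s B :: real and \<psi> :: "real^'n \<Rightarrow> complex" assume s: "\<bar>s\<bar> \<le> S" and \<psi>: "smooth_on W \<psi>"
      and B: "\<And>is x. length is \<le> k0 \<Longrightarrow> x \<in> W \<Longrightarrow> norm (pds is \<psi> x) \<le> B"
    have "x0 \<in> W" using r by simp
    then have B0: "B \<ge> 0" using order_trans[OF norm_ge_zero B[of "[]" x0]] by simp
    have Ek: "norm (pds is (\<lambda>x. E n s x * \<kappa> x) x) \<le> C2 * Be" if "length is \<le> k0" for "is" x
    proof -
      have "norm (pds is (\<lambda>x. ceta (n + 0) (s + \<rho> x) * \<kappa> x) x) \<le> C2 * Be"
      proof (rule C2(2)[of "\<lambda>j t. ceta (n + j) (s + t)" Be])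
        show "((\<lambda>t. ceta (n + j) (s + t)) has_vector_derivative ceta (n + Suc j) (s + t)) (at t)" for j t
          using sigma[of "n + j" s t] by simp
        show "norm (ceta (n + j) (s + \<rho> x)) \<le> Be" if "j \<le> k0" "x \<in> K" for j x
          unfolding norm_of_real using R(2)[OF that(2)] s that(1) by (intro Be(2)) auto
      qed (use Be that in auto)
      then show ?thesis by (simp add: E_def)
    qed
    have fn: "(\<lambda>x. E n s x * (\<kappa> x * \<psi> x)) = (\<lambda>x. (E n s x * \<kappa> x) * \<psi> x)" by (simp add: mult.assoc)
    have "norm (L n s \<psi>) \<le> C1 * (2 ^ k0 * (C2 * Be * B))"
      unfolding L_def
    proof (rule C1(2))
      show "smooth_on UNIV (\<lambda>x. E n s x * (\<kappa> x * \<psi> x))"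
        by (intro smooth_on_mult smooth_E smooth_cut \<psi> open_UNIV)
      fix "is" :: "'n list" and x assume len: "length is \<le> k0"
      show "norm (pds is (\<lambda>x. E n s x * (\<kappa> x * \<psi> x)) x) \<le> 2 ^ k0 * (C2 * Be * B)"
      proof (cases "x \<in> K")
        case False
        have "tsupp (\<lambda>x. E n s x * (\<kappa> x * \<psi> x)) \<subseteq> K"
          by (rule tsupp_subset) (use closed_K \<kappa>(3) in auto)
        then have "pds is (\<lambda>x. E n s x * (\<kappa> x * \<psi> x)) x = 0"
          using False by (intro pds_eq_0_off_tsupp) auto
        then show ?thesis using C2 Be B0 by simp
      next
        case True
        then have xW: "x \<in> W" using KW by auto
        have sm: "smooth_on W (\<lambda>x. E n s x * \<kappa> x)"
          by (intro smooth_on_mult open_ball smooth_on_subset[OF smooth_E] smooth_on_subset[OF \<kappa>(1)]) auto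
        have "norm (pds is (\<lambda>x. (E n s x * \<kappa> x) * \<psi> x) x)
           \<le> (\<Sum>k\<le>length is. real (length is choose k) * ((C2 * Be) * B))"
          by (rule norm_pds_mult_le[OF open_ball sm \<psi> xW]) (use Ek B xW len in auto)
        also have "\<dots> = (\<Sum>k\<le>length is. real (length is choose k)) * (C2 * Be * B)"
          by (simp add: sum_distrib_right)
        also have "(\<Sum>k\<le>length is. real (length is choose k)) = 2 ^ length is"
          by (metis choose_row_sum of_nat_numeral of_nat_power of_nat_sum)
        also have "2 ^ length is * (C2 * Be * B) \<le> 2 ^ k0 * (C2 * Be * B)"
          using len C2(1) Be(1) B0 by (intro mult_right_mono power_increasing) auto
        finally show ?thesis unfolding fn .
      qed
    qed (simp add: \<kappa>(3))
    then show "norm (L n s \<psi>) \<le> C1 * (2 ^ k0 * (C2 * Be)) * B" by (simp add: mult_ac)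
  qed (use C1 C2 Be in auto)
qed

text \<open>Induction on \<open>n\<close> with \<open>d\<close> and \<open>A\<close> general: one
  recursion step sends \<open>n\<close> to \<open>N + j < n\<close>, \<open>d\<close> to
  \<open>d + (m - j)\<close> and \<open>A\<close> to \<open>c j * A\<close>. The sum
  \<open>n + d\<close> is constant, the sum of the \<open>c j\<close> is paid by one power of
  \<open>H\<close>, and \<open>h\<close> never changes. Moderate growth then splits off the
  \<open>k0\<close> lost derivatives.\<close>

lemma L_estimate:
  assumes \<psi>: "denjoy W \<psi>"
  obtains C h where "h > 0" "\<And>n s. - 1 < s \<Longrightarrow> s < \<delta> \<Longrightarrow> norm (L n s \<psi>) \<le> C * h ^ n * M n"
proof -
  define P where "P j c \<longleftrightarrow> c \<ge> 0 \<and> (\<forall>\<^sub>F h in at_top. op_bound W h c (m - j) (\<lambda>f. Q j (\<lambda>x. inverse (q x) * f x)))" for j c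
  have "\<exists>c. j < m \<longrightarrow> P j c" for j
    using op_order_Q[of j] unfolding op_order_def P_def by blast
  then obtain c where "\<And>j. j < m \<longrightarrow> P j (c j)" by metis
  then have c: "\<And>j. j < m \<Longrightarrow> c j \<ge> 0" "\<And>j. j < m \<Longrightarrow> \<forall>\<^sub>F h in at_top. op_bound W h (c j) (m - j) (\<lambda>f. Q j (\<lambda>x. inverse (q x) * f x))"
    unfolding P_def by simp_all
  obtain A0 h0 where A0: "A0 \<ge> 0" "h0 > 0" "weighted W h0 A0 0 \<psi>" using \<psi> unfolding denjoy_def by blast
  \<comment> \<open>One radius has to serve the operators of all \<open>j < m\<close> and
    \<open>\<psi>\<close>; this is possible because the \<open>c j\<close> were chosen before
    \<open>h\<close>.\<close>
  have "\<forall>\<^sub>F h in at_top. (\<forall>j\<in>{..<m}. op_bound W h (c j) (m - j) (\<lambda>f. Q j (\<lambda>x. inverse (q x) * f x))) \<and> h \<ge> 1 \<and> h \<ge> h0"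
    using c(2) by (intro eventually_conj eventually_ball_finite eventually_ge_at_top) auto
  from eventually_happens'[OF trivial_limit_at_top_linorder this]
  obtain h where hh: "\<forall>j\<in>{..<m}. op_bound W h (c j) (m - j) (\<lambda>f. Q j (\<lambda>x. inverse (q x) * f x))" "h \<ge> 1" "h \<ge> h0"
    by blast
  have h: "h \<ge> 1" "h \<ge> h0" and Qw: "\<And>j A d f. j < m \<Longrightarrow> A \<ge> 0 \<Longrightarrow> weighted W h A d f \<Longrightarrow>
      weighted W h (c j * A) (d + (m - j)) (Q j (\<lambda>x. inverse (q x) * f x))"
    using hh unfolding op_bound_def Ball_def lessThan_iff by blast+
  \<comment> \<open>At least 1, so that powers of \<open>H\<close> increase and
    \<open>H ^ (N + j)\<close> can be replaced by \<open>H ^ (n - 1)\<close>.\<close>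
  define H where "H = max 1 (\<Sum>j<m. c j)"
  have H: "H \<ge> 1" "(\<Sum>j<m. c j) \<le> H" by (auto simp: H_def)
  define R where "R n C \<longleftrightarrow> C \<ge> 0 \<and> (\<forall>s \<psi> B. \<bar>s\<bar> \<le> 1 + \<delta> \<longrightarrow> smooth_on W \<psi> \<longrightarrow>
      (\<forall>is x. length is \<le> k0 \<longrightarrow> x \<in> W \<longrightarrow> norm (pds is \<psi> x) \<le> B) \<longrightarrow> norm (L n s \<psi>) \<le> C * B)" for n C
  have "\<exists>C. R n C" for n
    unfolding R_def by (rule L_bound[of "1 + \<delta>" n]) blast
  then obtain Cn where "\<And>n. R n (Cn n)" by metis
  then have Cn: "\<And>n. Cn n \<ge> 0" "\<And>n s \<psi> B. \<bar>s\<bar> \<le> 1 + \<delta> \<Longrightarrow> smooth_on W \<psi> \<Longrightarrow>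
      (\<And>is x. length is \<le> k0 \<Longrightarrow> x \<in> W \<Longrightarrow> norm (pds is \<psi> x) \<le> B) \<Longrightarrow> norm (L n s \<psi>) \<le> Cn n * B"
    unfolding R_def by blast+
  define C where "C = (\<Sum>n<m. Cn n)"
  have C: "C \<ge> 0" unfolding C_def using Cn(1) by (intro sum_nonneg) auto
  have est: "norm (L n s \<psi>) \<le> C * A * H ^ n * (h ^ (n + d + k0) * M (n + d + k0))"
    if s: "- 1 < s" "s < \<delta>" and "A \<ge> 0" "weighted W h A d \<psi>" for n s A d \<psi>
    using that(3,4)
  proof (induction n arbitrary: A d \<psi> rule: less_induct)
    case (less n)
    show ?case
    proof (cases "n < m")
      case True
      have "norm (L n s \<psi>) \<le> Cn n * (A * (h ^ (d + k0) * M (d + k0)))"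
      proof (rule Cn(2))
        fix "is" :: "'n list" and x assume *: "length is \<le> k0" "x \<in> W"
        have "norm (pds is \<psi> x) \<le> A * (h ^ (length is + d) * M (length is + d))"
          using weightedD[OF less.prems(2) *(2), of "is"] by (simp add: mult.assoc)
        also have "\<dots> \<le> A * (h ^ (d + k0) * M (d + k0))"
          using *(1) h less.prems(1) by (intro mult_left_mono mult_mono power_increasing M_mono) auto
        finally show "norm (pds is \<psi> x) \<le> A * (h ^ (d + k0) * M (d + k0))" .
      qed (use s \<delta>_pos weighted_smooth[OF less.prems(2)] in auto)
      also have "\<dots> \<le> (C * H ^ n) * (A * (h ^ (n + d + k0) * M (n + d + k0)))"
      proof (intro mult_mono)
        have "Cn n \<le> C" unfolding C_def using True Cn(1) by (intro member_le_sum) auto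
        also have "C \<le> C * H ^ n" using C H(1) by (simp add: mult_le_cancel_left1)
        finally show "Cn n \<le> C * H ^ n" .
      qed (use h C H less.prems(1) in \<open>auto intro!: power_increasing M_mono\<close>)
      finally show ?thesis by (simp add: mult_ac)
    next
      case False
      define N where "N = n - m"
      have n: "n = N + m" using False by (simp add: N_def)
      define X where "X = h ^ (n + d + k0) * M (n + d + k0)"
      have X: "X \<ge> 0" using h by (simp add: X_def)
      have "norm (L n s \<psi>) \<le> (\<Sum>j<m. norm (L (N + j) s (Q j (\<lambda>x. inverse (q x) * \<psi> x))))"
        unfolding n L_recursion[OF weighted_smooth[OF less.prems(2)] s(2)] norm_minus_cancel by (rule norm_sum)
      also have "\<dots> \<le> (\<Sum>j<m. c j * (C * A * H ^ (n - 1) * X))"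
      proof (rule sum_mono)
        fix j assume "j \<in> {..<m}"
        then have j: "j < m" by simp
        have idx: "N + j + (d + (m - j)) + k0 = n + d + k0" using j n by simp
        have "norm (L (N + j) s (Q j (\<lambda>x. inverse (q x) * \<psi> x)))
          \<le> C * (c j * A) * H ^ (N + j) * (h ^ (N + j + (d + (m - j)) + k0) * M (N + j + (d + (m - j)) + k0))"
          using j n c(1)[OF j] less.prems by (intro less.IH Qw) auto
        also have "\<dots> = c j * (C * A * H ^ (N + j) * X)" unfolding idx X_def by (simp add: mult_ac)
        also have "\<dots> \<le> c j * (C * A * H ^ (n - 1) * X)"
          using j n c(1)[OF j] C less.prems(1) H(1) X
          by (intro mult_left_mono mult_right_mono power_increasing mult_nonneg_nonneg) auto
        finally show "norm (L (N + j) s (Q j (\<lambda>x. inverse (q x) * \<psi> x))) \<le> c j * (C * A * H ^ (n - 1) * X)" .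
      qed
      also have "\<dots> = (\<Sum>j<m. c j) * (C * A * H ^ (n - 1) * X)" by (simp add: sum_distrib_right)
      also have "\<dots> \<le> C * A * H ^ n * X"
      \<comment> \<open>If \<open>m = 0\<close>, then \<open>n\<close> may be 0 and
        \<open>n - 1\<close> is truncated; the sum over \<open>j\<close> is then empty.\<close>
      proof (cases "m = 0")
        case True
        then show ?thesis using C less.prems(1) H X by simp
      next
        case False
        then have "n > 0" using n by simp
        then have "H ^ n = H * H ^ (n - 1)" using power_eq_if[of H n] by simp
        moreover have "(\<Sum>j<m. c j) * (C * A * H ^ (n - 1) * X) \<le> H * (C * A * H ^ (n - 1) * X)"
          using C less.prems(1) H X by (intro mult_right_mono mult_nonneg_nonneg) auto
        ultimately show ?thesis by (simp add: mult_ac)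
      qed
      finally show ?thesis unfolding X_def .
    qed
  qed
  obtain D \<tau> where mgD: "\<And>j k. M (j + k) \<le> D * \<tau> ^ (j + k) * M j * M k"
    using mg unfolding moderate_growth_def by blast
  have w: "weighted W h A0 0 \<psi>" using A0 h by (intro weighted_mono[OF A0(3)]) auto
  \<comment> \<open>\<open>moderate_growth\<close> does not fix the signs of its constants; the
    absolute value and the added 1 make the new radius positive.\<close>
  define t where "t = \<bar>\<tau>\<bar> + 1"
  have t: "t > 0" by (simp add: t_def)
  show ?thesis
  proof (rule that[of "H * h * t" "C * A0 * h ^ k0 * \<bar>D\<bar> * t ^ k0 * M k0"])
    fix n s assume s: "- 1 < s" "s < \<delta>"
    have "M (n + k0) \<le> D * \<tau> ^ (n + k0) * M n * M k0" by (rule mgD)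
    also have "\<dots> \<le> \<bar>D\<bar> * t ^ (n + k0) * M n * M k0"
    proof (intro mult_right_mono)
      have "D * \<tau> ^ (n + k0) \<le> \<bar>D\<bar> * \<bar>\<tau>\<bar> ^ (n + k0)"
        by (metis abs_ge_self abs_mult power_abs)
      also have "\<dots> \<le> \<bar>D\<bar> * t ^ (n + k0)"
        by (intro mult_left_mono power_mono) (auto simp: t_def)
      finally show "D * \<tau> ^ (n + k0) \<le> \<bar>D\<bar> * t ^ (n + k0)" .
    qed auto
    finally have Mb: "M (n + k0) \<le> \<bar>D\<bar> * t ^ (n + k0) * M n * M k0" .
    have "norm (L n s \<psi>) \<le> C * A0 * H ^ n * (h ^ (n + 0 + k0) * M (n + 0 + k0))"
      by (rule est[OF s A0(1) w])
    also have "\<dots> \<le> C * A0 * H ^ n * (h ^ (n + k0) * (\<bar>D\<bar> * t ^ (n + k0) * M n * M k0))"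
      using Mb C A0(1) H(1) h by (intro mult_left_mono mult_nonneg_nonneg) auto
    also have "\<dots> = C * A0 * h ^ k0 * \<bar>D\<bar> * t ^ k0 * M k0 * (H * h * t) ^ n * M n"
      by (simp add: power_add power_mult_distrib mult_ac)
    finally show "norm (L n s \<psi>) \<le> C * A0 * h ^ k0 * \<bar>D\<bar> * t ^ k0 * M k0 * (H * h * t) ^ n * M n" .
  qed (use H h t in auto)
qed

section \<open>Vanishing of the pairings and of \<open>u\<close> near \<open>x0\<close>\<close>

lemma L_vanish:
  assumes \<psi>: "denjoy W \<psi>" and s: "0 \<le> s" "s < \<delta>"
  shows "L 0 s \<psi> = 0"
proof -
  obtain C h where Ch: "h > 0" "\<And>n s. - 1 < s \<Longrightarrow> s < \<delta> \<Longrightarrow> norm (L n s \<psi>) \<le> C * h ^ n * M n"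
    by (rule L_estimate[OF \<psi>]) blast
  show ?thesis
  \<comment> \<open>All orders vanish at \<open>- 1 / 2\<close>, a point of the interval on which
    \<open>L_estimate\<close> is valid.\<close>
  proof (rule denjoy_carleman[where g="\<lambda>n s. L n s \<psi>" and a="-1" and b=\<delta> and ?x0.0="- 1 / 2" and h=h and C=C and M=M])
    show "((\<lambda>s. L n s \<psi>) has_vector_derivative L (Suc n) s \<psi>) (at s)" for n s
      by (rule L_derivative[OF denjoy_smooth[OF \<psi>]])
    show "L n (- 1 / 2) \<psi> = 0" for n
      by (rule L_negative[OF denjoy_smooth[OF \<psi>]]) simp
    show "\<not> summable (\<lambda>k. M k / M (Suc k))" using qa by (simp add: quasianalytic_weight_def)
  qed (use Ch s \<delta>_pos M_pos M_log_convex in auto)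
qed

text \<open>Polynomials belong to the class on the bounded set \<open>W\<close>; they approximate
  \<open>\<theta>\<close> together with \<open>k0\<close> derivatives, which is what
  \<open>L_bound\<close> measures. The approximation is by real polynomials, and complex functions
  are split into two parts afterwards.\<close>

lemma L_zero_of_real:
  fixes \<theta> :: "real^'n \<Rightarrow> real"
  assumes \<theta>: "smooth_on UNIV \<theta>" "compact (tsupp \<theta>)" and s: "0 \<le> s" "s < \<delta>"
  shows "L 0 s (\<lambda>x. complex_of_real (\<theta> x)) = 0"
proof -
  obtain C where C: "C \<ge> 0" "\<And>t \<psi> B. \<bar>t\<bar> \<le> s \<Longrightarrow> smooth_on W \<psi> \<Longrightarrow>
      (\<And>is x. length is \<le> k0 \<Longrightarrow> x \<in> W \<Longrightarrow> norm (pds is \<psi> x) \<le> B) \<Longrightarrow> norm (L 0 t \<psi>) \<le> C * B"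
    by (rule L_bound[of s 0]) blast
  have sm\<theta>: "smooth_on W (\<lambda>x. complex_of_real (\<theta> x))"
    by (intro smooth_on_of_real[OF open_ball] smooth_on_subset[OF \<theta>(1)]) auto
  have "norm (L 0 s (\<lambda>x. complex_of_real (\<theta> x))) \<le> C * \<epsilon>" if \<epsilon>: "\<epsilon> > 0" for \<epsilon>
  proof -
    obtain p where p: "real_polynomial_function p"
      "\<And>is x. length is \<le> k0 \<Longrightarrow> x \<in> W \<Longrightarrow> \<bar>pds is \<theta> x - pds is p x\<bar> \<le> \<epsilon>"
      by (rule polynomial_approx_derivatives[OF \<theta> bounded_ball[of x0 r] \<epsilon>, where k=k0]) blast
    have dp: "denjoy W (\<lambda>x. complex_of_real (p x))"
      by (intro denjoy_polynomial p bounded_ball open_ball)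
    have smp: "smooth_on W p" by (rule smooth_on_real_polynomial_function[OF p(1) open_ball])
    have sm: "smooth_on W (\<lambda>x. \<theta> x - p x)"
      by (intro smooth_on_diff smp smooth_on_subset[OF \<theta>(1)]) auto
    have "L 0 s (\<lambda>x. complex_of_real (\<theta> x)) = L 0 s (\<lambda>x. complex_of_real (\<theta> x)) - L 0 s (\<lambda>x. complex_of_real (p x))"
      using L_vanish[OF dp s] by simp
    also have "\<dots> = L 0 s (\<lambda>x. complex_of_real (\<theta> x - p x))"
      unfolding L_def distribution_diff[OF dist test_L[OF sm\<theta>] test_L[OF denjoy_smooth[OF dp]], symmetric]
      by (simp add: algebra_simps)
    also have "norm \<dots> \<le> C * \<epsilon>"
    proof (rule C(2))
      show "smooth_on W (\<lambda>x. complex_of_real (\<theta> x - p x))"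
        by (rule smooth_on_of_real[OF open_ball sm])
      fix "is" :: "'n list" and x assume *: "length is \<le> k0" "x \<in> W"
      have "pds is (\<lambda>x. complex_of_real (\<theta> x - p x)) x = complex_of_real (pds is (\<lambda>x. \<theta> x - p x) x)"
        by (rule pds_linear[OF bounded_linear_of_real open_ball sm *(2)])
      also have "pds is (\<lambda>x. \<theta> x - p x) x = pds is \<theta> x - pds is p x"
        by (rule pds_diff[OF open_ball smooth_on_subset[OF \<theta>(1)] smp *(2)]) simp
      finally show "norm (pds is (\<lambda>x. complex_of_real (\<theta> x - p x)) x) \<le> \<epsilon>"
        using p(2)[OF *] by (simp only: norm_of_real)
    qed (use s in auto)
    finally show ?thesis .
  qed
  then have "norm (L 0 s (\<lambda>x. complex_of_real (\<theta> x))) \<le> \<epsilon>" if "\<epsilon> > 0" for \<epsilon>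
  proof -
    have "C * (\<epsilon> / (C + 1)) \<le> \<epsilon>" using C(1) that by (simp add: field_simps)
    moreover have "norm (L 0 s (\<lambda>x. complex_of_real (\<theta> x))) \<le> C * (\<epsilon> / (C + 1))"
      using C(1) that by (intro \<open>\<And>\<epsilon>. \<epsilon> > 0 \<Longrightarrow> norm (L 0 s (\<lambda>x. complex_of_real (\<theta> x))) \<le> C * \<epsilon>\<close>) auto
    ultimately show ?thesis by linarith
  qed
  then have "norm (L 0 s (\<lambda>x. complex_of_real (\<theta> x))) \<le> 0" by (rule field_le_epsilon[where y=0, simplified])
  then show ?thesis by simp
qed

text \<open>Near \<open>x0\<close> the factor \<open>E 0 s\<close> has no zeros, so every test
  function there is \<open>E 0 s x * (\<kappa> x * \<theta> x)\<close> with a smooth compactly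
  supported \<open>\<theta>\<close>, and the vanishing of \<open>L 0 s\<close> applies to
  it.\<close>

theorem not_in_dsupp: "x0 \<notin> dsupp \<Omega> u"
proof -
  \<comment> \<open>Positive, so that \<open>s + \<rho>\<close> is positive at \<open>x0\<close>;
    below \<open>\<delta>\<close>, where \<open>L 0 s\<close> is known to vanish.\<close>
  define s where "s = \<delta> / 2"
  have s: "0 < s" "s < \<delta>" using \<delta>_pos by (auto simp: s_def)
  define V where "V = ball x0 (r / 3) \<inter> {x. 0 < s + \<rho> x}"
  have V: "open V" "x0 \<in> V" "V \<subseteq> \<Omega>"
  proof -
    have "open {x. 0 < s + \<rho> x}"
      using smooth_on_continuous[OF \<rho>(1)] by (intro open_Collect_less continuous_intros)
    then show "open V" unfolding V_def by auto
    show "x0 \<in> V" using s r \<rho>(2) by (simp add: V_def)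
    show "V \<subseteq> \<Omega>" using r by (force simp: V_def)
  qed
  have "u \<phi> = 0" if \<phi>: "test_fun \<Omega> \<phi>" "tsupp \<phi> \<subseteq> V" for \<phi>
  proof -
    \<comment> \<open>Off \<open>V\<close> this may invert 0, but there \<open>\<phi>\<close> is 0
      and so is the product.\<close>
    define \<theta> where "\<theta> x = \<phi> x * inverse (E 0 s x)" for x
    have Enz: "E 0 s x \<noteq> 0" if "x \<in> V" for x
      using that eta_0_pos[of "s + \<rho> x"] by (simp add: V_def E_def less_imp_neq[symmetric])
    have \<phi>0: "\<phi> x = 0" if "x \<notin> tsupp \<phi>" for x using eq_0_off_tsupp[OF that] .
    have sm: "smooth_on UNIV \<theta>"
    proof -
      have "smooth_on V \<theta>"
        unfolding \<theta>_def[abs_def] using Enz V(1)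
        by (intro smooth_on_mult smooth_on_inverse smooth_on_subset[OF smooth_E] smooth_on_subset[OF test_fun_smooth[OF \<phi>(1)]]) auto
      moreover have "smooth_on (- tsupp \<phi>) \<theta>"
        by (rule smooth_on_cong[of _ "\<lambda>x. 0"]) (use closed_tsupp \<phi>0 smooth_on_const in \<open>auto simp: \<theta>_def\<close>)
      ultimately have "smooth_on (V \<union> - tsupp \<phi>) \<theta>"
        using V(1) closed_tsupp[of \<phi>] by (intro smooth_on_Un) auto
      moreover have "V \<union> - tsupp \<phi> = UNIV" using \<phi>(2) by auto
      ultimately show ?thesis by simp
    qed
    have comp: "compact (tsupp f)" if "\<And>x. \<theta> x = 0 \<Longrightarrow> f x = 0" for f :: "real^'n \<Rightarrow> real"
    proof -
      have "tsupp f \<subseteq> tsupp \<phi>"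
        by (rule tsupp_subset[OF closed_tsupp]) (use that \<phi>0 in \<open>auto simp: \<theta>_def\<close>)
      moreover have "compact (tsupp \<phi>)" using \<phi>(1) by (simp add: test_fun_def)
      ultimately show ?thesis
        using compact_Int_closed[of "tsupp \<phi>" "tsupp f"] closed_tsupp[of f] by (simp add: Int_absorb1)
    qed
    have smRe: "smooth_on UNIV (\<lambda>x. Re (\<theta> x))" and smIm: "smooth_on UNIV (\<lambda>x. Im (\<theta> x))"
      by (rule smooth_on_linear[OF bounded_linear_Re open_UNIV sm], rule smooth_on_linear[OF bounded_linear_Im open_UNIV sm])
    have 0: "L 0 s (\<lambda>x. complex_of_real (Re (\<theta> x))) = 0" "L 0 s (\<lambda>x. complex_of_real (Im (\<theta> x))) = 0"
      using s by (auto intro!: L_zero_of_real smRe smIm comp)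
    have tRe: "test_fun \<Omega> (\<lambda>x. E 0 s x * (\<kappa> x * complex_of_real (Re (\<theta> x))))"
      and tIm: "test_fun \<Omega> (\<lambda>x. E 0 s x * (\<kappa> x * complex_of_real (Im (\<theta> x))))"
      using smooth_on_of_real[OF open_UNIV smRe] smooth_on_of_real[OF open_UNIV smIm]
      by (auto intro!: test_L intro: smooth_on_subset)
    have "\<phi> x = E 0 s x * (\<kappa> x * complex_of_real (Re (\<theta> x))) + \<i> * (E 0 s x * (\<kappa> x * complex_of_real (Im (\<theta> x))))" for x
    proof -
      have "E 0 s x * (\<kappa> x * complex_of_real (Re (\<theta> x))) + \<i> * (E 0 s x * (\<kappa> x * complex_of_real (Im (\<theta> x))))
         = E 0 s x * (\<kappa> x * (complex_of_real (Re (\<theta> x)) + \<i> * complex_of_real (Im (\<theta> x))))"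
        by (simp add: algebra_simps)
      also have "\<dots> = E 0 s x * (\<kappa> x * \<theta> x)" by (simp only: complex_eq[symmetric])
      also have "\<dots> = \<phi> x"
      proof (cases "x \<in> tsupp \<phi>")
        case True
        then have "x \<in> V" using \<phi>(2) by auto
        then show ?thesis using Enz[of x] by (simp add: \<theta>_def \<kappa>(2) V_def dist_commute)
      next
        case False
        then show ?thesis using \<phi>0 by (simp add: \<theta>_def)
      qed
      finally show ?thesis by simp
    qed
    then have "\<phi> = (\<lambda>x. E 0 s x * (\<kappa> x * complex_of_real (Re (\<theta> x))) + \<i> * (E 0 s x * (\<kappa> x * complex_of_real (Im (\<theta> x)))))"
      by blast
    then have "u \<phi> = L 0 s (\<lambda>x. complex_of_real (Re (\<theta> x))) + \<i> * L 0 s (\<lambda>x. complex_of_real (Im (\<theta> x)))"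
      unfolding L_def
      using distribution_add[OF dist tRe test_fun_mult[OF tIm smooth_on_const[of _ \<i>]]] distribution_scale[OF dist tIm, of \<i>]
      by simp
    then show ?thesis using 0 by simp
  qed
  then show ?thesis using V unfolding dsupp_def by blast
qed

end

section \<open>Passage to normals and to their closure\<close>

lemma principal_symbol_minus: "principal_symbol m a x (- \<xi>) = (-1) ^ m * principal_symbol m a x \<xi>"
proof -
  have "(\<Prod>i\<in>UNIV. complex_of_real ((- \<xi>) $ i) ^ \<alpha> i) = (-1) ^ m * (\<Prod>i\<in>UNIV. complex_of_real (\<xi> $ i) ^ \<alpha> i)"
    if "mlen \<alpha> = m" for \<alpha>
  proof -
    have "(\<Prod>i\<in>UNIV. complex_of_real ((- \<xi>) $ i) ^ \<alpha> i) = (\<Prod>i\<in>UNIV. (-1) ^ \<alpha> i * complex_of_real (\<xi> $ i) ^ \<alpha> i)"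
      by (intro prod.cong refl) (simp add: power_minus[of "complex_of_real _"])
    also have "\<dots> = (-1) ^ m * (\<Prod>i\<in>UNIV. complex_of_real (\<xi> $ i) ^ \<alpha> i)"
      using that by (simp add: prod.distrib power_sum[symmetric] mlen_def)
    finally show ?thesis .
  qed
  then show ?thesis
    unfolding principal_symbol_def sum_distrib_left by (intro sum.cong) (auto simp: mult_ac)
qed

lemma continuous_on_principal_symbol:
  fixes f :: "'a::topological_space \<Rightarrow> real^'n::finite"
  assumes "\<And>\<alpha>. mlen \<alpha> = m \<Longrightarrow> continuous_on \<Omega> (a \<alpha>)"
    and "continuous_on S f" "continuous_on S g" "f ` S \<subseteq> \<Omega>"
  shows "continuous_on S (\<lambda>x. principal_symbol m a (f x) (g x))"
  unfolding principal_symbol_def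
  by (intro continuous_on_sum continuous_on_mult continuous_on_prod continuous_on_power continuous_on_of_real
      continuous_on_component assms(3) continuous_on_compose2[OF assms(1) assms(2) assms(4)]) auto

text \<open>\<open>f\<close> is only of class C2 and need not lie in the class of \<open>M\<close>;
  Taylor's bound serves to replace it by a polynomial \<open>\<rho>\<close> with the same
  differential at \<open>x0\<close>.\<close>

lemma principal_symbol_normal:
  fixes u :: "(real^'n::finite \<Rightarrow> complex) \<Rightarrow> complex"
  assumes M: "regular_weight M" "quasianalytic_weight M" "moderate_growth M"
    and \<Omega>: "open \<Omega>" and a: "\<And>\<alpha>. mlen \<alpha> \<le> m \<Longrightarrow> E_M M \<Omega> (a \<alpha>)"
    and u: "distribution \<Omega> u" "solves m a \<Omega> u"
    and N: "(x0, \<xi>) \<in> N_e \<Omega> (dsupp \<Omega> u)"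
  shows "principal_symbol m a x0 \<xi> = 0"
proof (rule ccontr)
  assume nz: "principal_symbol m a x0 \<xi> \<noteq> 0"
  interpret regular_seq M by standard (rule M)
  obtain f :: "real^'n \<Rightarrow> real" where x0: "x0 \<in> dsupp \<Omega> u" and f: "Ck 2 \<Omega> f" "\<And>i. \<xi> $ i = pd i f x0"
    "\<And>y. y \<in> dsupp \<Omega> u \<Longrightarrow> f y \<le> f x0"
    using N by (auto simp: N_e_def C2_on_iff_Ck)
  have x0\<Omega>: "x0 \<in> \<Omega>" using x0 by (auto simp: dsupp_def)
  obtain C r1 where C: "C > 0" and r1: "r1 > 0" "cball x0 r1 \<subseteq> \<Omega>"
    and taylor: "\<And>y. dist y x0 \<le> r1 \<Longrightarrow> \<bar>f y - f x0 - (\<Sum>i\<in>UNIV. pd i f x0 * (y $ i - x0 $ i))\<bar> \<le> C * (dist y x0)\<^sup>2"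
    using C2_taylor[OF \<Omega> f(1) x0\<Omega>] by blast
  \<comment> \<open>On the support \<open>f y \<le> f x0\<close>, so near \<open>x0\<close> the
    linear part is at most \<open>C * (dist y x0)\<^sup>2\<close>; subtracting twice that amount
    leaves at most \<open>- C * (dist y x0)\<^sup>2\<close>.\<close>
  define \<rho> where "\<rho> x = (\<Sum>j\<in>UNIV. \<xi> $ j * (x $ j - x0 $ j) - 2 * C * (x $ j - x0 $ j)\<^sup>2)" for x
  have poly: "real_polynomial_function (\<lambda>x::real^'n. x $ j - x0 $ j)" for j
    by (intro real_polynomial_function_diff real_polynomial_function_component real_polynomial_function.intros(2))
  have poly\<rho>: "real_polynomial_function \<rho>"
    unfolding \<rho>_def[abs_def]
    by (intro real_polynomial_function_sum real_polynomial_function_diff real_polynomial_function.intros(2,4)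
        real_polynomial_function_power poly) auto
  have pd\<rho>: "pd i \<rho> x = \<xi> $ i - 4 * C * (x $ i - x0 $ i)" for i x
  proof (rule has_pd_imp_pd)
    have "has_pd i (\<lambda>x. \<xi> $ j * (x $ j - x0 $ j) - 2 * C * (x $ j - x0 $ j)\<^sup>2)
       (if j = i then \<xi> $ i - 4 * C * (x $ i - x0 $ i) else 0) x" for j
      unfolding has_pd_def has_real_derivative_iff_has_vector_derivative[symmetric]
      by (auto intro!: derivative_eq_intros simp: axis_def)
    then have "has_pd i \<rho> (\<Sum>j\<in>UNIV. if j = i then \<xi> $ i - 4 * C * (x $ i - x0 $ i) else 0) x"
      unfolding \<rho>_def[abs_def] has_pd_def by (intro has_vector_derivative_sum)
    then show "has_pd i \<rho> (\<xi> $ i - 4 * C * (x $ i - x0 $ i)) x" by simp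
  qed
  have polypd: "real_polynomial_function (pd i \<rho>)" for i
    unfolding pd\<rho>[abs_def]
    by (intro real_polynomial_function_diff real_polynomial_function.intros(2,4) poly)
  define p where "p x = principal_symbol m a x (\<chi> i. pd i \<rho> x)" for x
  have acont: "continuous_on \<Omega> (a \<alpha>)" if "mlen \<alpha> = m" for \<alpha>
    using a[of \<alpha>] that by (auto simp: E_M_def intro: smooth_on_continuous)
  have "continuous_on \<Omega> p"
    unfolding p_def[abs_def]
    by (intro continuous_on_principal_symbol[where \<Omega>=\<Omega>] acont continuous_on_vec_lambda continuous_on_id)
       (auto simp: pd\<rho>[abs_def] intro!: continuous_intros)
  moreover have p0: "p x0 = principal_symbol m a x0 \<xi>"
    by (simp add: p_def pd\<rho>)
  ultimately obtain d where d: "d > 0" "\<And>x. x \<in> \<Omega> \<Longrightarrow> dist x x0 < d \<Longrightarrow> dist (p x) (p x0) < norm (p x0) / 2"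
    unfolding continuous_on_iff using x0\<Omega> nz by (metis half_gt_zero zero_less_norm_iff)
  \<comment> \<open>\<open>d\<close> keeps the symbol away from 0; \<open>r1\<close> gives the
    Taylor bound and a compact subset of \<open>\<Omega>\<close> on which the coefficients are
    estimated.\<close>
  define r where "r = min d r1"
  have r: "r > 0" "ball x0 r \<subseteq> cball x0 r1" "ball x0 r \<subseteq> \<Omega>" using d r1 by (auto simp: r_def)
  have "noncharacteristic M \<Omega> m a u x0 r C \<rho>"
  proof
    show "denjoy (ball x0 r) (a \<alpha>)" if "mlen \<alpha> \<le> m" for \<alpha>
      by (rule denjoy_E_M[OF a[OF that] compact_cball r1(2) \<Omega> r(2)])
    show "smooth_on UNIV \<rho>" by (rule smooth_on_real_polynomial_function[OF poly\<rho> open_UNIV])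
    show "\<rho> x0 = 0" by (simp add: \<rho>_def)
    show "denjoy (ball x0 r) (\<lambda>x. complex_of_real (pd i \<rho> x))" for i
      by (rule denjoy_polynomial[OF polypd bounded_ball open_ball])
    show "\<exists>c>0. \<forall>x\<in>ball x0 r. c \<le> norm (principal_symbol m a x (\<chi> i. pd i \<rho> x))"
    proof (intro exI conjI ballI)
      show "norm (p x0) / 2 > 0" using nz p0 by simp
      fix x assume "x \<in> ball x0 r"
      then have "dist (p x) (p x0) < norm (p x0) / 2" using r by (intro d) (auto simp: dist_commute r_def)
      then have "norm (p x0) / 2 \<le> norm (p x)"
        using norm_triangle_ineq2[of "p x0" "p x"] by (simp add: dist_norm norm_minus_commute)
      then show "norm (p x0) / 2 \<le> norm (principal_symbol m a x (\<chi> i. pd i \<rho> x))" by (simp add: p_def)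
    qed
    show "\<rho> y \<le> - C * (dist y x0)\<^sup>2" if "y \<in> dsupp \<Omega> u" "y \<in> ball x0 r" for y
    proof -
      have "dist y x0 \<le> r1" using that r by (auto simp: dist_commute)
      from taylor[OF this] have "(\<Sum>i\<in>UNIV. \<xi> $ i * (y $ i - x0 $ i)) \<le> C * (dist y x0)\<^sup>2"
        using f(3)[OF that(1)] by (simp add: f(2))
      then show ?thesis
        by (simp add: \<rho>_def sum_subtractf sum_distrib_left[symmetric] dist_power2_eq_sum)
    qed
  qed (use M u r C in auto)
  then show False using noncharacteristic.not_in_dsupp x0 by blast
qed

text \<open>The symbol is continuous in both variables and vanishes on all normals, on the interior
  ones by homogeneity; limits over \<open>\<Omega>\<close> inherit this. The closure is meant in the
  cotangent bundle of \<open>\<Omega>\<close> without the zero section, hence the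
  intersection.\<close>

theorem mainTheorem14:
  fixes M :: "nat \<Rightarrow> real"
    and \<Omega> :: "(real^'n::finite) set"
    and m :: nat
    and a :: "('n \<Rightarrow> nat) \<Rightarrow> real^'n \<Rightarrow> complex"
    and u :: "(real^'n \<Rightarrow> complex) \<Rightarrow> complex"
  assumes "regular_weight M" and "quasianalytic_weight M" and "moderate_growth M"
    and "open \<Omega>"
    and "\<And>\<alpha>. mlen \<alpha> \<le> m \<Longrightarrow> E_M M \<Omega> (a \<alpha>)"
    and "distribution \<Omega> u"
    and "solves m a \<Omega> u"
  shows "closure (N_normal \<Omega> (dsupp \<Omega> u)) \<inter> (\<Omega> \<times> (UNIV - {0})) \<subseteq> Char m a \<Omega>"
proof
  fix z assume "z \<in> closure (N_normal \<Omega> (dsupp \<Omega> u)) \<inter> (\<Omega> \<times> (UNIV - {0}))"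
  then obtain x \<xi> where z: "z = (x, \<xi>)" "x \<in> \<Omega>" "\<xi> \<noteq> 0" "(x, \<xi>) \<in> closure (N_normal \<Omega> (dsupp \<Omega> u))"
    by auto
  let ?p = "\<lambda>z. principal_symbol m a (fst z) (snd z)"
  obtain s where s: "\<And>n. s n \<in> N_normal \<Omega> (dsupp \<Omega> u)" "s \<longlonglongrightarrow> (x, \<xi>)"
    using z(4) unfolding closure_sequential by blast
  have N: "?p w = 0 \<and> w \<in> \<Omega> \<times> UNIV" if "w \<in> N_normal \<Omega> (dsupp \<Omega> u)" for w
  proof -
    obtain y \<eta> where w: "w = (y, \<eta>)" by (cases w)
    have "(y, \<eta>) \<in> N_e \<Omega> (dsupp \<Omega> u) \<or> (y, - \<eta>) \<in> N_e \<Omega> (dsupp \<Omega> u)"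
      using that by (auto simp: w N_normal_def N_i_def)
    moreover from this have "y \<in> \<Omega>" by (auto simp: N_e_def dsupp_def)
    moreover have "principal_symbol m a y \<eta> = 0" if "(y, - \<eta>) \<in> N_e \<Omega> (dsupp \<Omega> u)"
      using principal_symbol_normal[OF assms that] principal_symbol_minus[of m a y \<eta>] by simp
    ultimately show ?thesis using principal_symbol_normal[OF assms] by (auto simp: w)
  qed
  have "continuous_on (\<Omega> \<times> UNIV) ?p"
    by (rule continuous_on_principal_symbol[where \<Omega>=\<Omega>])
       (use assms(5) in \<open>auto simp: E_M_def intro!: smooth_on_continuous continuous_intros\<close>)
  then have "(?p \<circ> s) \<longlonglongrightarrow> ?p (x, \<xi>)"
    unfolding continuous_on_sequentially using s N z(2) by blast
  moreover have "?p \<circ> s = (\<lambda>n. 0)" using s(1) N by auto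
  ultimately have "?p (x, \<xi>) = 0" using LIMSEQ_unique[OF tendsto_const] by metis
  then show "z \<in> Char m a \<Omega>" using z by (simp add: Char_def)
qed

end
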